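(* Let $F\in\mathcal{O}_K[x,y,z]$ be a non-singular ternary cubic form with $v(F)=0$ and positive level. Then: (i) the singular locus of the reduction, $\mathcal{S}=\{(x:y:z)\in\mathbb{P}^2(\overline{k}): F\equiv\partial F/\partial x\equiv\partial F/\partial y\equiv\partial F/\partial z\equiv0\pmod{\pi}\}$, is either a point or a line, and is defined over $k$; (ii) the following procedure replaces $F$ by a $K$-equivalent integral ternary cubic of the same level: apply a linear substitution with matrix in $GL_3(\mathcal{O}_K)$ moving $\mathcal{S}$ to the point $(1:0:0)$, respectively to the line $\{z=0\}$, and then replace $F(x,y,z)$ by $\pi F(\pi^{-1}x,y,z)$, respectively by $\pi^{-1}F(x,y,\pi z)$; (iii) if $F$ is non-minimal, then at most $4$ iterations of the procedure in (ii) produce a ternary cubic $F$ with $v(F)\geq1$.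
   Context: $K$ is a field with normalised discrete valuation $v:K^\times\to\mathbb{Z}$, valuation ring $\mathcal{O}_K$, uniformiser $\pi$, and perfect residue field $k=\mathcal{O}_K/\pi\mathcal{O}_K$. For a form $F$, $v(F)$ is the minimum valuation of its coefficients. Ternary cubics $F,F'$ over $K$ are $K$-equivalent if $F'=\mu F(\sum_im_{i1}x_i,\sum_im_{i2}x_i,\sum_im_{i3}x_i)$ with $\mu\in K^\times$, $(m_{ij})\in GL_3(K)$. Invariants: with $H(F)$ the determinant of the $3\times3$ matrix of second partial derivatives of $F$, $c_4(F),c_6(F)$ are defined by $H(H(F))=48c_4(F)^2F+16c_6(F)H(F)$, the sign of $c_4$ chosen so that $\Delta(F)=(c_4^3-c_6^2)/1728$ is an integer-coefficient polynomial in the coefficients of $F$. $F$ is non-singular if $\Delta(F)\neq0$; then $\{F=0\}$ is a smooth genus one curve whose Jacobian $E$ has minimal discriminant $\Delta_E$ over $K$, and $v(\Delta(F))=v(\Delta_E)+12\ell$ with $\ell\in\mathbb{Z}$ the level of $F$. $F$ is integral if its coefficients lie in $\mathcal{O}_K$; an integral $F$ is minimal if $v(\Delta(F))$ is minimal among integral ternary cubics $K$-equivalent to $F$, and non-minimal otherwise. *)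

theory Defs
  imports "HOL-Computational_Algebra.Polynomial"
begin

text \<open>A normalised discrete valuation on the field K (type 'a), given on nonzero
  elements (the value at 0 is irrelevant; 0 counts as having valuation +infinity).\<close>
definition discrete_valuation :: "('a::field \<Rightarrow> int) \<Rightarrow> bool" where
  "discrete_valuation v \<longleftrightarrow>
     (\<forall>x y. x \<noteq> 0 \<longrightarrow> y \<noteq> 0 \<longrightarrow> v (x * y) = v x + v y) \<and>
     (\<forall>x y. x \<noteq> 0 \<longrightarrow> y \<noteq> 0 \<longrightarrow> x + y \<noteq> 0 \<longrightarrow> min (v x) (v y) \<le> v (x + y)) \<and>
     (\<exists>x. x \<noteq> 0 \<and> v x = 1)"

definition val_ge :: "('a::field \<Rightarrow> int) \<Rightarrow> int \<Rightarrow> 'a \<Rightarrow> bool" where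
  "val_ge v n x \<longleftrightarrow> x = 0 \<or> n \<le> v x"

definition integral :: "('a::field \<Rightarrow> int) \<Rightarrow> 'a \<Rightarrow> bool" where
  "integral v x \<longleftrightarrow> val_ge v 0 x"

definition uniformiser :: "('a::field \<Rightarrow> int) \<Rightarrow> 'a \<Rightarrow> bool" where
  "uniformiser v p \<longleftrightarrow> p \<noteq> 0 \<and> v p = 1"

definition residue_map :: "('a::field \<Rightarrow> int) \<Rightarrow> ('a \<Rightarrow> 'k::field) \<Rightarrow> bool" where
  "residue_map v red \<longleftrightarrow>
     (\<forall>x y. integral v x \<longrightarrow> integral v y \<longrightarrow>
        red (x + y) = red x + red y \<and> red (x * y) = red x * red y) \<and>
     red 1 = 1 \<and>
     (\<forall>x. integral v x \<longrightarrow> (red x = 0 \<longleftrightarrow> val_ge v 1 x)) \<and>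
     (\<forall>c. \<exists>x. integral v x \<and> red x = c)"

definition perfect_field :: "'k::field itself \<Rightarrow> bool" where
  "perfect_field _ \<longleftrightarrow> CHAR('k) = 0 \<or> (\<forall>y::'k. \<exists>x. x ^ CHAR('k) = y)"

definition algebraic_closure :: "('k::field \<Rightarrow> 'c::field) \<Rightarrow> bool" where
  "algebraic_closure emb \<longleftrightarrow>
     (\<forall>x y. emb (x + y) = emb x + emb y \<and> emb (x * y) = emb x * emb y) \<and> emb 1 = 1 \<and>
     (\<forall>p :: 'c poly. 0 < degree p \<longrightarrow> (\<exists>z. poly p z = 0)) \<and>
     (\<forall>z :: 'c. \<exists>p :: 'k poly. p \<noteq> 0 \<and> poly (map_poly emb p) z = 0)"

text \<open>A ternary form is given by its coefficient function: F (i,j,k) is the coefficient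
  of x^i y^j z^k.\<close>
type_synonym 'a tform = "nat \<times> nat \<times> nat \<Rightarrow> 'a"

definition ternary_cubic :: "'a::zero tform \<Rightarrow> bool" where
  "ternary_cubic F \<longleftrightarrow> (\<forall>i j k. i + j + k \<noteq> 3 \<longrightarrow> F (i,j,k) = 0)"

definition tf_eval :: "'a::comm_semiring_1 tform \<Rightarrow> 'a \<times> 'a \<times> 'a \<Rightarrow> 'a" where
  "tf_eval F X = (case X of (x, y, z) \<Rightarrow>
     (\<Sum>i\<le>3. \<Sum>j\<le>3. \<Sum>k\<le>3. F (i,j,k) * x ^ i * y ^ j * z ^ k))"

definition tf_dx :: "'a::comm_semiring_1 tform \<Rightarrow> 'a tform" where
  "tf_dx F = (\<lambda>(i,j,k). of_nat (Suc i) * F (Suc i, j, k))"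
definition tf_dy :: "'a::comm_semiring_1 tform \<Rightarrow> 'a tform" where
  "tf_dy F = (\<lambda>(i,j,k). of_nat (Suc j) * F (i, Suc j, k))"
definition tf_dz :: "'a::comm_semiring_1 tform \<Rightarrow> 'a tform" where
  "tf_dz F = (\<lambda>(i,j,k). of_nat (Suc k) * F (i, j, Suc k))"

definition tf_mult :: "'a::comm_semiring_1 tform \<Rightarrow> 'a tform \<Rightarrow> 'a tform" where
  "tf_mult f g = (\<lambda>(n1,n2,n3). \<Sum>i\<le>n1. \<Sum>j\<le>n2. \<Sum>k\<le>n3.
                    f (i,j,k) * g (n1 - i, n2 - j, n3 - k))"

definition tf_one :: "'a::comm_semiring_1 tform" where
  "tf_one = (\<lambda>n. if n = (0,0,0) then 1 else 0)"

primrec tf_pow :: "'a::comm_semiring_1 tform \<Rightarrow> nat \<Rightarrow> 'a tform" where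
  "tf_pow f 0 = tf_one"
| "tf_pow f (Suc n) = tf_mult f (tf_pow f n)"

definition tf_lin :: "'a::comm_semiring_1 \<Rightarrow> 'a \<Rightarrow> 'a \<Rightarrow> 'a tform" where
  "tf_lin a b c = (\<lambda>n. if n = (1,0,0) then a else if n = (0,1,0) then b
                        else if n = (0,0,1) then c else 0)"

text \<open>3x3 matrices are functions M i j with indices i, j in {0,1,2}
  (M i j is the entry m_{i+1,j+1}).\<close>
definition det3 :: "(nat \<Rightarrow> nat \<Rightarrow> 'a::comm_ring_1) \<Rightarrow> 'a" where
  "det3 M = M 0 0 * M 1 1 * M 2 2 + M 0 1 * M 1 2 * M 2 0 + M 0 2 * M 1 0 * M 2 1
          - M 0 0 * M 1 2 * M 2 1 - M 0 1 * M 1 0 * M 2 2 - M 0 2 * M 1 1 * M 2 0"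

text \<open>Linear substitution: tf_subst F M is the form
  F(sum_i m_{i1} x_i, sum_i m_{i2} x_i, sum_i m_{i3} x_i).\<close>
definition tf_subst :: "'a::comm_semiring_1 tform \<Rightarrow> (nat \<Rightarrow> nat \<Rightarrow> 'a) \<Rightarrow> 'a tform" where
  "tf_subst F M = (let l = (\<lambda>j. tf_lin (M 0 j) (M 1 j) (M 2 j)) in
     (\<lambda>n. \<Sum>i\<le>3. \<Sum>j\<le>3. \<Sum>k\<le>3.
        F (i,j,k) * tf_mult (tf_pow (l 0) i) (tf_mult (tf_pow (l 1) j) (tf_pow (l 2) k)) n))"

definition tc_equiv :: "'a::field tform \<Rightarrow> 'a tform \<Rightarrow> bool" where
  "tc_equiv F' F \<longleftrightarrow> (\<exists>\<mu> M. \<mu> \<noteq> 0 \<and> det3 M \<noteq> 0 \<and> F' = (\<lambda>n. \<mu> * tf_subst F M n))"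

definition GL3_O :: "('a::field \<Rightarrow> int) \<Rightarrow> (nat \<Rightarrow> nat \<Rightarrow> 'a) \<Rightarrow> bool" where
  "GL3_O v M \<longleftrightarrow> (\<forall>i<3. \<forall>j<3. integral v (M i j)) \<and> det3 M \<noteq> 0 \<and> v (det3 M) = 0"

definition form_val_ge :: "('a::field \<Rightarrow> int) \<Rightarrow> int \<Rightarrow> 'a tform \<Rightarrow> bool" where
  "form_val_ge v n F \<longleftrightarrow> (\<forall>m. val_ge v n (F m))"

definition form_integral :: "('a::field \<Rightarrow> int) \<Rightarrow> 'a tform \<Rightarrow> bool" where
  "form_integral v F \<longleftrightarrow> form_val_ge v 0 F"

definition form_val_zero :: "('a::field \<Rightarrow> int) \<Rightarrow> 'a tform \<Rightarrow> bool" where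
  "form_val_zero v F \<longleftrightarrow> form_val_ge v 0 F \<and> \<not> form_val_ge v 1 F"

text \<open>Coefficient names: cxxy is the coefficient of x^2 y, etc.
  tc_c4 and tc_c6 are the invariants c4, c6 defined by H(H(F)) = 48 c4^2 F + 16 c6 H(F)
  (sign of c4 normalised so that (c4^3-c6^2)/1728 has integer coefficients).
  tc_ainv F = (a1,a2,a3,a4,a6) is the Artin--Rodriguez-Villegas--Tate Weierstrass
  model of the Jacobian E of {F = 0}; it has c4(a) = c4(F), c6(a) = c6(F), and its
  discriminant equals Delta(F) = (c4^3 - c6^2)/1728 as integer polynomials.\<close>

definition tc_ainv :: "'a::comm_ring_1 tform \<Rightarrow> 'a \<times> 'a \<times> 'a \<times> 'a \<times> 'a" where
  "tc_ainv F = (let cxxx = F (3,0,0); cyyy = F (0,3,0); czzz = F (0,0,3);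
         cxxy = F (2,1,0); cxxz = F (2,0,1); cxyy = F (1,2,0);
         cyyz = F (0,2,1); cxzz = F (1,0,2); cyzz = F (0,1,2); cxyz = F (1,1,1)
     in (cxyz,
   - (cxyy * cxzz) - cxxz * cyyz - cxxy * cyzz,
   - (cxxz * cxyy * cyzz) - cxxy * cyyz * cxzz - czzz * cxxy * cxyy - cyyy * cxxz * cxzz - cxxx * cyyz * cyzz + 9 * cxxx * cyyy * czzz,
   cxxz * cxyy * cyyz * cxzz + cxxy * cxyy * cxzz * cyzz + cxxy * cxxz * cyyz * cyzz + czzz * cxxz * cxyy ^ 2 + czzz * cxxy ^ 2 * cyyz + cyyy * cxxz ^ 2 * cyzz + cyyy * cxxy * cxzz ^ 2 - 3 * cyyy * czzz * cxxy * cxxz + cxxx * cyyz ^ 2 * cxzz + cxxx * cxyy * cyzz ^ 2 - 3 * cxxx * czzz * cxyy * cyyz - 3 * cxxx * cyyy * cxzz * cyzz,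
   - (cxxy * cxxz * cxyy * cyyz * cxzz * cyzz) - czzz * cxxz ^ 2 * cxyy ^ 2 * cyyz + czzz * cxxy * cxxz * cxyy * cyyz * cxyz - czzz * cxxy * cxxz * cxyy ^ 2 * cyzz - czzz * cxxy ^ 2 * cxyy * cyyz * cxzz - czzz * cxxy ^ 2 * cxxz * cyyz ^ 2 - cyyy * cxxz ^ 2 * cxyy * cxzz * cyzz + cyyy * cxxy * cxxz * cxzz * cyzz * cxyz - cyyy * cxxy * cxxz * cyyz * cxzz ^ 2 - cyyy * cxxy * cxxz ^ 2 * cyzz ^ 2 - cyyy * cxxy ^ 2 * cxzz ^ 2 * cyzz + cyyy * czzz * cxxz ^ 2 * cxyy * cxyz - cyyy * czzz * cxxy * cxxz * cxyz ^ 2 - cyyy * czzz * cxxy * cxxz * cxyy * cxzz + 2 * cyyy * czzz * cxxy * cxxz ^ 2 * cyyz + cyyy * czzz * cxxy ^ 2 * cxzz * cxyz + 2 * cyyy * czzz * cxxy ^ 2 * cxxz * cyzz - cyyy * czzz ^ 2 * cxxy ^ 3 - cyyy ^ 2 * czzz * cxxz ^ 3 + cxxx * cxyy * cyyz * cxzz * cyzz * cxyz - cxxx * cxyy * cyyz ^ 2 * cxzz ^ 2 - cxxx * cxyy ^ 2 * cxzz * cyzz ^ 2 - cxxx * cxxz * cxyy * cyyz * cyzz ^ 2 - cxxx * cxxy * cyyz ^ 2 * cxzz * cyzz - cxxx * czzz * cxyy * cyyz * cxyz ^ 2 + cxxx * czzz * cxyy ^ 2 * cyzz * cxyz + 2 *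 cxxx * czzz * cxyy ^ 2 * cyyz * cxzz + 2 * cxxx * czzz * cxxz * cxyy * cyyz ^ 2 + cxxx * czzz * cxxy * cyyz ^ 2 * cxyz - cxxx * czzz * cxxy * cxyy * cyyz * cyzz - cxxx * czzz ^ 2 * cxyy ^ 3 - cxxx * cyyy * cxzz * cyzz * cxyz ^ 2 + cxxx * cyyy * cyyz * cxzz ^ 2 * cxyz + 2 * cxxx * cyyy * cxyy * cxzz ^ 2 * cyzz + cxxx * cyyy * cxxz * cyzz ^ 2 * cxyz - cxxx * cyyy * cxxz * cyyz * cxzz * cyzz + 2 * cxxx * cyyy * cxxy * cxzz * cyzz ^ 2 + cxxx * cyyy * czzz * cxyz ^ 3 - 3 * cxxx * cyyy * czzz * cxyy * cxzz * cxyz - 3 * cxxx * cyyy * czzz * cxxz * cyyz * cxyz + 3 * cxxx * cyyy * czzz * cxxz * cxyy * cyzz - 3 * cxxx * cyyy * czzz * cxxy * cyzz * cxyz + 3 * cxxx * cyyy * czzz * cxxy * cyyz * cxzz + 9 * cxxx * cyyy * czzz ^ 2 * cxxy * cxyy - cxxx * cyyy ^ 2 * cxzz ^ 3 + 9 * cxxx * cyyy ^ 2 * czzz * cxxz * cxzz - cxxx ^ 2 * czzz * cyyz ^ 3 - cxxx ^ 2 * cyyy * cyzz ^ 3 + 9 * cxxx ^ 2 * cyyy * czzz * cyyz * cyzz - 27 * cxxx ^ 2 * cyyy ^ 2 * czzz ^ 2))"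

definition tc_c4 :: "'a::comm_ring_1 tform \<Rightarrow> 'a" where
  "tc_c4 F = (let cxxx = F (3,0,0); cyyy = F (0,3,0); czzz = F (0,0,3);
         cxxy = F (2,1,0); cxxz = F (2,0,1); cxyy = F (1,2,0);
         cyyz = F (0,2,1); cxzz = F (1,0,2); cyzz = F (0,1,2); cxyz = F (1,1,1)
     in (cxyz ^ 4 - 8 * cxyy * cxzz * cxyz ^ 2 + 16 * cxyy ^ 2 * cxzz ^ 2 - 8 * cxxz * cyyz * cxyz ^ 2 + 24 * cxxz * cxyy * cyzz * cxyz - 16 * cxxz * cxyy * cyyz * cxzz + 16 * cxxz ^ 2 * cyyz ^ 2 - 8 * cxxy * cyzz * cxyz ^ 2 + 24 * cxxy * cyyz * cxzz * cxyz - 16 * cxxy * cxyy * cxzz * cyzz - 16 * cxxy * cxxz * cyyz * cyzz + 16 * cxxy ^ 2 * cyzz ^ 2 - 48 * czzz * cxxz * cxyy ^ 2 + 24 * czzz * cxxy * cxyy * cxyz - 48 * czzz * cxxy ^ 2 * cyyz + 24 * cyyy * cxxz * cxzz * cxyz - 48 * cyyy * cxxz ^ 2 * cyzz - 48 * cyyy * cxxy * cxzz ^ 2 + 144 * cyyy * czzz * cxxy * cxxz + 24 * cxxx * cyyz * cyzz * cxyz - 48 * cxxx * cyyz ^ 2 * cxzz - 48 * cxxx * cxyy * cyzz ^ 2 + 144 * cxxx * czzz * cxyy * cyyz + 144 * cxxx * cyyy * cxzz * cyzz - 216 * cxxx * cyyy * czzz * cxyz))"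

definition tc_c6 :: "'a::comm_ring_1 tform \<Rightarrow> 'a" where
  "tc_c6 F = (let cxxx = F (3,0,0); cyyy = F (0,3,0); czzz = F (0,0,3);
         cxxy = F (2,1,0); cxxz = F (2,0,1); cxyy = F (1,2,0);
         cyyz = F (0,2,1); cxzz = F (1,0,2); cyzz = F (0,1,2); cxyz = F (1,1,1)
     in (- (cxyz ^ 6) + 12 * cxyy * cxzz * cxyz ^ 4 - 48 * cxyy ^ 2 * cxzz ^ 2 * cxyz ^ 2 + 64 * cxyy ^ 3 * cxzz ^ 3 + 12 * cxxz * cyyz * cxyz ^ 4 - 36 * cxxz * cxyy * cyzz * cxyz ^ 3 - 24 * cxxz * cxyy * cyyz * cxzz * cxyz ^ 2 + 144 * cxxz * cxyy ^ 2 * cxzz * cyzz * cxyz - 96 * cxxz * cxyy ^ 2 * cyyz * cxzz ^ 2 - 48 * cxxz ^ 2 * cyyz ^ 2 * cxyz ^ 2 + 144 * cxxz ^ 2 * cxyy * cyyz * cyzz * cxyz - 96 * cxxz ^ 2 * cxyy * cyyz ^ 2 * cxzz - 216 * cxxz ^ 2 * cxyy ^ 2 * cyzz ^ 2 + 64 * cxxz ^ 3 * cyyz ^ 3 + 12 * cxxy * cyzz * cxyz ^ 4 - 36 * cxxy * cyyz * cxzz * cxyz ^ 3 - 24 * cxxy * cxyy * cxzz * cyzz * cxyz ^ 2 + 144 * cxxy * cxyy * cyyz * cxzz ^ 2 * cxyz - 96 * cxxy * cxyy ^ 2 * cxzz ^ 2 * cyzz - 24 * cxxy * cxxz * cyyz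 * cyzz * cxyz ^ 2 + 144 * cxxy * cxxz * cyyz ^ 2 * cxzz * cxyz + 144 * cxxy * cxxz * cxyy * cyzz ^ 2 * cxyz - 48 * cxxy * cxxz * cxyy * cyyz * cxzz * cyzz - 96 * cxxy * cxxz ^ 2 * cyyz ^ 2 * cyzz - 48 * cxxy ^ 2 * cyzz ^ 2 * cxyz ^ 2 + 144 * cxxy ^ 2 * cyyz * cxzz * cyzz * cxyz - 216 * cxxy ^ 2 * cyyz ^ 2 * cxzz ^ 2 - 96 * cxxy ^ 2 * cxyy * cxzz * cyzz ^ 2 - 96 * cxxy ^ 2 * cxxz * cyyz * cyzz ^ 2 + 64 * cxxy ^ 3 * cyzz ^ 3 + 72 * czzz * cxxz * cxyy ^ 2 * cxyz ^ 2 - 288 * czzz * cxxz * cxyy ^ 3 * cxzz + 576 * czzz * cxxz ^ 2 * cxyy ^ 2 * cyyz - 36 * czzz * cxxy * cxyy * cxyz ^ 3 + 144 * czzz * cxxy * cxyy ^ 2 * cxzz * cxyz - 720 * czzz * cxxy * cxxz * cxyy * cyyz * cxyz + 144 * czzz * cxxy * cxxz * cxyy ^ 2 * cyzz + 72 * czzz * cxxy ^ 2 * cyyz * cxyz ^ 2 + 144 * czzz * cxxy ^ 2 * cxyy * cyzz * cxyz + 144 * czzz * cxxy ^ 2 * cxyy * cyyz * cxzz + 576 * czzz * cxxy ^ 2 * cxxz * cyyz ^ 2 - 288 * czzz * cxxy ^ 3 * cyyz * cyzz - 216 * czzz ^ 2 * cxxy ^ 2 * cxyy ^ 2 - 36 *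 cyyy * cxxz * cxzz * cxyz ^ 3 + 144 * cyyy * cxxz * cxyy * cxzz ^ 2 * cxyz + 72 * cyyy * cxxz ^ 2 * cyzz * cxyz ^ 2 + 144 * cyyy * cxxz ^ 2 * cyyz * cxzz * cxyz + 144 * cyyy * cxxz ^ 2 * cxyy * cxzz * cyzz - 288 * cyyy * cxxz ^ 3 * cyyz * cyzz + 72 * cyyy * cxxy * cxzz ^ 2 * cxyz ^ 2 - 288 * cyyy * cxxy * cxyy * cxzz ^ 3 - 720 * cyyy * cxxy * cxxz * cxzz * cyzz * cxyz + 144 * cyyy * cxxy * cxxz * cyyz * cxzz ^ 2 + 576 * cyyy * cxxy * cxxz ^ 2 * cyzz ^ 2 + 576 * cyyy * cxxy ^ 2 * cxzz ^ 2 * cyzz - 864 * cyyy * czzz * cxxz ^ 2 * cxyy * cxyz + 648 * cyyy * czzz * cxxy * cxxz * cxyz ^ 2 + 1296 * cyyy * czzz * cxxy * cxxz * cxyy * cxzz - 864 * cyyy * czzz * cxxy * cxxz ^ 2 * cyyz - 864 * cyyy * czzz * cxxy ^ 2 * cxzz * cxyz - 864 * cyyy * czzz * cxxy ^ 2 * cxxz * cyzz + 864 * cyyy * czzz ^ 2 * cxxy ^ 3 - 216 * cyyy ^ 2 * cxxz ^ 2 * cxzz ^ 2 + 864 * cyyy ^ 2 * czzz * cxxz ^ 3 - 36 * cxxx * cyyz * cyzz * cxyz ^ 3 + 72 * cxxx * cyyz ^ 2 * cxzz * cxyz ^ 2 + 72 * cxxx * cxyy * cyzz ^ 2 * cxyz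 ^ 2 - 720 * cxxx * cxyy * cyyz * cxzz * cyzz * cxyz + 576 * cxxx * cxyy * cyyz ^ 2 * cxzz ^ 2 + 576 * cxxx * cxyy ^ 2 * cxzz * cyzz ^ 2 + 144 * cxxx * cxxz * cyyz ^ 2 * cyzz * cxyz - 288 * cxxx * cxxz * cyyz ^ 3 * cxzz + 144 * cxxx * cxxz * cxyy * cyyz * cyzz ^ 2 + 144 * cxxx * cxxy * cyyz * cyzz ^ 2 * cxyz + 144 * cxxx * cxxy * cyyz ^ 2 * cxzz * cyzz - 288 * cxxx * cxxy * cxyy * cyzz ^ 3 + 648 * cxxx * czzz * cxyy * cyyz * cxyz ^ 2 - 864 * cxxx * czzz * cxyy ^ 2 * cyzz * cxyz - 864 * cxxx * czzz * cxyy ^ 2 * cyyz * cxzz - 864 * cxxx * czzz * cxxz * cxyy * cyyz ^ 2 - 864 * cxxx * czzz * cxxy * cyyz ^ 2 * cxyz + 1296 * cxxx * czzz * cxxy * cxyy * cyyz * cyzz + 864 * cxxx * czzz ^ 2 * cxyy ^ 3 + 648 * cxxx * cyyy * cxzz * cyzz * cxyz ^ 2 - 864 * cxxx * cyyy * cyyz * cxzz ^ 2 * cxyz - 864 * cxxx * cyyy * cxyy * cxzz ^ 2 * cyzz - 864 * cxxx * cyyy * cxxz * cyzz ^ 2 * cxyz + 1296 * cxxx * cyyy * cxxz * cyyz * cxzz * cyzz - 864 * cxxx * cyyy * cxxy * cxzz * cyzz ^ 2 - 540 * cxxx * cyyy * czzz * cxyz ^ 3 + 1296 * cxxx * cyyy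 * czzz * cxyy * cxzz * cxyz + 1296 * cxxx * cyyy * czzz * cxxz * cyyz * cxyz + 1296 * cxxx * cyyy * czzz * cxxz * cxyy * cyzz + 1296 * cxxx * cyyy * czzz * cxxy * cyzz * cxyz + 1296 * cxxx * cyyy * czzz * cxxy * cyyz * cxzz - 3888 * cxxx * cyyy * czzz ^ 2 * cxxy * cxyy + 864 * cxxx * cyyy ^ 2 * cxzz ^ 3 - 3888 * cxxx * cyyy ^ 2 * czzz * cxxz * cxzz - 216 * cxxx ^ 2 * cyyz ^ 2 * cyzz ^ 2 + 864 * cxxx ^ 2 * czzz * cyyz ^ 3 + 864 * cxxx ^ 2 * cyyy * cyzz ^ 3 - 3888 * cxxx ^ 2 * cyyy * czzz * cyyz * cyzz + 5832 * cxxx ^ 2 * cyyy ^ 2 * czzz ^ 2))"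

definition w_disc :: "'a::comm_ring_1 \<times> 'a \<times> 'a \<times> 'a \<times> 'a \<Rightarrow> 'a" where
  "w_disc A = (case A of (a1, a2, a3, a4, a6) \<Rightarrow>
     (let b2 = a1\<^sup>2 + 4 * a2; b4 = a1 * a3 + 2 * a4; b6 = a3\<^sup>2 + 4 * a6;
          b8 = a1\<^sup>2 * a6 + 4 * a2 * a6 - a1 * a3 * a4 + a2 * a3\<^sup>2 - a4\<^sup>2
      in - b2\<^sup>2 * b8 - 8 * b4 ^ 3 - 27 * b6\<^sup>2 + 9 * b2 * b4 * b6))"

definition tc_disc :: "'a::comm_ring_1 tform \<Rightarrow> 'a" where
  "tc_disc F = w_disc (tc_ainv F)"

text \<open>Change of Weierstrass coordinates x = u^2 x' + r, y = u^3 y' + s u^2 x' + t.\<close>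
definition w_trans :: "'a::field \<Rightarrow> 'a \<Rightarrow> 'a \<Rightarrow> 'a \<Rightarrow> 'a \<times> 'a \<times> 'a \<times> 'a \<times> 'a
                         \<Rightarrow> 'a \<times> 'a \<times> 'a \<times> 'a \<times> 'a" where
  "w_trans u r s t A = (case A of (a1, a2, a3, a4, a6) \<Rightarrow>
     ((a1 + 2 * s) / u,
      (a2 - s * a1 + 3 * r - s\<^sup>2) / u ^ 2,
      (a3 + r * a1 + 2 * t) / u ^ 3,
      (a4 - s * a3 + 2 * r * a2 - (t + r * s) * a1 + 3 * r\<^sup>2 - 2 * s * t) / u ^ 4,
      (a6 + r * a4 + r\<^sup>2 * a2 + r ^ 3 - t * a3 - t\<^sup>2 - r * t * a1) / u ^ 6))"

definition w_integral :: "('a::field \<Rightarrow> int) \<Rightarrow> 'a \<times> 'a \<times> 'a \<times> 'a \<times> 'a \<Rightarrow> bool" where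
  "w_integral v A = (case A of (a1, a2, a3, a4, a6) \<Rightarrow>
     integral v a1 \<and> integral v a2 \<and> integral v a3 \<and> integral v a4 \<and> integral v a6)"

definition min_disc_val :: "('a::field \<Rightarrow> int) \<Rightarrow> 'a \<times> 'a \<times> 'a \<times> 'a \<times> 'a \<Rightarrow> nat" where
  "min_disc_val v A = (LEAST n. \<exists>u r s t. u \<noteq> 0 \<and> w_integral v (w_trans u r s t A) \<and>
        w_disc (w_trans u r s t A) \<noteq> 0 \<and> v (w_disc (w_trans u r s t A)) = int n)"

text \<open>The level l of F: v(Delta(F)) = v(Delta_E) + 12 l.\<close>
definition tc_level :: "('a::field \<Rightarrow> int) \<Rightarrow> 'a tform \<Rightarrow> int" where
  "tc_level v F = (v (tc_disc F) - int (min_disc_val v (tc_ainv F))) div 12"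

definition tc_minimal :: "('a::field \<Rightarrow> int) \<Rightarrow> 'a tform \<Rightarrow> bool" where
  "tc_minimal v F \<longleftrightarrow> form_integral v F \<and>
     (\<forall>G. form_integral v G \<and> tc_equiv G F \<longrightarrow> v (tc_disc F) \<le> v (tc_disc G))"

definition tc_non_minimal :: "('a::field \<Rightarrow> int) \<Rightarrow> 'a tform \<Rightarrow> bool" where
  "tc_non_minimal v F \<longleftrightarrow> form_integral v F \<and> \<not> tc_minimal v F"

definition tf_red :: "('a \<Rightarrow> 'k) \<Rightarrow> ('k \<Rightarrow> 'c) \<Rightarrow> 'a tform \<Rightarrow> 'c tform" where
  "tf_red red emb F = (\<lambda>n. emb (red (F n)))"

text \<open>The singular locus S in P^2(kbar), represented by its affine cone minus the origin:
  the nonzero (x,y,z) over kbar at which F and its three partial derivatives vanish mod pi.\<close>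
definition sing_locus :: "('a::field \<Rightarrow> 'k::field) \<Rightarrow> ('k \<Rightarrow> 'c::field) \<Rightarrow> 'a tform
                          \<Rightarrow> ('c \<times> 'c \<times> 'c) set" where
  "sing_locus red emb F = (let G = tf_red red emb F in
     {X. X \<noteq> (0,0,0) \<and> tf_eval G X = 0 \<and> tf_eval (tf_dx G) X = 0 \<and>
         tf_eval (tf_dy G) X = 0 \<and> tf_eval (tf_dz G) X = 0})"

text \<open>The projective point (x:y:z) and the projective line {a x + b y + c z = 0},
  as subsets of the affine cone minus the origin.\<close>
definition proj_point :: "'c::field \<times> 'c \<times> 'c \<Rightarrow> ('c \<times> 'c \<times> 'c) set" where
  "proj_point P = (case P of (x, y, z) \<Rightarrow> {(l * x, l * y, l * z) | l. l \<noteq> 0})"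

definition proj_line :: "'c::field \<times> 'c \<times> 'c \<Rightarrow> ('c \<times> 'c \<times> 'c) set" where
  "proj_line L = (case L of (a, b, c) \<Rightarrow>
     {(x, y, z). (x, y, z) \<noteq> (0,0,0) \<and> a * x + b * y + c * z = 0})"

definition map3 :: "('k \<Rightarrow> 'c) \<Rightarrow> 'k \<times> 'k \<times> 'k \<Rightarrow> 'c \<times> 'c \<times> 'c" where
  "map3 f P = (case P of (x, y, z) \<Rightarrow> (f x, f y, f z))"

text \<open>F(x,y,z) \<mapsto> pi F(pi^-1 x, y, z) and F(x,y,z) \<mapsto> pi^-1 F(x, y, pi z).\<close>
definition step_point :: "'a::field \<Rightarrow> 'a tform \<Rightarrow> 'a tform" where
  "step_point p F = (\<lambda>(i,j,k). p powi (1 - int i) * F (i,j,k))"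

definition step_line :: "'a::field \<Rightarrow> 'a tform \<Rightarrow> 'a tform" where
  "step_line p F = (\<lambda>(i,j,k). p powi (int k - 1) * F (i,j,k))"

definition proc_step :: "('a::field \<Rightarrow> int) \<Rightarrow> 'a \<Rightarrow> ('a \<Rightarrow> 'k::field) \<Rightarrow> ('k \<Rightarrow> 'c::field)
                         \<Rightarrow> 'a tform \<Rightarrow> 'a tform \<Rightarrow> bool" where
  "proc_step v p red emb F G \<longleftrightarrow> (\<exists>M. GL3_O v M \<and>
     ((sing_locus red emb (tf_subst F M) = proj_point (1,0,0) \<and> G = step_point p (tf_subst F M)) \<or>
      (sing_locus red emb (tf_subst F M) = proj_line (0,0,1) \<and> G = step_line p (tf_subst F M))))"

end

theory Submission
  imports Defs "HOL-Computational_Algebra.Primes"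
begin

text \<open>
  Positive level means that the Weierstrass equation of the Jacobian attached to \<open>F\<close> can be
  translated by integral \<open>r, s, t\<close> so that \<open>\<pi>\<^sup>i\<close> divides \<open>a\<^sub>i\<close>. In particular its reduction is
  \<open>y\<^sup>2 = x\<^sup>3\<close> up to translation, and a plane cubic over an algebraically closed field with such a
  Jacobian is singular along exactly one point or one line; conjugation shows that this locus is
  rational over the perfect field \<open>k\<close>. When the locus is the point \<open>(1:0:0)\<close>, integrality of the step
  amounts to \<open>\<pi>\<^sup>2\<close> dividing the coefficient of \<open>x\<^sup>3\<close>; this is read off from the divisibility of the
  translated \<open>a\<^sub>3, a\<^sub>4, a\<^sub>6\<close>.

  If \<open>F\<close> is non-minimal, the Smith normal form of a minimising substitution makes \<open>F\<close>
  \<open>GL\<^sub>3(\<O>)\<close>-equivalent to a form whose coefficients at \<open>x\<^sup>i y\<^sup>j z\<^sup>k\<close> have valuation at least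
  \<open>a + b + 1 - a j - b k\<close>, and one may take \<open>(a,b)\<close> among \<open>(0,0), (0,1), (1,1), (1,2), (2,3)\<close>.
  Each step of the procedure moves to a strictly earlier pair in this list, and \<open>(0,0)\<close> means \<open>v(F) \<ge> 1\<close>.
\<close>

section \<open>Evaluation and linear substitution\<close>

text \<open>Residue characteristics 2 and 3 are allowed, where \<open>c4\<close> and
  \<open>c6\<close> are too coarse, so the full Weierstrass equation \<open>tc_ainv\<close> is
  carried along. Its behaviour under linear substitutions is a polynomial identity that is checked
  on transpositions, one shear and diagonal matrices; elimination extends it to all invertible
  matrices. The same elimination, with multipliers restricted to the valuation ring, is the Smith
  normal form.

  The procedure leaves the normalising matrix open, so bounds on individual coefficients cannot be
  followed from one step to the next. What is followed is membership in a class closed under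
  \<open>GL3_O\<close>. Two admissible matrices give \<open>GL3_O\<close>-equivalent results, hence
  each step may be computed with the most convenient one.

  Only the differences of the three Smith exponents matter. The short list of weights results from
  sorting the exponents and asking on which side of the midpoint of the outer two the middle one
  lies. Numbered from 0, the list ends at index 4, which is the bound on the number of
  steps.\<close>

lemma homog_vanish: "ternary_cubic F \<Longrightarrow> i + j + k \<noteq> 3 \<Longrightarrow> F (i,j,k) = 0"
  by (simp add: ternary_cubic_def)

lemma sum_le3: "(\<Sum>i\<le>(3::nat). f i) = f 0 + f 1 + f 2 + f 3" for f :: "nat \<Rightarrow> 'a::comm_monoid_add"
  by (simp add: numeral_3_eq_3 numeral_2_eq_2)

lemma tf_eval_cubic:
  fixes F :: "'a::comm_ring_1 tform"
  assumes "ternary_cubic F"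
  shows "tf_eval F (x,y,z) = F (3,0,0) * x^3 + F (0,3,0) * y^3 + F (0,0,3) * z^3
     + F (2,1,0) * x^2*y + F (2,0,1) * x^2*z + F (1,2,0) * x*y^2 + F (0,2,1) * y^2*z
     + F (1,0,2) * x*z^2 + F (0,1,2) * y*z^2 + F (1,1,1) * x*y*z"
  using assms
  by (simp add: tf_eval_def homog_vanish sum_le3 ac_simps)

definition tf_homog :: "nat \<Rightarrow> 'a::zero tform \<Rightarrow> bool" where
  "tf_homog d F \<longleftrightarrow> (\<forall>i j k. i + j + k \<noteq> d \<longrightarrow> F (i,j,k) = 0)"

text \<open>The left side runs over the triangle \<open>i + m \<le> N\<close>; the terms that
  complete it to a square vanish by hypothesis. This is how a Cauchy product with truncated
  exponents is unfolded.\<close>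

lemma sum_diagonals:
  fixes \<phi> :: "nat \<Rightarrow> nat \<Rightarrow> 'a::comm_monoid_add"
  assumes "\<And>i m. N < i + m \<Longrightarrow> \<phi> i m = 0"
  shows "(\<Sum>n\<le>N. \<Sum>i\<le>n. \<phi> i (n - i)) = (\<Sum>i\<le>N. \<Sum>m\<le>N. \<phi> i m)"
proof -
  have "(\<Sum>n\<le>N. \<Sum>i\<le>n. \<phi> i (n - i)) = (\<Sum>(i,m)\<in>{(i,m). i + m \<le> N}. \<phi> i m)"
    by (simp add: sum.triangle_reindex_eq)
  also have "\<dots> = (\<Sum>(i,m)\<in>{..N} \<times> {..N}. \<phi> i m)"
    by (rule sum.mono_neutral_left) (use assms in \<open>auto simp: not_le[symmetric]\<close>)
  finally show ?thesis by (simp add: sum.cartesian_product)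
qed

text \<open>\<open>tf_eval\<close> cuts every exponent off at 3, so it is multiplicative only while
  no monomial of the product is lost; homogeneity with \<open>d + e \<le> 3\<close> ensures this.
  The sums are rearranged so that the Cauchy products in the three coordinates can be unfolded one
  at a time.\<close>

lemma tf_eval_mult:
  fixes f g :: "'a::comm_semiring_1 tform"
  assumes f: "tf_homog d f" and g: "tf_homog e g" and de: "d + e \<le> 3"
  shows "tf_eval (tf_mult f g) X = tf_eval f X * tf_eval g X"
proof -
  obtain x y z where X: "X = (x,y,z)" by (cases X)
  define h where "h i i' j j' k k' =
    f (i,j,k) * g (i',j',k') * x ^ (i + i') * y ^ (j + j') * z ^ (k + k')" for i i' j j' k k'
  have zero: "h i i' j j' k k' = 0" if "3 < i + i' \<or> 3 < j + j' \<or> 3 < k + k'" for i i' j j' k k'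
  proof -
    have "i + j + k \<noteq> d \<or> i' + j' + k' \<noteq> e" using that de by linarith
    then show ?thesis using f g by (auto simp: h_def tf_homog_def)
  qed
  have swap3: "(\<Sum>n\<le>N. \<Sum>i\<le>a. \<Sum>j\<le>b. \<phi> n i j) = (\<Sum>i\<le>a. \<Sum>j\<le>b. \<Sum>n\<le>N. \<phi> n i j)"
    for N a b :: nat and \<phi> :: "nat \<Rightarrow> nat \<Rightarrow> nat \<Rightarrow> 'a"
    by (subst sum.swap, rule sum.cong[OF refl], rule sum.swap)
  have "tf_eval (tf_mult f g) X = (\<Sum>n1\<le>3. \<Sum>n2\<le>3. \<Sum>n3\<le>3. \<Sum>i\<le>n1. \<Sum>j\<le>n2. \<Sum>k\<le>n3.
      h i (n1 - i) j (n2 - j) k (n3 - k))"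
    unfolding X tf_eval_def tf_mult_def h_def prod.case sum_distrib_right
    by (intro sum.cong refl) simp
  also have "\<dots> = (\<Sum>n1\<le>3. \<Sum>n2\<le>3. \<Sum>i\<le>n1. \<Sum>j\<le>n2. \<Sum>n3\<le>3. \<Sum>k\<le>n3.
      h i (n1 - i) j (n2 - j) k (n3 - k))"
    by (rule sum.cong[OF refl], rule sum.cong[OF refl], rule swap3)
  also have "\<dots> = (\<Sum>n1\<le>3. \<Sum>n2\<le>3. \<Sum>i\<le>n1. \<Sum>j\<le>n2. \<Sum>k\<le>3. \<Sum>k'\<le>3.
      h i (n1 - i) j (n2 - j) k k')"
    by (intro sum.cong refl sum_diagonals zero) auto
  also have "\<dots> = (\<Sum>n1\<le>3. \<Sum>i\<le>n1. \<Sum>n2\<le>3. \<Sum>j\<le>n2. \<Sum>k\<le>3. \<Sum>k'\<le>3.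
      h i (n1 - i) j (n2 - j) k k')"
    by (rule sum.cong[OF refl], rule sum.swap)
  also have "\<dots> = (\<Sum>n1\<le>3. \<Sum>i\<le>n1. \<Sum>j\<le>3. \<Sum>j'\<le>3. \<Sum>k\<le>3. \<Sum>k'\<le>3.
      h i (n1 - i) j j' k k')"
    by (intro sum.cong refl sum_diagonals) (auto simp: zero)
  also have "\<dots> = (\<Sum>i\<le>3. \<Sum>i'\<le>3. \<Sum>j\<le>3. \<Sum>j'\<le>3. \<Sum>k\<le>3. \<Sum>k'\<le>3. h i i' j j' k k')"
    by (intro sum_diagonals) (auto simp: zero)
  also have "\<dots> = (\<Sum>i\<le>3. \<Sum>j\<le>3. \<Sum>k\<le>3. \<Sum>i'\<le>3. \<Sum>j'\<le>3. \<Sum>k'\<le>3. h i i' j j' k k')"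
    by (rule sum.cong[OF refl], subst sum.swap, rule sum.cong[OF refl], rule swap3[symmetric])
  also have "\<dots> = tf_eval g X * tf_eval f X"
    unfolding X tf_eval_def h_def prod.case sum_distrib_right sum_distrib_left
    by (intro sum.cong refl) (simp add: power_add mult_ac)
  finally show ?thesis by (simp add: mult.commute)
qed

lemma tf_homog_mult:
  fixes f g :: "'a::comm_semiring_1 tform"
  assumes f: "tf_homog d f" and g: "tf_homog e g"
  shows "tf_homog (d + e) (tf_mult f g)"
  unfolding tf_homog_def
proof (intro allI impI)
  fix i j k assume n: "i + j + k \<noteq> d + e"
  have "f (i',j',k') * g (i - i', j - j', k - k') = 0"
    if "i' \<le> i" "j' \<le> j" "k' \<le> k" for i' j' k'
  proof -
    have "i' + j' + k' \<noteq> d \<or> (i - i') + (j - j') + (k - k') \<noteq> e" using n that by linarith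
    then show ?thesis using f g by (auto simp: tf_homog_def)
  qed
  then show "tf_mult f g (i,j,k) = 0" by (simp add: tf_mult_def)
qed

lemma tf_homog_lin: "tf_homog 1 (tf_lin a b c)"
  by (auto simp: tf_homog_def tf_lin_def)

lemma tf_homog_one: "tf_homog 0 tf_one"
  by (auto simp: tf_homog_def tf_one_def)

lemma tf_homog_pow_lin: "tf_homog n (tf_pow (tf_lin a b c) n)"
proof (induction n)
  case 0 show ?case by (simp add: tf_homog_one)
next
  case (Suc n)
  then show ?case using tf_homog_mult[OF tf_homog_lin Suc] by simp
qed

lemma tf_eval_lin: "tf_eval (tf_lin a b c) (x,y,z) = a * x + b * y + c * z"
  by (simp add: tf_eval_def tf_lin_def sum_le3 ac_simps)

lemma tf_eval_one: "tf_eval tf_one X = 1"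
  by (cases X) (simp add: tf_eval_def tf_one_def sum_le3)

lemma tf_eval_pow_lin: "n \<le> 3 \<Longrightarrow> tf_eval (tf_pow (tf_lin a b c) n) X = tf_eval (tf_lin a b c) X ^ n"
proof (induction n)
  case 0 show ?case by (simp add: tf_eval_one)
next
  case (Suc n)
  then show ?case
    using tf_eval_mult[OF tf_homog_lin tf_homog_pow_lin, of n a b c a b c X] by simp
qed

text \<open>Points are row vectors: substituting \<open>M\<close> evaluates a form at \<open>X M\<close>, so substituting \<open>A\<close> and then
  \<open>B\<close> is substituting \<open>B A\<close>.\<close>
definition vm :: "'a::comm_semiring_1 \<times> 'a \<times> 'a \<Rightarrow> (nat \<Rightarrow> nat \<Rightarrow> 'a) \<Rightarrow> 'a \<times> 'a \<times> 'a" where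
  "vm X M = (case X of (x,y,z) \<Rightarrow>
     (M 0 0 * x + M 1 0 * y + M 2 0 * z, M 0 1 * x + M 1 1 * y + M 2 1 * z, M 0 2 * x + M 1 2 * y + M 2 2 * z))"

lemma subst_term_homog:
  "tf_homog (i + (j + k)) (tf_mult (tf_pow (tf_lin a b c) i)
      (tf_mult (tf_pow (tf_lin a' b' c') j) (tf_pow (tf_lin a'' b'' c'') k)))"
  by (intro tf_homog_mult tf_homog_pow_lin)

lemma ternary_cubic_subst:
  assumes "ternary_cubic F"
  shows "ternary_cubic (tf_subst F M)"
  unfolding ternary_cubic_def tf_subst_def Let_def
proof (intro allI impI sum.neutral ballI)
  fix n1 n2 n3 i j k :: nat assume n: "n1 + n2 + n3 \<noteq> 3"
  show "F (i,j,k) * tf_mult (tf_pow (tf_lin (M 0 0) (M 1 0) (M 2 0)) i)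
      (tf_mult (tf_pow (tf_lin (M 0 1) (M 1 1) (M 2 1)) j)
        (tf_pow (tf_lin (M 0 2) (M 1 2) (M 2 2)) k)) (n1,n2,n3) = 0"
  proof (cases "i + j + k = 3")
    case True
    then have n': "n1 + n2 + n3 \<noteq> i + (j + k)" using n by simp
    show ?thesis
      using subst_term_homog[unfolded tf_homog_def, rule_format, OF n'] by (metis mult_zero_right)
  qed (use assms in \<open>simp add: homog_vanish\<close>)
qed

lemma tf_eval_sum:
  "tf_eval (\<lambda>n. \<Sum>i\<in>A. f i n) X = (\<Sum>i\<in>A. tf_eval (f i) X)"
proof (cases X)
  case (fields x y z)
  show ?thesis
    unfolding fields tf_eval_def prod.case sum_le3
    by (simp add: sum_distrib_right sum.distrib)
qed

lemma tf_eval_smult: "tf_eval (\<lambda>n. c * f n) X = c * tf_eval f X"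
  by (cases X) (simp add: tf_eval_def sum_distrib_left mult_ac)

text \<open>Where \<open>F\<close> has a nonzero coefficient the linear factors have total exponent
  exactly 3, which is within the range where the truncated evaluation is multiplicative.\<close>

lemma tf_eval_subst:
  assumes F: "ternary_cubic F"
  shows "tf_eval (tf_subst F M) X = tf_eval F (vm X M)"
proof -
  obtain x y z where X: "X = (x,y,z)" by (cases X)
  define l where "l = (\<lambda>j. tf_lin (M 0 j) (M 1 j) (M 2 j))"
  have tm: "F (i,j,k) * tf_eval (tf_mult (tf_pow (l 0) i) (tf_mult (tf_pow (l 1) j) (tf_pow (l 2) k))) X
     = F (i,j,k) * tf_eval (l 0) X ^ i * tf_eval (l 1) X ^ j * tf_eval (l 2) X ^ k" for i j k
  proof (cases "i + j + k = 3")
    case True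
    have h: "tf_homog i (tf_pow (l 0) i)" "tf_homog j (tf_pow (l 1) j)" "tf_homog k (tf_pow (l 2) k)"
      by (simp_all add: l_def tf_homog_pow_lin)
    have p: "tf_eval (tf_pow (l 0) i) X = tf_eval (l 0) X ^ i"
       "tf_eval (tf_pow (l 1) j) X = tf_eval (l 1) X ^ j"
       "tf_eval (tf_pow (l 2) k) X = tf_eval (l 2) X ^ k"
      unfolding l_def by (intro tf_eval_pow_lin, use True in simp)+
    have "tf_eval (tf_mult (tf_pow (l 0) i) (tf_mult (tf_pow (l 1) j) (tf_pow (l 2) k))) X
      = tf_eval (l 0) X ^ i * (tf_eval (l 1) X ^ j * tf_eval (l 2) X ^ k)"
      using tf_eval_mult[OF h(1) tf_homog_mult[OF h(2,3)], of X] tf_eval_mult[OF h(2,3), of X] True p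
      by simp
    then show ?thesis by (simp add: mult_ac)
  qed (use F in \<open>simp add: homog_vanish\<close>)
  have v: "vm X M = (tf_eval (l 0) X, tf_eval (l 1) X, tf_eval (l 2) X)"
    by (simp add: X vm_def l_def tf_eval_lin)
  have "tf_eval (tf_subst F M) X
     = (\<Sum>i\<le>3. \<Sum>j\<le>3. \<Sum>k\<le>3. F (i,j,k) * tf_eval (tf_mult (tf_pow (l 0) i) (tf_mult (tf_pow (l 1) j) (tf_pow (l 2) k))) X)"
    unfolding tf_subst_def Let_def tf_eval_sum tf_eval_smult l_def by simp
  also have "\<dots> = tf_eval F (vm X M)"
    unfolding v tm by (simp add: tf_eval_def[of F])
  finally show ?thesis .
qed

lemma ternary_cubic_ext:
  assumes "ternary_cubic F" "ternary_cubic G"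
    and "F (3,0,0) = G (3,0,0)" "F (0,3,0) = G (0,3,0)" "F (0,0,3) = G (0,0,3)"
      "F (2,1,0) = G (2,1,0)" "F (2,0,1) = G (2,0,1)" "F (1,2,0) = G (1,2,0)"
      "F (0,2,1) = G (0,2,1)" "F (1,0,2) = G (1,0,2)" "F (0,1,2) = G (0,1,2)"
      "F (1,1,1) = G (1,1,1)"
  shows "F = G"
proof
  fix n :: "nat \<times> nat \<times> nat"
  obtain i j k where n: "n = (i,j,k)" by (cases n)
  show "F n = G n"
  proof (cases "i + j + k = 3")
    case True
    then have "i \<le> 3" "j \<le> 3" "k = 3 - i - j" by auto
    then have "i \<in> {0,1,2,3}" "j \<in> {0,1,2,3}" "k = 3 - i - j" by auto
    then show ?thesis using True assms(3-) unfolding n by (auto simp: numeral_2_eq_2 numeral_3_eq_3)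
  next
    case False
    then show ?thesis using assms(1,2) unfolding n by (simp add: ternary_cubic_def)
  qed
qed

lemma cubic_coeffs_eq_0:
  fixes a b c d :: "'a::idom"
  assumes "infinite (UNIV :: 'a set)" and z: "\<And>x. a + b * x + c * x^2 + d * x^3 = 0"
  shows "a = 0 \<and> b = 0 \<and> c = 0 \<and> d = 0"
proof -
  have "poly [:a,b,c,d:] x = 0" for x
    using z[of x] by (simp add: algebra_simps power2_eq_square power3_eq_cube)
  then have "{x. poly [:a,b,c,d:] x = 0} = UNIV" by auto
  then have "[:a,b,c,d:] = 0" using poly_roots_finite[of "[:a,b,c,d:]"] assms(1) by auto
  then show ?thesis by simp
qed

text \<open>This is the device for all later identities between cubic forms: over an infinite field
  they may be tested on values. Coefficients are separated first by powers of \<open>x\<close>, then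
  by powers of \<open>y\<close> at \<open>z = 1\<close>.\<close>

lemma tf_eval_inj:
  fixes F G :: "'a::field tform"
  assumes inf: "infinite (UNIV :: 'a set)" and F: "ternary_cubic F" and G: "ternary_cubic G"
    and eq: "\<And>x y z. tf_eval F (x,y,z) = tf_eval G (x,y,z)"
  shows "F = G"
proof -
  define D where "D n = F n - G n" for n
  have cx: "(D (0,3,0) * y^3 + D (0,2,1) * y^2 * z + D (0,1,2) * y * z^2 + D (0,0,3) * z^3)
      + (D (1,2,0) * y^2 + D (1,1,1) * y * z + D (1,0,2) * z^2) * x
      + (D (2,1,0) * y + D (2,0,1) * z) * x^2 + D (3,0,0) * x^3 = 0" for x y z
    using eq[of x y z] unfolding tf_eval_cubic[OF F] tf_eval_cubic[OF G] D_def
    by (simp add: algebra_simps)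
  note X = cubic_coeffs_eq_0[OF inf cx]
  have c0: "D (0,0,3) * z^3 + D (0,1,2) * z^2 * y + D (0,2,1) * z * y^2 + D (0,3,0) * y^3 = 0" for y z
    using X[of y z] by (simp add: algebra_simps)
  have c1: "D (1,0,2) * z^2 + D (1,1,1) * z * y + D (1,2,0) * y^2 + 0 * y^3 = 0" for y z
    using X[of y z] by (simp add: algebra_simps)
  have c2: "D (2,0,1) * z + D (2,1,0) * y + 0 * y^2 + 0 * y^3 = 0" for y z
    using X[of y z] by (simp add: algebra_simps)
  show ?thesis
    using X[of 1 1] cubic_coeffs_eq_0[OF inf c0, of 1] cubic_coeffs_eq_0[OF inf c1, of 1]
      cubic_coeffs_eq_0[OF inf c2, of 1]
    by (intro ternary_cubic_ext[OF F G]) (simp_all add: D_def)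
qed

definition cubic_form :: "'a \<Rightarrow> 'a \<Rightarrow> 'a \<Rightarrow> 'a \<Rightarrow> 'a \<Rightarrow> 'a \<Rightarrow> 'a \<Rightarrow> 'a \<Rightarrow> 'a \<Rightarrow> 'a \<Rightarrow> 'a::zero tform" where
  "cubic_form c300 c030 c003 c210 c201 c120 c021 c102 c012 c111 = (\<lambda>n.
     if n = (3,0,0) then c300 else
     if n = (0,3,0) then c030 else
     if n = (0,0,3) then c003 else
     if n = (2,1,0) then c210 else
     if n = (2,0,1) then c201 else
     if n = (1,2,0) then c120 else
     if n = (0,2,1) then c021 else
     if n = (1,0,2) then c102 else
     if n = (0,1,2) then c012 else
     if n = (1,1,1) then c111 else
     0)"

lemma cubic_form_coeffs:
  "cubic_form c300 c030 c003 c210 c201 c120 c021 c102 c012 c111 (3,0,0) = c300"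
  "cubic_form c300 c030 c003 c210 c201 c120 c021 c102 c012 c111 (0,3,0) = c030"
  "cubic_form c300 c030 c003 c210 c201 c120 c021 c102 c012 c111 (0,0,3) = c003"
  "cubic_form c300 c030 c003 c210 c201 c120 c021 c102 c012 c111 (2,1,0) = c210"
  "cubic_form c300 c030 c003 c210 c201 c120 c021 c102 c012 c111 (2,0,1) = c201"
  "cubic_form c300 c030 c003 c210 c201 c120 c021 c102 c012 c111 (1,2,0) = c120"
  "cubic_form c300 c030 c003 c210 c201 c120 c021 c102 c012 c111 (0,2,1) = c021"
  "cubic_form c300 c030 c003 c210 c201 c120 c021 c102 c012 c111 (1,0,2) = c102"
  "cubic_form c300 c030 c003 c210 c201 c120 c021 c102 c012 c111 (0,1,2) = c012"
  "cubic_form c300 c030 c003 c210 c201 c120 c021 c102 c012 c111 (1,1,1) = c111"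
  by (simp_all add: cubic_form_def)

lemma ternary_cubic_form: "ternary_cubic (cubic_form c300 c030 c003 c210 c201 c120 c021 c102 c012 c111)"
  by (auto simp: ternary_cubic_def cubic_form_def)

text \<open>Both sides are cubic forms, so comparing values suffices. The formulas for shears,
  transpositions and diagonal matrices below are specialisations of this one.\<close>

lemma tf_subst_eq_form:
  fixes F :: "'a::field tform"
  assumes inf: "infinite (UNIV :: 'a set)" and F: "ternary_cubic F"
  shows "tf_subst F M = cubic_form
    (F (0,0,3) * M 0 2 ^ 3 + F (0,1,2) * M 0 1 * M 0 2 ^ 2 + F (0,2,1) * M 0 1 ^ 2 * M 0 2 + F (0,3,0) * M 0 1 ^ 3 + F (1,0,2) * M 0 0 * M 0 2 ^ 2 + F (1,1,1) * M 0 0 * M 0 1 * M 0 2 + F (1,2,0) * M 0 0 * M 0 1 ^ 2 + F (2,0,1) * M 0 0 ^ 2 * M 0 2 + F (2,1,0) * M 0 0 ^ 2 * M 0 1 + F (3,0,0) * M 0 0 ^ 3)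
    (F (0,0,3) * M 1 2 ^ 3 + F (0,1,2) * M 1 1 * M 1 2 ^ 2 + F (0,2,1) * M 1 1 ^ 2 * M 1 2 + F (0,3,0) * M 1 1 ^ 3 + F (1,0,2) * M 1 0 * M 1 2 ^ 2 + F (1,1,1) * M 1 0 * M 1 1 * M 1 2 + F (1,2,0) * M 1 0 * M 1 1 ^ 2 + F (2,0,1) * M 1 0 ^ 2 * M 1 2 + F (2,1,0) * M 1 0 ^ 2 * M 1 1 + F (3,0,0) * M 1 0 ^ 3)
    (F (0,0,3) * M 2 2 ^ 3 + F (0,1,2) * M 2 1 * M 2 2 ^ 2 + F (0,2,1) * M 2 1 ^ 2 * M 2 2 + F (0,3,0) * M 2 1 ^ 3 + F (1,0,2) * M 2 0 * M 2 2 ^ 2 + F (1,1,1) * M 2 0 * M 2 1 * M 2 2 + F (1,2,0) * M 2 0 * M 2 1 ^ 2 + F (2,0,1) * M 2 0 ^ 2 * M 2 2 + F (2,1,0) * M 2 0 ^ 2 * M 2 1 + F (3,0,0) * M 2 0 ^ 3)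
    (3 * F (0,0,3) * M 0 2 ^ 2 * M 1 2 + 2 * F (0,1,2) * M 0 1 * M 0 2 * M 1 2 + F (0,1,2) * M 0 2 ^ 2 * M 1 1 + 2 * F (0,2,1) * M 0 1 * M 0 2 * M 1 1 + F (0,2,1) * M 0 1 ^ 2 * M 1 2 + 3 * F (0,3,0) * M 0 1 ^ 2 * M 1 1 + 2 * F (1,0,2) * M 0 0 * M 0 2 * M 1 2 + F (1,0,2) * M 0 2 ^ 2 * M 1 0 + F (1,1,1) * M 0 0 * M 0 1 * M 1 2 + F (1,1,1) * M 0 0 * M 0 2 * M 1 1 + F (1,1,1) * M 0 1 * M 0 2 * M 1 0 + 2 * F (1,2,0) * M 0 0 * M 0 1 * M 1 1 + F (1,2,0) * M 0 1 ^ 2 * M 1 0 + 2 * F (2,0,1) * M 0 0 * M 0 2 * M 1 0 + F (2,0,1) * M 0 0 ^ 2 * M 1 2 + 2 * F (2,1,0) * M 0 0 * M 0 1 * M 1 0 + F (2,1,0) * M 0 0 ^ 2 * M 1 1 + 3 * F (3,0,0) * M 0 0 ^ 2 * M 1 0)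
    (3 * F (0,0,3) * M 0 2 ^ 2 * M 2 2 + 2 * F (0,1,2) * M 0 1 * M 0 2 * M 2 2 + F (0,1,2) * M 0 2 ^ 2 * M 2 1 + 2 * F (0,2,1) * M 0 1 * M 0 2 * M 2 1 + F (0,2,1) * M 0 1 ^ 2 * M 2 2 + 3 * F (0,3,0) * M 0 1 ^ 2 * M 2 1 + 2 * F (1,0,2) * M 0 0 * M 0 2 * M 2 2 + F (1,0,2) * M 0 2 ^ 2 * M 2 0 + F (1,1,1) * M 0 0 * M 0 1 * M 2 2 + F (1,1,1) * M 0 0 * M 0 2 * M 2 1 + F (1,1,1) * M 0 1 * M 0 2 * M 2 0 + 2 * F (1,2,0) * M 0 0 * M 0 1 * M 2 1 + F (1,2,0) * M 0 1 ^ 2 * M 2 0 + 2 * F (2,0,1) * M 0 0 * M 0 2 * M 2 0 + F (2,0,1) * M 0 0 ^ 2 * M 2 2 + 2 * F (2,1,0) * M 0 0 * M 0 1 * M 2 0 + F (2,1,0) * M 0 0 ^ 2 * M 2 1 + 3 * F (3,0,0) * M 0 0 ^ 2 * M 2 0)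
    (3 * F (0,0,3) * M 0 2 * M 1 2 ^ 2 + F (0,1,2) * M 0 1 * M 1 2 ^ 2 + 2 * F (0,1,2) * M 0 2 * M 1 1 * M 1 2 + 2 * F (0,2,1) * M 0 1 * M 1 1 * M 1 2 + F (0,2,1) * M 0 2 * M 1 1 ^ 2 + 3 * F (0,3,0) * M 0 1 * M 1 1 ^ 2 + F (1,0,2) * M 0 0 * M 1 2 ^ 2 + 2 * F (1,0,2) * M 0 2 * M 1 0 * M 1 2 + F (1,1,1) * M 0 0 * M 1 1 * M 1 2 + F (1,1,1) * M 0 1 * M 1 0 * M 1 2 + F (1,1,1) * M 0 2 * M 1 0 * M 1 1 + F (1,2,0) * M 0 0 * M 1 1 ^ 2 + 2 * F (1,2,0) * M 0 1 * M 1 0 * M 1 1 + 2 * F (2,0,1) * M 0 0 * M 1 0 * M 1 2 + F (2,0,1) * M 0 2 * M 1 0 ^ 2 + 2 * F (2,1,0) * M 0 0 * M 1 0 * M 1 1 + F (2,1,0) * M 0 1 * M 1 0 ^ 2 + 3 * F (3,0,0) * M 0 0 * M 1 0 ^ 2)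
    (3 * F (0,0,3) * M 1 2 ^ 2 * M 2 2 + 2 * F (0,1,2) * M 1 1 * M 1 2 * M 2 2 + F (0,1,2) * M 1 2 ^ 2 * M 2 1 + 2 * F (0,2,1) * M 1 1 * M 1 2 * M 2 1 + F (0,2,1) * M 1 1 ^ 2 * M 2 2 + 3 * F (0,3,0) * M 1 1 ^ 2 * M 2 1 + 2 * F (1,0,2) * M 1 0 * M 1 2 * M 2 2 + F (1,0,2) * M 1 2 ^ 2 * M 2 0 + F (1,1,1) * M 1 0 * M 1 1 * M 2 2 + F (1,1,1) * M 1 0 * M 1 2 * M 2 1 + F (1,1,1) * M 1 1 * M 1 2 * M 2 0 + 2 * F (1,2,0) * M 1 0 * M 1 1 * M 2 1 + F (1,2,0) * M 1 1 ^ 2 * M 2 0 + 2 * F (2,0,1) * M 1 0 * M 1 2 * M 2 0 + F (2,0,1) * M 1 0 ^ 2 * M 2 2 + 2 * F (2,1,0) * M 1 0 * M 1 1 * M 2 0 + F (2,1,0) * M 1 0 ^ 2 * M 2 1 + 3 * F (3,0,0) * M 1 0 ^ 2 * M 2 0)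
    (3 * F (0,0,3) * M 0 2 * M 2 2 ^ 2 + F (0,1,2) * M 0 1 * M 2 2 ^ 2 + 2 * F (0,1,2) * M 0 2 * M 2 1 * M 2 2 + 2 * F (0,2,1) * M 0 1 * M 2 1 * M 2 2 + F (0,2,1) * M 0 2 * M 2 1 ^ 2 + 3 * F (0,3,0) * M 0 1 * M 2 1 ^ 2 + F (1,0,2) * M 0 0 * M 2 2 ^ 2 + 2 * F (1,0,2) * M 0 2 * M 2 0 * M 2 2 + F (1,1,1) * M 0 0 * M 2 1 * M 2 2 + F (1,1,1) * M 0 1 * M 2 0 * M 2 2 + F (1,1,1) * M 0 2 * M 2 0 * M 2 1 + F (1,2,0) * M 0 0 * M 2 1 ^ 2 + 2 * F (1,2,0) * M 0 1 * M 2 0 * M 2 1 + 2 * F (2,0,1) * M 0 0 * M 2 0 * M 2 2 + F (2,0,1) * M 0 2 * M 2 0 ^ 2 + 2 * F (2,1,0) * M 0 0 * M 2 0 * M 2 1 + F (2,1,0) * M 0 1 * M 2 0 ^ 2 + 3 * F (3,0,0) * M 0 0 * M 2 0 ^ 2)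
    (3 * F (0,0,3) * M 1 2 * M 2 2 ^ 2 + F (0,1,2) * M 1 1 * M 2 2 ^ 2 + 2 * F (0,1,2) * M 1 2 * M 2 1 * M 2 2 + 2 * F (0,2,1) * M 1 1 * M 2 1 * M 2 2 + F (0,2,1) * M 1 2 * M 2 1 ^ 2 + 3 * F (0,3,0) * M 1 1 * M 2 1 ^ 2 + F (1,0,2) * M 1 0 * M 2 2 ^ 2 + 2 * F (1,0,2) * M 1 2 * M 2 0 * M 2 2 + F (1,1,1) * M 1 0 * M 2 1 * M 2 2 + F (1,1,1) * M 1 1 * M 2 0 * M 2 2 + F (1,1,1) * M 1 2 * M 2 0 * M 2 1 + F (1,2,0) * M 1 0 * M 2 1 ^ 2 + 2 * F (1,2,0) * M 1 1 * M 2 0 * M 2 1 + 2 * F (2,0,1) * M 1 0 * M 2 0 * M 2 2 + F (2,0,1) * M 1 2 * M 2 0 ^ 2 + 2 * F (2,1,0) * M 1 0 * M 2 0 * M 2 1 + F (2,1,0) * M 1 1 * M 2 0 ^ 2 + 3 * F (3,0,0) * M 1 0 * M 2 0 ^ 2)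
    (6 * F (0,0,3) * M 0 2 * M 1 2 * M 2 2 + 2 * F (0,1,2) * M 0 1 * M 1 2 * M 2 2 + 2 * F (0,1,2) * M 0 2 * M 1 1 * M 2 2 + 2 * F (0,1,2) * M 0 2 * M 1 2 * M 2 1 + 2 * F (0,2,1) * M 0 1 * M 1 1 * M 2 2 + 2 * F (0,2,1) * M 0 1 * M 1 2 * M 2 1 + 2 * F (0,2,1) * M 0 2 * M 1 1 * M 2 1 + 6 * F (0,3,0) * M 0 1 * M 1 1 * M 2 1 + 2 * F (1,0,2) * M 0 0 * M 1 2 * M 2 2 + 2 * F (1,0,2) * M 0 2 * M 1 0 * M 2 2 + 2 * F (1,0,2) * M 0 2 * M 1 2 * M 2 0 + F (1,1,1) * M 0 0 * M 1 1 * M 2 2 + F (1,1,1) * M 0 0 * M 1 2 * M 2 1 + F (1,1,1) * M 0 1 * M 1 0 * M 2 2 + F (1,1,1) * M 0 1 * M 1 2 * M 2 0 + F (1,1,1) * M 0 2 * M 1 0 * M 2 1 + F (1,1,1) * M 0 2 * M 1 1 * M 2 0 + 2 * F (1,2,0) * M 0 0 * M 1 1 * M 2 1 + 2 * F (1,2,0) * M 0 1 * M 1 0 * M 2 1 + 2 * F (1,2,0) * M 0 1 * M 1 1 * M 2 0 + 2 * F (2,0,1) * M 0 0 * M 1 0 * M 2 2 + 2 * F (2,0,1) * M 0 0 * M 1 2 * M 2 0 + 2 * F (2,0,1) * M 0 2 * M 1 0 * M 2 0 + 2 * F (2,1,0) * M 0 0 * M 1 0 * M 2 1 + 2 * F (2,1,0)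 * M 0 0 * M 1 1 * M 2 0 + 2 * F (2,1,0) * M 0 1 * M 1 0 * M 2 0 + 6 * F (3,0,0) * M 0 0 * M 1 0 * M 2 0)
" (is "_ = ?G")
proof (rule tf_eval_inj[OF inf ternary_cubic_subst[OF F]])
  show G: "ternary_cubic ?G" by (rule ternary_cubic_form)
  fix x y z
  show "tf_eval (tf_subst F M) (x,y,z) = tf_eval ?G (x,y,z)"
    unfolding tf_eval_subst[OF F] vm_def prod.case tf_eval_cubic[OF F] tf_eval_cubic[OF G] cubic_form_coeffs
    by algebra
qed

section \<open>Matrices and the singular locus\<close>

definition mm :: "(nat \<Rightarrow> nat \<Rightarrow> 'a::comm_ring_1) \<Rightarrow> (nat \<Rightarrow> nat \<Rightarrow> 'a) \<Rightarrow> nat \<Rightarrow> nat \<Rightarrow> 'a" where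
  "mm A B = (\<lambda>i j. A i 0 * B 0 j + A i 1 * B 1 j + A i 2 * B 2 j)"

lemma vm_mm: "vm (vm X A) B = vm X (mm A B)"
  by (cases X) (simp add: vm_def mm_def algebra_simps)

lemma det3_mm: "det3 (mm A B) = det3 A * det3 B" for A B :: "nat \<Rightarrow> nat \<Rightarrow> 'a::field"
  unfolding det3_def mm_def by algebra

lemma mm_assoc: "mm (mm A B) C = mm A (mm B C)"
  by (intro ext) (simp add: mm_def algebra_simps)

lemma tf_subst_mm:
  fixes F :: "'a::field tform"
  assumes "infinite (UNIV :: 'a set)" and F: "ternary_cubic F"
  shows "tf_subst (tf_subst F A) B = tf_subst F (mm B A)"
  by (rule tf_eval_inj[OF assms(1)])
    (simp_all add: F ternary_cubic_subst tf_eval_subst vm_mm)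

lemma tf_subst_cong:
  assumes "\<And>i j. i < 3 \<Longrightarrow> j < 3 \<Longrightarrow> A i j = B i j"
  shows "tf_subst F A = tf_subst F B"
  using assms by (simp add: tf_subst_def)

lemma vm_cong:
  assumes "\<And>i j. i < 3 \<Longrightarrow> j < 3 \<Longrightarrow> A i j = B i j"
  shows "vm X A = vm X B"
  using assms by (simp add: vm_def)

lemma det3_cong:
  assumes "\<And>i j. i < 3 \<Longrightarrow> j < 3 \<Longrightarrow> A i j = B i j"
  shows "det3 A = det3 B"
  using assms by (simp add: det3_def)

definition mat9 :: "'a \<Rightarrow> 'a \<Rightarrow> 'a \<Rightarrow> 'a \<Rightarrow> 'a \<Rightarrow> 'a \<Rightarrow> 'a \<Rightarrow> 'a \<Rightarrow> 'a::zero \<Rightarrow> nat \<Rightarrow> nat \<Rightarrow> 'a" where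
  "mat9 a b c d e f g h i = (\<lambda>r s.
     if r = 0 then if s = 0 then a else if s = 1 then b else c
     else if r = 1 then if s = 0 then d else if s = 1 then e else f
     else if s = 0 then g else if s = 1 then h else i)"

lemma mat9_entries [simp]:
  "mat9 a b c d e f g h i 0 0 = a" "mat9 a b c d e f g h i 0 (Suc 0) = b" "mat9 a b c d e f g h i 0 2 = c"
  "mat9 a b c d e f g h i (Suc 0) 0 = d" "mat9 a b c d e f g h i (Suc 0) (Suc 0) = e" "mat9 a b c d e f g h i (Suc 0) 2 = f"
  "mat9 a b c d e f g h i 2 0 = g" "mat9 a b c d e f g h i 2 (Suc 0) = h" "mat9 a b c d e f g h i 2 2 = i"
  by (simp_all add: mat9_def)

definition adj3 :: "(nat \<Rightarrow> nat \<Rightarrow> 'a::comm_ring_1) \<Rightarrow> nat \<Rightarrow> nat \<Rightarrow> 'a" where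
  "adj3 M = mat9
     (M 1 1 * M 2 2 - M 1 2 * M 2 1) (M 0 2 * M 2 1 - M 0 1 * M 2 2) (M 0 1 * M 1 2 - M 0 2 * M 1 1)
     (M 1 2 * M 2 0 - M 1 0 * M 2 2) (M 0 0 * M 2 2 - M 0 2 * M 2 0) (M 0 2 * M 1 0 - M 0 0 * M 1 2)
     (M 1 0 * M 2 1 - M 1 1 * M 2 0) (M 0 1 * M 2 0 - M 0 0 * M 2 1) (M 0 0 * M 1 1 - M 0 1 * M 1 0)"

definition inv3 :: "(nat \<Rightarrow> nat \<Rightarrow> 'a::field) \<Rightarrow> nat \<Rightarrow> nat \<Rightarrow> 'a" where
  "inv3 M = (\<lambda>i j. adj3 M i j / det3 M)"

lemma mm_adj3:
  fixes M :: "nat \<Rightarrow> nat \<Rightarrow> 'a::field"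
  assumes "i < 3" "j < 3"
  shows "mm M (adj3 M) i j = (if i = j then det3 M else 0)"
    and "mm (adj3 M) M i j = (if i = j then det3 M else 0)"
proof -
  have e: "mm M (adj3 M) 0 0 = det3 M" "mm M (adj3 M) 0 1 = 0" "mm M (adj3 M) 0 2 = 0"
    "mm M (adj3 M) 1 0 = 0" "mm M (adj3 M) 1 1 = det3 M" "mm M (adj3 M) 1 2 = 0"
    "mm M (adj3 M) 2 0 = 0" "mm M (adj3 M) 2 1 = 0" "mm M (adj3 M) 2 2 = det3 M"
    "mm (adj3 M) M 0 0 = det3 M" "mm (adj3 M) M 0 1 = 0" "mm (adj3 M) M 0 2 = 0"
    "mm (adj3 M) M 1 0 = 0" "mm (adj3 M) M 1 1 = det3 M" "mm (adj3 M) M 1 2 = 0"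
    "mm (adj3 M) M 2 0 = 0" "mm (adj3 M) M 2 1 = 0" "mm (adj3 M) M 2 2 = det3 M"
    by (simp_all add: mm_def adj3_def det3_def, algebra+)
  have "i = 0 \<or> i = 1 \<or> i = 2" "j = 0 \<or> j = 1 \<or> j = 2" using assms by linarith+
  then show "mm M (adj3 M) i j = (if i = j then det3 M else 0)"
    and "mm (adj3 M) M i j = (if i = j then det3 M else 0)"
    using e by auto
qed

lemma mm_inv3:
  fixes M :: "nat \<Rightarrow> nat \<Rightarrow> 'a::field"
  assumes "det3 M \<noteq> 0" "i < 3" "j < 3"
  shows "mm M (inv3 M) i j = (if i = j then 1 else 0)"
    and "mm (inv3 M) M i j = (if i = j then 1 else 0)"
proof -
  have "mm M (inv3 M) i j = mm M (adj3 M) i j / det3 M" "mm (inv3 M) M i j = mm (adj3 M) M i j / det3 M"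
    by (simp_all add: mm_def inv3_def add_divide_distrib)
  then show "mm M (inv3 M) i j = (if i = j then 1 else 0)" "mm (inv3 M) M i j = (if i = j then 1 else 0)"
    using assms by (simp_all add: mm_adj3)
qed

definition id3 :: "nat \<Rightarrow> nat \<Rightarrow> 'a::zero_neq_one" where "id3 = (\<lambda>i j. if i = j then 1 else 0)"

lemma vm_id3: "vm X id3 = X"
  by (cases X) (simp add: vm_def id3_def)

lemma tf_subst_id3:
  fixes F :: "'a::field tform"
  assumes "infinite (UNIV :: 'a set)" and F: "ternary_cubic F"
  shows "tf_subst F id3 = F"
  by (rule tf_eval_inj[OF assms(1)])
    (simp_all add: F ternary_cubic_subst tf_eval_subst vm_id3)

lemma vm_inv3:
  assumes "det3 M \<noteq> 0"
  shows "vm (vm X M) (inv3 M) = X" "vm (vm X (inv3 M)) M = X"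
proof -
  have "vm X (mm M (inv3 M)) = vm X id3" "vm X (mm (inv3 M) M) = vm X id3"
    by (rule vm_cong; simp add: mm_inv3[OF assms] id3_def)+
  then show "vm (vm X M) (inv3 M) = X" "vm (vm X (inv3 M)) M = X"
    by (simp_all add: vm_mm vm_id3)
qed

lemma det3_inv3:
  assumes "det3 M \<noteq> 0"
  shows "det3 (inv3 M) = 1 / det3 M"
proof -
  have "det3 (mm M (inv3 M)) = det3 (id3 :: nat \<Rightarrow> nat \<Rightarrow> 'a)"
    by (rule det3_cong) (simp add: mm_inv3[OF assms] id3_def)
  then have "det3 M * det3 (inv3 M) = 1" by (simp add: det3_mm) (simp add: det3_def id3_def)
  then show ?thesis using assms by (simp add: field_simps)
qed

lemma tf_subst_inv3:
  fixes F :: "'a::field tform"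
  assumes inf: "infinite (UNIV :: 'a set)" and F: "ternary_cubic F" and M: "det3 M \<noteq> 0"
  shows "tf_subst (tf_subst F M) (inv3 M) = F"
proof -
  have "tf_subst F (mm (inv3 M) M) = tf_subst F id3"
    by (rule tf_subst_cong) (simp add: mm_inv3[OF M] id3_def)
  then show ?thesis by (simp add: tf_subst_mm[OF inf F] tf_subst_id3[OF inf F])
qed

lemma vm_zero: "vm (0,0,0) M = (0,0,0)"
  by (simp add: vm_def)

lemma vm_eq_zero_iff: "det3 M \<noteq> 0 \<Longrightarrow> vm X M = (0,0,0) \<longleftrightarrow> X = (0,0,0)" for M :: "nat \<Rightarrow> nat \<Rightarrow> 'a::field"
  using vm_inv3(1)[of M X] vm_zero[of "inv3 M"] vm_zero[of M] by auto

section \<open>Partial derivatives and the singular locus under substitution\<close>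

lemma tf_eval_derivs:
  fixes F :: "'a::comm_ring_1 tform"
  assumes "ternary_cubic F"
  shows "tf_eval (tf_dx F) (x,y,z) = 3 * F (3,0,0) * x^2 + 2 * F (2,1,0) * x * y + 2 * F (2,0,1) * x * z
            + F (1,2,0) * y^2 + F (1,1,1) * y * z + F (1,0,2) * z^2"
    "tf_eval (tf_dy F) (x,y,z) = 3 * F (0,3,0) * y^2 + 2 * F (1,2,0) * x * y + 2 * F (0,2,1) * y * z
            + F (2,1,0) * x^2 + F (1,1,1) * x * z + F (0,1,2) * z^2"
    "tf_eval (tf_dz F) (x,y,z) = 3 * F (0,0,3) * z^2 + 2 * F (1,0,2) * x * z + 2 * F (0,1,2) * y * z
            + F (2,0,1) * x^2 + F (1,1,1) * x * y + F (0,2,1) * y^2"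
  using assms
  by (simp_all add: tf_eval_def tf_dx_def tf_dy_def tf_dz_def homog_vanish sum_le3 ac_simps flip: numeral_2_eq_2)

text \<open>Since the degree is 3, the quadratic term in \<open>t\<close> is the linear term with
  the two points interchanged, so no second derivatives are needed.\<close>

lemma tf_eval_taylor:
  fixes F :: "'a::field tform"
  assumes F: "ternary_cubic F"
  shows "tf_eval F (x + t * u, y + t * v, z + t * w) = tf_eval F (x,y,z)
    + (u * tf_eval (tf_dx F) (x,y,z) + v * tf_eval (tf_dy F) (x,y,z) + w * tf_eval (tf_dz F) (x,y,z)) * t
    + (x * tf_eval (tf_dx F) (u,v,w) + y * tf_eval (tf_dy F) (u,v,w) + z * tf_eval (tf_dz F) (u,v,w)) * t^2
    + tf_eval F (u,v,w) * t^3"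
  unfolding tf_eval_cubic[OF F] tf_eval_derivs[OF F] by algebra

text \<open>No derivative of the substituted form is computed: the Taylor expansions of both sides
  along \<open>(u,v,w)\<close> are the same cubic polynomial in \<open>t\<close>, and its linear
  coefficient is the directional derivative.\<close>

lemma chain_rule:
  fixes F :: "'a::field tform"
  assumes inf: "infinite (UNIV :: 'a set)" and F: "ternary_cubic F" and X': "vm (x,y,z) M = X'"
  shows "u * tf_eval (tf_dx (tf_subst F M)) (x,y,z) + v * tf_eval (tf_dy (tf_subst F M)) (x,y,z) + w * tf_eval (tf_dz (tf_subst F M)) (x,y,z)
   = (M 0 0 * u + M 1 0 * v + M 2 0 * w) * tf_eval (tf_dx F) X'
   + (M 0 1 * u + M 1 1 * v + M 2 1 * w) * tf_eval (tf_dy F) X'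
   + (M 0 2 * u + M 1 2 * v + M 2 2 * w) * tf_eval (tf_dz F) X'"
proof -
  note S = ternary_cubic_subst[OF F, of M]
  obtain x' y' z' where X'': "X' = (x',y',z')" by (cases X')
  obtain u' v' w' where U: "vm (u,v,w) M = (u',v',w')" by (cases "vm (u,v,w) M")
  have vm: "vm (x + t * u, y + t * v, z + t * w) M = (x' + t * u', y' + t * v', z' + t * w')" for t
    using X' U unfolding X'' vm_def by (auto simp: algebra_simps)
  define A where "A = u * tf_eval (tf_dx (tf_subst F M)) (x,y,z) + v * tf_eval (tf_dy (tf_subst F M)) (x,y,z) + w * tf_eval (tf_dz (tf_subst F M)) (x,y,z)"
  define B where "B = u' * tf_eval (tf_dx F) (x',y',z') + v' * tf_eval (tf_dy F) (x',y',z') + w' * tf_eval (tf_dz F) (x',y',z')"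
  define A2 where "A2 = x * tf_eval (tf_dx (tf_subst F M)) (u,v,w) + y * tf_eval (tf_dy (tf_subst F M)) (u,v,w) + z * tf_eval (tf_dz (tf_subst F M)) (u,v,w)"
  define B2 where "B2 = x' * tf_eval (tf_dx F) (u',v',w') + y' * tf_eval (tf_dy F) (u',v',w') + z' * tf_eval (tf_dz F) (u',v',w')"
  have "tf_eval (tf_subst F M) (x + t * u, y + t * v, z + t * w)
      = tf_eval F (x' + t * u', y' + t * v', z' + t * w')" for t
    by (simp add: tf_eval_subst[OF F] vm)
  note eq = this[unfolded tf_eval_taylor[OF F] tf_eval_taylor[OF S], unfolded A_def[symmetric] B_def[symmetric] A2_def[symmetric] B2_def[symmetric]
      tf_eval_subst[OF F] X' U X'']
  \<comment> \<open>The constant and cubic terms cancel because they are values of the form at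
    corresponding points.\<close>
  have "0 + (A - B) * t + (A2 - B2) * t^2 + 0 * t^3 = 0" for t
    using eq[of t] by algebra
  from cubic_coeffs_eq_0[OF inf this] have "A = B" by simp
  then show ?thesis using U unfolding A_def B_def X'' vm_def by auto
qed

text \<open>The same set as \<open>sing_locus\<close>, but for a form that is already reduced, so
  that it can be studied with arbitrary matrices over the closure.\<close>

definition singset :: "'c::field tform \<Rightarrow> ('c \<times> 'c \<times> 'c) set" where
  "singset G = {X. X \<noteq> (0,0,0) \<and> tf_eval G X = 0 \<and> tf_eval (tf_dx G) X = 0 \<and>
         tf_eval (tf_dy G) X = 0 \<and> tf_eval (tf_dz G) X = 0}"

lemma mem_singset:
  fixes G :: "'c::field tform"
  assumes G: "ternary_cubic G"
  shows "(x,y,z) \<in> singset G \<longleftrightarrow> (x,y,z) \<noteq> (0,0,0)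
    \<and> G (3,0,0) * x^3 + G (0,3,0) * y^3 + G (0,0,3) * z^3 + G (2,1,0) * x^2*y + G (2,0,1) * x^2*z
      + G (1,2,0) * x*y^2 + G (0,2,1) * y^2*z + G (1,0,2) * x*z^2 + G (0,1,2) * y*z^2 + G (1,1,1) * x*y*z = 0
    \<and> 3 * G (3,0,0) * x^2 + 2 * G (2,1,0) * x * y + 2 * G (2,0,1) * x * z
      + G (1,2,0) * y^2 + G (1,1,1) * y * z + G (1,0,2) * z^2 = 0
    \<and> 3 * G (0,3,0) * y^2 + 2 * G (1,2,0) * x * y + 2 * G (0,2,1) * y * z
      + G (2,1,0) * x^2 + G (1,1,1) * x * z + G (0,1,2) * z^2 = 0
    \<and> 3 * G (0,0,3) * z^2 + 2 * G (1,0,2) * x * z + 2 * G (0,1,2) * y * z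
      + G (2,0,1) * x^2 + G (1,1,1) * x * y + G (0,2,1) * y^2 = 0"
  unfolding singset_def mem_Collect_eq tf_eval_cubic[OF G] tf_eval_derivs[OF G] ..

lemma sing_locus_singset: "sing_locus red emb F = singset (tf_red red emb F)"
  by (simp add: sing_locus_def singset_def Let_def)

lemma singset_substI:
  fixes F :: "'a::field tform"
  assumes inf: "infinite (UNIV :: 'a set)" and F: "ternary_cubic F" and M: "det3 M \<noteq> 0"
    and X: "vm X M \<in> singset F"
  shows "X \<in> singset (tf_subst F M)"
proof -
  obtain x y z where xyz: "X = (x,y,z)" by (cases X)
  note cr = chain_rule[OF inf F, of x y z M "vm X M"]
  have "u * tf_eval (tf_dx (tf_subst F M)) X + v * tf_eval (tf_dy (tf_subst F M)) X + w * tf_eval (tf_dz (tf_subst F M)) X = 0" for u v w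
    using cr[of u v w] X by (simp add: xyz singset_def)
  from this[of 1 0 0] this[of 0 1 0] this[of 0 0 1]
  show ?thesis using X by (auto simp: singset_def tf_eval_subst[OF F] vm_zero)
qed

lemma singset_subst:
  fixes F :: "'a::field tform"
  assumes inf: "infinite (UNIV :: 'a set)" and F: "ternary_cubic F" and M: "det3 M \<noteq> 0"
  shows "X \<in> singset (tf_subst F M) \<longleftrightarrow> vm X M \<in> singset F"
proof
  assume X: "X \<in> singset (tf_subst F M)"
  have "vm (vm X M) (inv3 M) \<in> singset (tf_subst F M)" using X by (simp add: vm_inv3[OF M])
  moreover have "det3 (inv3 M) \<noteq> 0" using det3_inv3[OF M] M by simp
  ultimately have "vm X M \<in> singset (tf_subst (tf_subst F M) (inv3 M))"
    using singset_substI[OF inf ternary_cubic_subst[OF F]] by blast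
  then show "vm X M \<in> singset F" by (simp add: tf_subst_inv3[OF inf F M])
qed (rule singset_substI[OF assms])

section \<open>The Jacobian under linear substitutions\<close>

text \<open>Naming the transformed coefficients and clearing the powers of \<open>u\<close> turns
  the group law of coordinate changes into polynomial identities.\<close>

lemma w_trans_compose:
  fixes u :: "'a::field"
  assumes "u \<noteq> 0" "u' \<noteq> 0"
  shows "w_trans u' r' s' t' (w_trans u r s t A)
       = w_trans (u * u') (u^2 * r' + r) (u * s' + s) (u^3 * t' + u^2 * r' * s + t) A"
proof -
  obtain a1 a2 a3 a4 a6 where A: "A = (a1,a2,a3,a4,a6)" by (cases A)
  define b1 b2 b3 b4 b6 where b: "b1 = (a1 + 2 * s) / u" "b2 = (a2 - s * a1 + 3 * r - s\<^sup>2) / u ^ 2"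
      "b3 = (a3 + r * a1 + 2 * t) / u ^ 3"
      "b4 = (a4 - s * a3 + 2 * r * a2 - (t + r * s) * a1 + 3 * r\<^sup>2 - 2 * s * t) / u ^ 4"
      "b6 = (a6 + r * a4 + r\<^sup>2 * a2 + r ^ 3 - t * a3 - t\<^sup>2 - r * t * a1) / u ^ 6"
  have h: "u * b1 = a1 + 2 * s" "u^2 * b2 = a2 - s * a1 + 3 * r - s\<^sup>2" "u^3 * b3 = a3 + r * a1 + 2 * t"
     "u^4 * b4 = a4 - s * a3 + 2 * r * a2 - (t + r * s) * a1 + 3 * r\<^sup>2 - 2 * s * t"
     "u^6 * b6 = a6 + r * a4 + r\<^sup>2 * a2 + r ^ 3 - t * a3 - t\<^sup>2 - r * t * a1"
    using assms by (simp_all add: b)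
  define R S T where R: "R = u^2 * r' + r" and S: "S = u * s' + s" and T: "T = u^3 * t' + u^2 * r' * s + t"
  have e1: "u * (b1 + 2 * s') = a1 + 2 * S"
    and e2: "u^2 * (b2 - s' * b1 + 3 * r' - s'\<^sup>2) = a2 - S * a1 + 3 * R - S\<^sup>2"
    and e3: "u^3 * (b3 + r' * b1 + 2 * t') = a3 + R * a1 + 2 * T"
    and e4: "u^4 * (b4 - s' * b3 + 2 * r' * b2 - (t' + r' * s') * b1 + 3 * r'\<^sup>2 - 2 * s' * t')
       = a4 - S * a3 + 2 * R * a2 - (T + R * S) * a1 + 3 * R\<^sup>2 - 2 * S * T"
    and e6: "u^6 * (b6 + r' * b4 + r'\<^sup>2 * b2 + r' ^ 3 - t' * b3 - t'\<^sup>2 - r' * t' * b1)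
       = a6 + R * a4 + R\<^sup>2 * a2 + R ^ 3 - T * a3 - T\<^sup>2 - R * T * a1"
    unfolding R S T using h by algebra+
  show ?thesis unfolding A R[symmetric] S[symmetric] T[symmetric] w_trans_def prod.case b[symmetric]
      e1[symmetric] e2[symmetric] e3[symmetric] e4[symmetric] e6[symmetric]
    using assms by (simp add: power_mult_distrib)
qed

text \<open>The discriminant is a polynomial in \<open>b2, b4, b6, b8\<close>, and these change only
  with \<open>r\<close>; thus \<open>s\<close> and \<open>t\<close> disappear before the large
  identity is checked. That identity holds modulo the relation
  \<open>4 b8 = b2 b6 - b4^2\<close>.\<close>

lemma w_disc_trans:
  fixes u :: "'a::field"
  assumes "u \<noteq> 0"
  shows "w_disc (w_trans u r s t A) = w_disc A / u ^ 12"
proof -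
  obtain a1 a2 a3 a4 a6 where A: "A = (a1,a2,a3,a4,a6)" by (cases A)
  define x1 x2 x3 x4 x6 where x: "x1 = a1 + 2 * s" "x2 = a2 - s * a1 + 3 * r - s\<^sup>2"
      "x3 = a3 + r * a1 + 2 * t"
      "x4 = a4 - s * a3 + 2 * r * a2 - (t + r * s) * a1 + 3 * r\<^sup>2 - 2 * s * t"
      "x6 = a6 + r * a4 + r\<^sup>2 * a2 + r ^ 3 - t * a3 - t\<^sup>2 - r * t * a1"
  define c2 c4 c6 c8 where c: "c2 = a1\<^sup>2 + 4 * a2" "c4 = a1 * a3 + 2 * a4" "c6 = a3\<^sup>2 + 4 * a6"
     "c8 = a1\<^sup>2 * a6 + 4 * a2 * a6 - a1 * a3 * a4 + a2 * a3\<^sup>2 - a4\<^sup>2"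
  have b: "x1\<^sup>2 + 4 * x2 = c2 + 12 * r"
     "x1 * x3 + 2 * x4 = c4 + r * c2 + 6 * r^2"
     "x3\<^sup>2 + 4 * x6 = c6 + 2 * r * c4 + r^2 * c2 + 4 * r^3"
     "x1\<^sup>2 * x6 + 4 * x2 * x6 - x1 * x3 * x4 + x2 * x3\<^sup>2 - x4\<^sup>2 = c8 + 3 * r * c6 + 3 * r^2 * c4 + r^3 * c2 + 3 * r^4"
    unfolding x c by algebra+
  have rel: "4 * c8 = c2 * c6 - c4^2" unfolding c by algebra
  have d: "w_disc (x1,x2,x3,x4,x6) = w_disc A"
    unfolding A w_disc_def prod.case Let_def b c[symmetric] using rel by algebra
  have e: "w_disc (x1/u,x2/u^2,x3/u^3,x4/u^4,x6/u^6) = w_disc (x1,x2,x3,x4,x6) / u^12"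
  proof -
    define y1 y2 y3 y4 y6 where y: "y1 = x1/u" "y2 = x2/u^2" "y3 = x3/u^3" "y4 = x4/u^4" "y6 = x6/u^6"
    have "x1 = u * y1" "x2 = u^2 * y2" "x3 = u^3 * y3" "x4 = u^4 * y4" "x6 = u^6 * y6"
      using assms by (simp_all add: y)
    then have "w_disc (x1,x2,x3,x4,x6) = u^12 * w_disc (y1,y2,y3,y4,y6)"
      unfolding w_disc_def prod.case Let_def by algebra
    then show ?thesis using assms by (simp add: y)
  qed
  show ?thesis using d e by (simp add: A w_trans_def x)
qed

lemma w_trans_id: "w_trans 1 0 0 0 A = A"
  by (cases A) (simp add: w_trans_def)

lemma w_trans_inverse:
  fixes u :: "'a::field"
  assumes u: "u \<noteq> 0"
  shows "w_trans (1/u) (- r / u^2) (- s / u) ((r * s - t) / u^3) (w_trans u r s t A) = A"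
proof -
  have "w_trans (1/u) (- r / u^2) (- s / u) ((r * s - t) / u^3) (w_trans u r s t A) = w_trans 1 0 0 0 A"
    using u by (subst w_trans_compose) (simp_all add: field_simps)
  then show ?thesis by (simp add: w_trans_id)
qed

text \<open>Tying \<open>u\<close> to the determinant is what later converts a change of matrix into
  a change of discriminant valuation. The sign stays open because a transposition has determinant -1
  and leaves \<open>tc_ainv\<close> unchanged.\<close>

definition jac_equivariant :: "(nat \<Rightarrow> nat \<Rightarrow> 'a::field) \<Rightarrow> bool" where
  "jac_equivariant M \<longleftrightarrow> (\<forall>F. ternary_cubic F \<longrightarrow> (\<exists>u r s t. (u * det3 M = 1 \<or> u * det3 M = -1) \<and>
      tc_ainv (tf_subst F M) = w_trans u r s t (tc_ainv F)))"

lemma jac_equivariant_mm: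
  fixes A B :: "nat \<Rightarrow> nat \<Rightarrow> 'a::field"
  assumes inf: "infinite (UNIV :: 'a set)" and A: "jac_equivariant A" and B: "jac_equivariant B"
  shows "jac_equivariant (mm A B)"
  unfolding jac_equivariant_def
proof (intro allI impI)
  fix F :: "'a tform" assume F: "ternary_cubic F"
  obtain u r s t where u: "u * det3 B = 1 \<or> u * det3 B = -1"
      and 1: "tc_ainv (tf_subst F B) = w_trans u r s t (tc_ainv F)"
    using B F unfolding jac_equivariant_def by blast
  obtain u' r' s' t' where u': "u' * det3 A = 1 \<or> u' * det3 A = -1"
      and 2: "tc_ainv (tf_subst (tf_subst F B) A) = w_trans u' r' s' t' (tc_ainv (tf_subst F B))"
    using A ternary_cubic_subst[OF F] unfolding jac_equivariant_def by blast
  have nz: "u \<noteq> 0" "u' \<noteq> 0" using u u' by auto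
  have "u * u' * det3 (mm A B) = (u * det3 B) * (u' * det3 A)" by (simp add: det3_mm)
  moreover have "(u * det3 B) * (u' * det3 A) = 1 \<or> (u * det3 B) * (u' * det3 A) = -1"
    using u u' by (elim disjE) (simp_all only:, simp_all)
  ultimately have "u * u' * det3 (mm A B) = 1 \<or> u * u' * det3 (mm A B) = -1" by argo
  then show "\<exists>u r s t. (u * det3 (mm A B) = 1 \<or> u * det3 (mm A B) = - 1) \<and>
       tc_ainv (tf_subst F (mm A B)) = w_trans u r s t (tc_ainv F)"
    using 2 unfolding 1 w_trans_compose[OF nz] tf_subst_mm[OF inf F] by blast
qed

section \<open>The Jacobian under shears, transpositions and diagonal matrices\<close>

lemmas mat9_entries' = mat9_entries[unfolded One_nat_def[symmetric]]

lemma tf_subst_shear: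
  fixes F :: "'a::field tform"
  assumes "infinite (UNIV :: 'a set)" "ternary_cubic F"
  shows "tf_subst F (mat9 1 0 0 l 1 0 0 0 1) = cubic_form
    (F (3,0,0)) (F (0,3,0) + l * F (1,2,0) + l^2 * F (2,1,0) + l^3 * F (3,0,0)) (F (0,0,3))
    (F (2,1,0) + 3 * l * F (3,0,0)) (F (2,0,1)) (F (1,2,0) + 2 * l * F (2,1,0) + 3 * l^2 * F (3,0,0))
    (F (0,2,1) + l * F (1,1,1) + l^2 * F (2,0,1)) (F (1,0,2)) (F (0,1,2) + l * F (1,0,2))
    (F (1,1,1) + 2 * l * F (2,0,1))"
  unfolding tf_subst_eq_form[OF assms] mat9_entries' by (simp add: ac_simps)

lemma tf_subst_swap01:
  fixes F :: "'a::field tform"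
  assumes "infinite (UNIV :: 'a set)" "ternary_cubic F"
  shows "tf_subst F (mat9 0 1 0 1 0 0 0 0 1) = cubic_form
    (F (0,3,0)) (F (3,0,0)) (F (0,0,3)) (F (1,2,0)) (F (0,2,1)) (F (2,1,0)) (F (2,0,1))
    (F (0,1,2)) (F (1,0,2)) (F (1,1,1))"
  unfolding tf_subst_eq_form[OF assms] mat9_entries' by (simp add: ac_simps)

lemma tf_subst_swap12:
  fixes F :: "'a::field tform"
  assumes "infinite (UNIV :: 'a set)" "ternary_cubic F"
  shows "tf_subst F (mat9 1 0 0 0 0 1 0 1 0) = cubic_form
    (F (3,0,0)) (F (0,0,3)) (F (0,3,0)) (F (2,0,1)) (F (2,1,0)) (F (1,0,2)) (F (0,1,2))
    (F (1,2,0)) (F (0,2,1)) (F (1,1,1))"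
  unfolding tf_subst_eq_form[OF assms] mat9_entries' by (simp add: ac_simps)

lemma tf_subst_diag:
  fixes F :: "'a::field tform"
  assumes "infinite (UNIV :: 'a set)" "ternary_cubic F"
  shows "tf_subst F (mat9 a 0 0 0 b 0 0 0 c) = cubic_form
    (a^3 * F (3,0,0)) (b^3 * F (0,3,0)) (c^3 * F (0,0,3)) (a^2 * b * F (2,1,0)) (a^2 * c * F (2,0,1))
    (a * b^2 * F (1,2,0)) (b^2 * c * F (0,2,1))
    (a * c^2 * F (1,0,2)) (b * c^2 * F (0,1,2)) (a * b * c * F (1,1,1))"
  unfolding tf_subst_eq_form[OF assms] mat9_entries' by (simp add: ac_simps)

text \<open>The values of \<open>s\<close>, \<open>r\<close> and \<open>t\<close> are read off, in this order, from the transformation formulas for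
  \<open>a\<^sub>1\<close>, \<open>a\<^sub>2\<close> and \<open>a\<^sub>3\<close>.\<close>
lemma jac_equivariant_shear:
  fixes l :: "'a::field"
  assumes inf: "infinite (UNIV :: 'a set)"
  shows "jac_equivariant (mat9 1 0 0 l 1 0 0 0 1)"
  unfolding jac_equivariant_def
proof (intro allI impI)
  fix F :: "'a tform" assume F: "ternary_cubic F"
  have "tc_ainv (tf_subst F (mat9 1 0 0 l 1 0 0 0 1)) = w_trans 1
    (-2 * F (3,0,0) * F (1,0,2) * l^2 + -1 * F (3,0,0) * F (0,1,2) * l + -1 * F (2,1,0) * F (1,0,2) * l)
    (F (2,0,1) * l)
    (-4 * F (3,0,0) * F (2,0,1) * F (1,0,2) * l^3 + -2 * F (3,0,0) * F (2,0,1) * F (0,1,2) * l^2 + 3 * F (3,0,0) * F (1,2,0) * F (0,0,3) * l + -1 * F (3,0,0) * F (1,1,1) * F (1,0,2) * l^2 + -2 * F (3,0,0) * F (1,0,2) * F (0,2,1) * l + -2 * F (2,1,0) * F (2,0,1) * F (1,0,2) * l^2 + -1 * F (2,1,0) * F (2,0,1) * F (0,1,2) * l + -1 * F (2,1,0)^2 * F (0,0,3) * l + -1 * F (2,0,1) * F (1,2,0) * F (1,0,2) * l) (tc_ainv F)"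
    unfolding tf_subst_shear[OF inf F] tc_ainv_def w_trans_def Let_def prod.case cubic_form_coeffs
    unfolding prod.inject div_by_1 power_one by (intro conjI refl; algebra)
  moreover have "1 * det3 (mat9 1 0 0 l 1 0 0 0 1) = 1" by (simp add: det3_def)
  ultimately show "\<exists>u r s t. (u * det3 (mat9 1 0 0 l 1 0 0 0 1) = 1 \<or> u * det3 (mat9 1 0 0 l 1 0 0 0 1) = - 1) \<and>
       tc_ainv (tf_subst F (mat9 1 0 0 l 1 0 0 0 1)) = w_trans u r s t (tc_ainv F)" by blast
qed

lemma jac_equivariant_swap01:
  assumes inf: "infinite (UNIV :: 'a::field set)"
  shows "jac_equivariant (mat9 0 1 0 1 0 0 0 0 1 :: nat \<Rightarrow> nat \<Rightarrow> 'a)"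
  unfolding jac_equivariant_def
proof (intro allI impI)
  fix F :: "'a tform" assume F: "ternary_cubic F"
  let ?M = "mat9 0 1 0 1 0 0 0 0 1 :: nat \<Rightarrow> nat \<Rightarrow> 'a"
  have "tc_ainv (tf_subst F ?M) = tc_ainv F"
    unfolding tf_subst_swap01[OF inf F] tc_ainv_def Let_def cubic_form_coeffs
    unfolding prod.inject by (intro conjI refl; algebra)
  moreover have "1 * det3 ?M = -1" by (simp add: det3_def)
  ultimately show "\<exists>u r s t. (u * det3 ?M = 1 \<or> u * det3 ?M = - 1) \<and>
       tc_ainv (tf_subst F ?M) = w_trans u r s t (tc_ainv F)" by (metis w_trans_id)
qed

lemma jac_equivariant_swap12:
  assumes inf: "infinite (UNIV :: 'a::field set)"
  shows "jac_equivariant (mat9 1 0 0 0 0 1 0 1 0 :: nat \<Rightarrow> nat \<Rightarrow> 'a)"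
  unfolding jac_equivariant_def
proof (intro allI impI)
  fix F :: "'a tform" assume F: "ternary_cubic F"
  let ?M = "mat9 1 0 0 0 0 1 0 1 0 :: nat \<Rightarrow> nat \<Rightarrow> 'a"
  have "tc_ainv (tf_subst F ?M) = tc_ainv F"
    unfolding tf_subst_swap12[OF inf F] tc_ainv_def Let_def cubic_form_coeffs
    unfolding prod.inject by (intro conjI refl; algebra)
  moreover have "1 * det3 ?M = -1" by (simp add: det3_def)
  ultimately show "\<exists>u r s t. (u * det3 ?M = 1 \<or> u * det3 ?M = - 1) \<and>
       tc_ainv (tf_subst F ?M) = w_trans u r s t (tc_ainv F)" by (metis w_trans_id)
qed

lemma w_trans_scale:
  "u \<noteq> 0 \<Longrightarrow> w_trans (1/u) 0 0 0 (a1,a2,a3,a4,a6) = (u * a1, u^2 * a2, u^3 * a3, u^4 * a4, u^6 * (a6::'a::field))"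
  by (simp add: w_trans_def power_one_over mult.commute)

text \<open>The coefficients are isobaric: a diagonal substitution multiplies
  \<open>a\<^sub>i\<close> by the i-th power of its determinant.\<close>

lemma jac_equivariant_diag:
  fixes a b c :: "'a::field"
  assumes inf: "infinite (UNIV :: 'a set)" and nz: "a \<noteq> 0" "b \<noteq> 0" "c \<noteq> 0"
  shows "jac_equivariant (mat9 a 0 0 0 b 0 0 0 c)"
  unfolding jac_equivariant_def
proof (intro allI impI)
  fix F :: "'a tform" assume F: "ternary_cubic F"
  let ?M = "mat9 a 0 0 0 b 0 0 0 c"
  have "a * b * c \<noteq> 0" using nz by simp
  then have "tc_ainv (tf_subst F ?M) = w_trans (1 / (a * b * c)) 0 0 0 (tc_ainv F)"
    unfolding tf_subst_diag[OF inf F] tc_ainv_def Let_def cubic_form_coeffs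
    apply (subst w_trans_scale, assumption)
    unfolding prod.inject by (intro conjI refl; algebra)
  moreover have "1 / (a * b * c) * det3 ?M = 1" using nz by (simp add: det3_def)
  ultimately show "\<exists>u r s t. (u * det3 ?M = 1 \<or> u * det3 ?M = - 1) \<and>
       tc_ainv (tf_subst F ?M) = w_trans u r s t (tc_ainv F)" by blast
qed

text \<open>Each \<open>a\<^sub>i\<close> is homogeneous of degree i in the coefficients of the
  cubic.\<close>

lemma tc_ainv_smult:
  fixes c :: "'a::field"
  assumes "c \<noteq> 0"
  shows "tc_ainv (\<lambda>n. c * F n) = w_trans (1 / c) 0 0 0 (tc_ainv F)"
  unfolding tc_ainv_def Let_def w_trans_scale[OF assms]
  unfolding prod.inject by (intro conjI refl; algebra)

section \<open>Matrices in coordinates, elimination and the Smith normal form\<close>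

lemma mm_mat9:
  "mm (mat9 a b c d e f g h i) (mat9 a' b' c' d' e' f' g' h' i') = mat9
    (a * a' + b * d' + c * g') (a * b' + b * e' + c * h') (a * c' + b * f' + c * i')
    (d * a' + e * d' + f * g') (d * b' + e * e' + f * h') (d * c' + e * f' + f * i')
    (g * a' + h * d' + i * g') (g * b' + h * e' + i * h') (g * c' + h * f' + i * i')"
  by (intro ext) (simp add: mm_def mat9_def)

text \<open>Matrices are functions on all pairs of natural numbers; passing to the nine relevant
  entries makes matrix identities literal equalities that \<open>mm_mat9\<close> can
  compute.\<close>

lemma tf_subst_mat9:
  "tf_subst F M = tf_subst F (mat9 (M 0 0) (M 0 1) (M 0 2) (M 1 0) (M 1 1) (M 1 2) (M 2 0) (M 2 1) (M 2 2))"
  by (rule tf_subst_cong) (auto simp: mat9_def less_Suc_eq numeral_3_eq_3 numeral_2_eq_2)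

lemma det3_mat9:
  "det3 M = det3 (mat9 (M 0 0) (M 0 1) (M 0 2) (M 1 0) (M 1 1) (M 1 2) (M 2 0) (M 2 1) (M 2 2))"
  by (simp add: det3_def)

text \<open>Two adjacent transpositions and a single shear are enough, since every other elementary
  operation is conjugate to this shear by transpositions.\<close>

inductive elem_gen :: "('a::field \<Rightarrow> bool) \<Rightarrow> (nat \<Rightarrow> nat \<Rightarrow> 'a) \<Rightarrow> bool" for R where
  swap01: "elem_gen R (mat9 0 1 0 1 0 0 0 0 1)"
| swap12: "elem_gen R (mat9 1 0 0 0 0 1 0 1 0)"
| shear: "R l \<Longrightarrow> elem_gen R (mat9 1 0 0 l 1 0 0 0 1)"
| mult: "elem_gen R A \<Longrightarrow> elem_gen R B \<Longrightarrow> elem_gen R (mm A B)"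

lemma elem_gen_id: "elem_gen R (mat9 1 0 0 0 1 0 0 0 1)"
  using elem_gen.mult[OF elem_gen.swap01 elem_gen.swap01, of R] by (simp add: mm_mat9)

text \<open>Nine separate entries instead of a matrix: row and column operations then become
  backward rules that apply by unification.\<close>

definition smith_reducible where
  "smith_reducible R a b c d e f g h i \<longleftrightarrow> (\<exists>V x y z U. elem_gen R V \<and> elem_gen R U \<and> x \<noteq> 0 \<and> y \<noteq> 0 \<and> z \<noteq> 0 \<and>
     mat9 a b c d e f g h i = mm V (mm (mat9 x 0 0 0 y 0 0 0 z) U))"

lemma smith_reducible_mult_left:
  assumes S: "elem_gen R S" and Q: "smith_reducible R a' b' c' d' e' f' g' h' i'"
    and eq: "mat9 a b c d e f g h i = mm S (mat9 a' b' c' d' e' f' g' h' i')"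
  shows "smith_reducible R a b c d e f g h i"
proof -
  obtain V x y z U where V: "elem_gen R V" and U: "elem_gen R U" "x \<noteq> 0" "y \<noteq> 0" "z \<noteq> 0"
     "mat9 a' b' c' d' e' f' g' h' i' = mm V (mm (mat9 x 0 0 0 y 0 0 0 z) U)"
    using Q unfolding smith_reducible_def by blast
  have "mat9 a b c d e f g h i = mm (mm S V) (mm (mat9 x 0 0 0 y 0 0 0 z) U)"
    by (simp add: eq U(5) mm_assoc)
  with elem_gen.mult[OF S V] U(1-4) show ?thesis unfolding smith_reducible_def by blast
qed

lemma smith_reducible_mult_right:
  assumes S: "elem_gen R S" and Q: "smith_reducible R a' b' c' d' e' f' g' h' i'"
    and eq: "mat9 a b c d e f g h i = mm (mat9 a' b' c' d' e' f' g' h' i') S"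
  shows "smith_reducible R a b c d e f g h i"
proof -
  obtain V x y z U where U: "elem_gen R U" and V: "elem_gen R V" "x \<noteq> 0" "y \<noteq> 0" "z \<noteq> 0"
     "mat9 a' b' c' d' e' f' g' h' i' = mm V (mm (mat9 x 0 0 0 y 0 0 0 z) U)"
    using Q unfolding smith_reducible_def by blast
  have "mat9 a b c d e f g h i = mm V (mm (mat9 x 0 0 0 y 0 0 0 z) (mm U S))"
    by (simp add: eq V(5) mm_assoc)
  with elem_gen.mult[OF U S] V(1-4) show ?thesis unfolding smith_reducible_def by blast
qed

text \<open>The abstract form of choosing an entry of least valuation as pivot. Quotients lying in
  \<open>R\<close> define a total preorder on the nonzero elements: \<open>tot\<close> is totality
  and \<open>mul\<close> gives transitivity.\<close>

lemma exists_divisor: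
  fixes R :: "'a::field \<Rightarrow> bool"
  assumes tot: "\<And>a b. a \<noteq> 0 \<Longrightarrow> b \<noteq> 0 \<Longrightarrow> R (a / b) \<or> R (b / a)" and R0: "R 0"
    and mul: "\<And>a b. R a \<Longrightarrow> R b \<Longrightarrow> R (a * b)"
    and S: "finite S" "\<exists>x\<in>S. x \<noteq> 0"
  shows "\<exists>x\<in>S. x \<noteq> 0 \<and> (\<forall>y\<in>S. R (y / x))"
  using S
proof (induction S rule: finite_induct)
  case (insert w S)
  show ?case
  proof (cases "\<exists>x\<in>S. x \<noteq> 0")
    case True
    then obtain x where x: "x \<in> S" "x \<noteq> 0" "\<forall>y\<in>S. R (y / x)" using insert.IH by blast
    show ?thesis
    proof (cases "R (w / x)")
      case True then show ?thesis using x by auto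
    next
      case False
      then have "w \<noteq> 0" using R0 by (cases "w = 0") auto
      then have w: "w \<noteq> 0" "R (x / w)" using tot[OF _ x(2), of w] False by auto
      have "R (y / w)" if "y \<in> S" for y
        using mul[OF x(3)[rule_format, OF that] w(2)] x(2) by simp
      moreover have "R (w / w)" using tot[OF w(1) w(1)] by blast
      ultimately show ?thesis using w by auto
    qed
  next
    case False
    then have w: "w \<noteq> 0" using insert.prems by auto
    have "R (w / w)" using tot[OF w w] by blast
    then show ?thesis using w False R0 by (intro bexI[of _ w]) auto
  qed
qed simp

text \<open>Multipliers are restricted to \<open>R\<close>, which contains one of the two quotients of any two nonzero
  elements. For \<open>R\<close> always true this is elimination over a field, for \<open>R\<close> integrality it is the Smith
  normal form over the valuation ring.\<close>
locale gauss_elim =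
  fixes R :: "'a::field \<Rightarrow> bool"
  assumes tot: "\<And>a b. a \<noteq> 0 \<Longrightarrow> b \<noteq> 0 \<Longrightarrow> R (a / b) \<or> R (b / a)" and R0: "R 0"
    and mul: "\<And>a b. R a \<Longrightarrow> R b \<Longrightarrow> R (a * b)" and neg: "\<And>a. R a \<Longrightarrow> R (- a)"
begin

abbreviation "Q \<equiv> smith_reducible R"

lemma row_swap01: "Q d e f a b c g h i \<Longrightarrow> Q a b c d e f g h i"
  by (rule smith_reducible_mult_left[OF elem_gen.swap01]) (auto simp: mm_mat9)
lemma row_swap12: "Q a b c g h i d e f \<Longrightarrow> Q a b c d e f g h i"
  by (rule smith_reducible_mult_left[OF elem_gen.swap12]) (auto simp: mm_mat9)
lemma col_swap01: "Q b a c e d f h g i \<Longrightarrow> Q a b c d e f g h i"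
  by (rule smith_reducible_mult_right[OF elem_gen.swap01]) (auto simp: mm_mat9)
lemma col_swap12: "Q a c b d f e g i h \<Longrightarrow> Q a b c d e f g h i"
  by (rule smith_reducible_mult_right[OF elem_gen.swap12]) (auto simp: mm_mat9)
lemma row_add10: "R l \<Longrightarrow> Q a b c (d - l * a) (e - l * b) (f - l * c) g h i \<Longrightarrow> Q a b c d e f g h i"
  by (rule smith_reducible_mult_left[OF elem_gen.shear, of R l]) (auto simp: mm_mat9)
lemma col_add10: "R l \<Longrightarrow> Q (a - l * b) b c (d - l * e) e f (g - l * h) h i \<Longrightarrow> Q a b c d e f g h i"
  by (rule smith_reducible_mult_right[OF elem_gen.shear, of R l]) (auto simp: mm_mat9 mult.commute)
lemma row_add20: "R l \<Longrightarrow> Q a b c d e f (g - l * a) (h - l * b) (i - l * c) \<Longrightarrow> Q a b c d e f g h i"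
  by (rule row_swap12, rule row_add10[of l], assumption, rule row_swap12)
lemma row_add21: "R l \<Longrightarrow> Q a b c d e f (g - l * d) (h - l * e) (i - l * f) \<Longrightarrow> Q a b c d e f g h i"
  by (rule row_swap01, rule row_add20[of l], assumption, rule row_swap01)
lemma col_add01: "R l \<Longrightarrow> Q a (b - l * a) c d (e - l * d) f g (h - l * g) i \<Longrightarrow> Q a b c d e f g h i"
  by (rule col_swap01, rule col_add10[of l], assumption, rule col_swap01)
lemma col_add02: "R l \<Longrightarrow> Q a b (c - l * a) d e (f - l * d) g h (i - l * g) \<Longrightarrow> Q a b c d e f g h i"
  by (rule col_swap12, rule col_add01[of l], assumption, rule col_swap12)
lemma col_add12: "R l \<Longrightarrow> Q a b (c - l * b) d e (f - l * e) g h (i - l * h) \<Longrightarrow> Q a b c d e f g h i"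
  by (rule col_swap01, rule col_add02[of l], assumption, rule col_swap01)

lemma smith_diag: "x \<noteq> 0 \<Longrightarrow> y \<noteq> 0 \<Longrightarrow> z \<noteq> 0 \<Longrightarrow> Q x 0 0 0 y 0 0 0 z"
  unfolding smith_reducible_def
  by (rule exI[of _ "mat9 1 0 0 0 1 0 0 0 1"], rule exI[of _ x], rule exI[of _ y], rule exI[of _ z],
      rule exI[of _ "mat9 1 0 0 0 1 0 0 0 1"]) (simp add: elem_gen_id mm_mat9)

lemma smith_block_pivot:
  assumes a: "a \<noteq> 0" "e \<noteq> 0" and det: "e * i - f * h \<noteq> 0"
    and R: "R (f / e)" "R (h / e)"
  shows "Q a 0 0 0 e f 0 h i"
proof -
  have "i - h / e * f \<noteq> 0" using det a(2) by (simp add: field_simps)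
  then have "Q a 0 0 0 e 0 0 0 (i - h / e * f)" by (intro smith_diag a)
  then have "Q a 0 0 0 e f 0 0 (i - h / e * f)" using a(2) by - (rule col_add12[OF R(1)], simp)
  then show ?thesis using a(2) by - (rule row_add21[OF R(2)], simp)
qed

lemma smith_block:
  assumes a: "a \<noteq> 0" and det: "e * i - f * h \<noteq> 0"
  shows "Q a 0 0 0 e f 0 h i"
proof -
  have "\<exists>x\<in>{e,f,h,i}. x \<noteq> 0" using det by (cases "e = 0"; cases "f = 0") simp_all
  from exists_divisor[OF tot R0 mul _ this] obtain x where
    x: "x \<in> {e,f,h,i}" "x \<noteq> 0" and R': "\<forall>y\<in>{e,f,h,i}. R (y / x)" by blast
  then have R: "R (e / x)" "R (f / x)" "R (h / x)" "R (i / x)" by simp_all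
  from x(1) consider "x = e" | "x = f" | "x = h" | "x = i" by auto
  then show ?thesis
  proof cases
    case 1
    show ?thesis by (rule smith_block_pivot[OF a _ det]) (use x(2) R 1 in simp_all)
  next
    case 2
    have "f * h - e * i \<noteq> 0" using det by (simp add: algebra_simps)
    then have "Q a 0 0 0 f e 0 i h" by (rule smith_block_pivot[OF a, rotated]) (use x(2) R 2 in simp_all)
    then show ?thesis by (rule col_swap12)
  next
    case 3
    have "h * f - i * e \<noteq> 0" using det by (simp add: algebra_simps)
    then have "Q a 0 0 0 h i 0 e f" by (rule smith_block_pivot[OF a, rotated]) (use x(2) R 3 in simp_all)
    then show ?thesis by (rule row_swap12)
  next
    case 4
    have "i * e - h * f \<noteq> 0" using det by (simp add: algebra_simps)
    then have "Q a 0 0 0 i h 0 f e" by (rule smith_block_pivot[OF a, rotated]) (use x(2) R 4 in simp_all)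
    then show ?thesis by (rule row_swap12[OF col_swap12])
  qed
qed

definition det9 :: "'a \<Rightarrow> 'a \<Rightarrow> 'a \<Rightarrow> 'a \<Rightarrow> 'a \<Rightarrow> 'a \<Rightarrow> 'a \<Rightarrow> 'a \<Rightarrow> 'a \<Rightarrow> 'a" where
  "det9 a b c d e f g h i = a * e * i + b * f * g + c * d * h - a * f * h - b * d * i - c * e * g"

text \<open>Clearing the first row and column leaves the Schur complement of the pivot, whose
  determinant is \<open>det9\<close> divided by the pivot and hence nonzero, so the block case
  applies.\<close>

lemma smith_pivot:
  assumes a: "a \<noteq> 0" and det: "det9 a b c d e f g h i \<noteq> 0"
    and R: "R (b / a)" "R (c / a)" "R (d / a)" "R (g / a)"
  shows "Q a b c d e f g h i"
proof -
  have "a * ((e - d / a * b) * (i - g / a * c) - (f - d / a * c) * (h - g / a * b)) = det9 a b c d e f g h i"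
    using a by (simp add: det9_def field_simps)
  then have "(e - d / a * b) * (i - g / a * c) - (f - d / a * c) * (h - g / a * b) \<noteq> 0"
    using det by auto
  from smith_block[OF a this]
  have "Q a b c 0 (e - d / a * b) (f - d / a * c) 0 (h - g / a * b) (i - g / a * c)"
    using a by - (rule col_add01[OF R(1)], rule col_add02[OF R(2)], simp)
  then show ?thesis using a by - (rule row_add10[OF R(3)], rule row_add20[OF R(4)], simp)
qed

lemma smith_pivot_col0:
  assumes x: "x \<noteq> 0" "x \<in> {a,d,g}" and det: "det9 a b c d e f g h i \<noteq> 0"
    and R: "\<And>y. y \<in> {a,b,c,d,e,f,g,h,i} \<Longrightarrow> R (y / x)"
  shows "Q a b c d e f g h i"
proof -
  from x(2) consider "x = a" | "x = d" | "x = g" by auto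
  then show ?thesis
  proof cases
    case 1
    show ?thesis by (rule smith_pivot[OF _ det]) (use x(1) R 1 in auto)
  next
    case 2
    have "det9 d e f a b c g h i \<noteq> 0" using det by (simp add: det9_def algebra_simps)
    then have "Q d e f a b c g h i" by (rule smith_pivot[rotated]) (use x(1) R 2 in auto)
    then show ?thesis by (rule row_swap01)
  next
    case 3
    have "det9 g h i a b c d e f \<noteq> 0" using det by (simp add: det9_def algebra_simps)
    then have "Q g h i a b c d e f" by (rule smith_pivot[rotated]) (use x(1) R 3 in auto)
    then show ?thesis by (rule row_swap12[OF row_swap01])
  qed
qed

lemma smith:
  assumes det: "det9 a b c d e f g h i \<noteq> 0"
  shows "Q a b c d e f g h i"
proof -
  have "\<exists>x\<in>{a,b,c,d,e,f,g,h,i}. x \<noteq> 0" using det by (auto simp: det9_def)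
  from exists_divisor[OF tot R0 mul _ this] obtain x where
    x: "x \<in> {a,b,c,d,e,f,g,h,i}" "x \<noteq> 0" and R: "\<forall>y\<in>{a,b,c,d,e,f,g,h,i}. R (y / x)" by blast
  from x(1) consider "x \<in> {a,d,g}" | "x \<in> {b,e,h}" | "x \<in> {c,f,i}" by auto
  then show ?thesis
  proof cases
    case 1 then show ?thesis by (rule smith_pivot_col0[OF x(2) _ det]) (use R in blast)
  next
    case 2
    have "det9 b a c e d f h g i \<noteq> 0" using det by (simp add: det9_def algebra_simps)
    then have "Q b a c e d f h g i" by (rule smith_pivot_col0[OF x(2) 2]) (use R in blast)
    then show ?thesis by (rule col_swap01)
  next
    case 3
    have "det9 c a b f d e i g h \<noteq> 0" using det by (simp add: det9_def algebra_simps)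
    then have "Q c a b f d e i g h" by (rule smith_pivot_col0[OF x(2) 3]) (use R in blast)
    then show ?thesis by (rule col_swap12[OF col_swap01])
  qed
qed

lemma smith_mat:
  assumes "det3 M \<noteq> 0"
  obtains V x y z U where "elem_gen R V" "elem_gen R U" "x \<noteq> 0" "y \<noteq> 0" "z \<noteq> 0"
    "mat9 (M 0 0) (M 0 1) (M 0 2) (M 1 0) (M 1 1) (M 1 2) (M 2 0) (M 2 1) (M 2 2)
       = mm V (mm (mat9 x 0 0 0 y 0 0 0 z) U)"
proof -
  have "det9 (M 0 0) (M 0 1) (M 0 2) (M 1 0) (M 1 1) (M 1 2) (M 2 0) (M 2 1) (M 2 2) \<noteq> 0"
    using assms by (simp add: det9_def det3_def)
  from smith[OF this] show ?thesis using that unfolding smith_reducible_def by blast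
qed

end

lemma jac_equivariant_elem_gen:
  assumes inf: "infinite (UNIV :: 'a::field set)" and "elem_gen R (A :: nat \<Rightarrow> nat \<Rightarrow> 'a)"
  shows "jac_equivariant A"
  using assms(2)
  by induction (simp_all add: jac_equivariant_swap01[OF inf] jac_equivariant_swap12[OF inf]
      jac_equivariant_shear[OF inf] jac_equivariant_mm[OF inf])

text \<open>Over a field every invertible matrix is a product of generators and one diagonal matrix,
  and equivariance is multiplicative.\<close>

lemma jac_equivariant:
  assumes inf: "infinite (UNIV :: 'a::field set)" and M: "det3 (M :: nat \<Rightarrow> nat \<Rightarrow> 'a) \<noteq> 0"
  shows "jac_equivariant M"
proof -
  interpret gauss_elim "\<lambda>_::'a. True" by standard auto
  obtain V x y z U where V: "elem_gen (\<lambda>_. True) V" "elem_gen (\<lambda>_. True) U" "x \<noteq> 0" "y \<noteq> 0" "z \<noteq> 0"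
    and e: "mat9 (M 0 0) (M 0 1) (M 0 2) (M 1 0) (M 1 1) (M 1 2) (M 2 0) (M 2 1) (M 2 2)
       = mm V (mm (mat9 x 0 0 0 y 0 0 0 z) U)"
    by (rule smith_mat[OF M])
  have "jac_equivariant (mm V (mm (mat9 x 0 0 0 y 0 0 0 z) U))"
    using jac_equivariant_mm[OF inf jac_equivariant_elem_gen[OF inf V(1)]
        jac_equivariant_mm[OF inf jac_equivariant_diag[OF inf V(3-5)] jac_equivariant_elem_gen[OF inf V(2)]]] .
  then show ?thesis
    unfolding jac_equivariant_def tf_subst_mat9[of _ M] det3_mat9[of M] e .
qed

lemma tc_ainv_equiv:
  fixes F :: "'a::field tform"
  assumes inf: "infinite (UNIV :: 'a set)" and M: "det3 M \<noteq> 0" and F: "ternary_cubic F" and c: "c \<noteq> 0"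
  obtains u r s t where "u * (c * det3 M) = 1 \<or> u * (c * det3 M) = -1" "u \<noteq> 0"
    "tc_ainv (\<lambda>n. c * tf_subst F M n) = w_trans u r s t (tc_ainv F)"
proof -
  obtain u r s t where u: "u * det3 M = 1 \<or> u * det3 M = -1"
    and e: "tc_ainv (tf_subst F M) = w_trans u r s t (tc_ainv F)"
    using jac_equivariant[OF inf M] F unfolding jac_equivariant_def by blast
  have u0: "u \<noteq> 0" using u by auto
  have c': "1 / c \<noteq> 0" using c by simp
  have "tc_ainv (\<lambda>n. c * tf_subst F M n) = w_trans (u * (1 / c)) (u^2 * 0 + r) (u * 0 + s) (u^3 * 0 + u^2 * 0 * s + t) (tc_ainv F)"
    unfolding tc_ainv_smult[OF c] e w_trans_compose[OF u0 c'] ..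
  moreover have "u * (1 / c) * (c * det3 M) = u * det3 M" using c by simp
  ultimately show ?thesis using that[of "u * (1/c)"] u u0 c by simp
qed

section \<open>Discrete valuations and levels\<close>

locale dval =
  fixes v :: "'a::field \<Rightarrow> int"
  assumes dval: "discrete_valuation v"
begin

lemma v_mult: "x \<noteq> 0 \<Longrightarrow> y \<noteq> 0 \<Longrightarrow> v (x * y) = v x + v y"
  using dval by (simp add: discrete_valuation_def)

lemma v_one: "v 1 = 0"
  using v_mult[of 1 1] by simp

lemma v_minus_one: "v (- 1) = 0"
  using v_mult[of "-1" "-1"] v_one by simp

lemma v_uminus: "v (- x) = v x"
  using v_mult[of "-1" x] v_minus_one by (cases "x = 0") simp_all

lemma v_power: "x \<noteq> 0 \<Longrightarrow> v (x ^ n) = int n * v x"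
  by (induction n) (simp_all add: v_one v_mult algebra_simps)

lemma v_inverse: "x \<noteq> 0 \<Longrightarrow> v (1 / x) = - v x"
  using v_mult[of x "1/x"] v_one by simp

lemma v_divide: "x \<noteq> 0 \<Longrightarrow> y \<noteq> 0 \<Longrightarrow> v (x / y) = v x - v y"
  using v_mult[of x "1/y"] v_inverse[of y] by simp

lemma ge_0 [simp]: "val_ge v n 0"
  by (simp add: val_ge_def)

lemma ge_add: "val_ge v n x \<Longrightarrow> val_ge v n y \<Longrightarrow> val_ge v n (x + y)"
proof -
  assume "val_ge v n x" "val_ge v n y"
  moreover have "x \<noteq> 0 \<Longrightarrow> y \<noteq> 0 \<Longrightarrow> x + y \<noteq> 0 \<Longrightarrow> min (v x) (v y) \<le> v (x + y)"
    using dval by (simp add: discrete_valuation_def)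
  ultimately show ?thesis by (fastforce simp: val_ge_def)
qed

lemma ge_uminus: "val_ge v n (- x) \<longleftrightarrow> val_ge v n x"
  by (simp add: val_ge_def v_uminus)

lemma ge_diff: "val_ge v n x \<Longrightarrow> val_ge v n y \<Longrightarrow> val_ge v n (x - y)"
  using ge_add[of n x "- y"] by (simp add: ge_uminus)

lemma ge_mult: "val_ge v m x \<Longrightarrow> val_ge v n y \<Longrightarrow> val_ge v (m + n) (x * y)"
  by (cases "x = 0"; cases "y = 0") (simp_all add: val_ge_def v_mult)

lemma ge_mono: "val_ge v m x \<Longrightarrow> n \<le> m \<Longrightarrow> val_ge v n x"
  by (auto simp: val_ge_def)

lemma ge_mult_left: "x \<noteq> 0 \<Longrightarrow> val_ge v n (x * y) \<longleftrightarrow> val_ge v (n - v x) y"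
  by (cases "y = 0") (auto simp: val_ge_def v_mult)

lemma int_0 [simp]: "integral v 0" and int_1 [simp]: "integral v 1"
  by (simp_all add: integral_def val_ge_def v_one)

lemma int_add: "integral v x \<Longrightarrow> integral v y \<Longrightarrow> integral v (x + y)"
  and int_diff: "integral v x \<Longrightarrow> integral v y \<Longrightarrow> integral v (x - y)"
  and int_uminus: "integral v (- x) \<longleftrightarrow> integral v x"
  by (simp_all add: integral_def ge_add ge_diff ge_uminus)

lemma int_mult: "integral v x \<Longrightarrow> integral v y \<Longrightarrow> integral v (x * y)"
  using ge_mult[of 0 x 0 y] by (simp add: integral_def)

lemma int_power: "integral v x \<Longrightarrow> integral v (x ^ n)"
  by (induction n) (simp_all add: int_mult)

lemma int_of_nat: "integral v (of_nat n)"
  by (induction n) (simp_all add: int_add)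

lemma int_numeral: "integral v (numeral n)"
  using int_of_nat[of "numeral n"] by simp

lemmas int_simps = int_add int_diff int_uminus int_mult int_power int_numeral
lemmas int_intros = int_add int_diff int_uminus[THEN iffD2] int_mult int_power int_numeral

lemma int_sum: "(\<And>i. i \<in> A \<Longrightarrow> integral v (f i)) \<Longrightarrow> integral v (sum f A)"
  by (induction A rule: infinite_finite_induct) (simp_all add: int_add)

lemma ge_mult_int: "val_ge v n x \<Longrightarrow> integral v y \<Longrightarrow> val_ge v n (x * y)"
  and ge_int_mult: "integral v x \<Longrightarrow> val_ge v n y \<Longrightarrow> val_ge v n (x * y)"
  using ge_mult[of n x 0 y] ge_mult[of 0 x n y] by (simp_all add: integral_def)

lemma ge_power: "val_ge v n x \<Longrightarrow> val_ge v (int k * n) (x ^ k)"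
proof (induction k)
  case 0 show ?case using int_1 by (simp add: integral_def)
next
  case (Suc k) then show ?case using ge_mult[of n x "int k * n" "x ^ k"] by (simp add: algebra_simps)
qed

lemma int_totality: "a \<noteq> 0 \<Longrightarrow> b \<noteq> 0 \<Longrightarrow> integral v (a / b) \<or> integral v (b / a)"
  by (auto simp: integral_def val_ge_def v_divide)

lemma unit_iff: "integral v x \<Longrightarrow> \<not> val_ge v 1 x \<longleftrightarrow> x \<noteq> 0 \<and> v x = 0"
  by (auto simp: integral_def val_ge_def)

lemma infinite_field: "infinite (UNIV :: 'a set)"
proof -
  obtain x where x: "x \<noteq> 0" "v x = 1" using dval by (auto simp: discrete_valuation_def)
  have "inj (\<lambda>n. x ^ n)"
  proof (rule injI)
    fix m n :: nat assume "x ^ m = x ^ n"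
    then have "v (x ^ m) = v (x ^ n)" by (rule arg_cong)
    then show "m = n" by (simp add: v_power[OF x(1)] x(2))
  qed
  then have "infinite (range (\<lambda>n. x ^ n))" by (rule range_inj_infinite)
  then show ?thesis using infinite_super[OF subset_UNIV] by blast
qed

text \<open>Integral closedness of the valuation ring: if \<open>x\<close> were not integral,
  \<open>1 / x\<close> would be, and dividing the equation by \<open>x\<close> would express
  \<open>x\<close> through integral elements. The next two lemmas repeat this in degrees 3 and 4
  with a unit leading coefficient.\<close>

lemma int_root2:
  assumes "integral v b" "integral v c" "integral v (x^2 + b * x + c)"
  shows "integral v x"
proof (rule ccontr)
  assume n: "\<not> integral v x"
  then have x: "x \<noteq> 0" "v x < 0" by (auto simp: integral_def val_ge_def)
  have "integral v (1 / x)" using x by (simp add: integral_def val_ge_def v_inverse)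
  then have "integral v ((x^2 + b * x + c) * (1/x) - b - c * (1/x))"
    using assms by (simp only: int_simps)
  moreover have "(x^2 + b * x + c) * (1/x) - b - c * (1/x) = x" using x by (simp add: field_simps power2_eq_square)
  ultimately show False using n by simp
qed

lemma int_root_lead_unit:
  assumes e: "e \<noteq> 0" "v e = 0" and c: "integral v b" "integral v c" "integral v d" "integral v (e * x^3 + b * x^2 + c * x + d)"
  shows "integral v x"
proof (rule ccontr)
  assume n: "\<not> integral v x"
  then have x: "x \<noteq> 0" "v x < 0" by (auto simp: integral_def val_ge_def)
  have i: "integral v (1 / x)" "integral v (1/e)" using x e by (simp_all add: integral_def val_ge_def v_inverse)
  then have "integral v (((e * x^3 + b * x^2 + c * x + d) * (1/x)^2 - b - c * (1/x) - d * (1/x)^2) * (1/e))"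
    using c by (simp only: int_simps)
  moreover have "((e * x^3 + b * x^2 + c * x + d) * (1/x)^2 - b - c * (1/x) - d * (1/x)^2) * (1/e) = x"
    using x e by (simp add: field_simps power2_eq_square power3_eq_cube)
  ultimately show False using n by simp
qed

lemma int_root4_lead_unit:
  assumes e: "e \<noteq> 0" "v e = 0" and c: "integral v a" "integral v b" "integral v c" "integral v d"
    "integral v (e * x^4 + a * x^3 + b * x^2 + c * x + d)"
  shows "integral v x"
proof (rule ccontr)
  assume n: "\<not> integral v x"
  then have x: "x \<noteq> 0" "v x < 0" by (auto simp: integral_def val_ge_def)
  have i: "integral v (1 / x)" "integral v (1/e)" using x e by (simp_all add: integral_def val_ge_def v_inverse)
  then have "integral v (((e * x^4 + a * x^3 + b * x^2 + c * x + d) * (1/x)^3 - a - b * (1/x) - c * (1/x)^2 - d * (1/x)^3) * (1/e))"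
    using c by (simp only: int_simps)
  moreover have "((e * x^4 + a * x^3 + b * x^2 + c * x + d) * (1/x)^3 - a - b * (1/x) - c * (1/x)^2 - d * (1/x)^3) * (1/e) = x"
    using x e by (simp add: field_simps power2_eq_square power3_eq_cube power4_eq_xxxx)
  ultimately show False using n by simp
qed

text \<open>3 and 4 differ by 1, so they cannot both lie in the maximal ideal. They are the leading
  coefficients in \<open>r\<close> of the transformed \<open>b8\<close> and
  \<open>b6\<close>.\<close>

lemma three_or_four_unit: "(3 \<noteq> (0::'a) \<and> v 3 = 0) \<or> (4 \<noteq> (0::'a) \<and> v 4 = 0)"
proof (rule ccontr)
  assume "\<not> ?thesis"
  then have "val_ge v 1 3" "val_ge v 1 4" using unit_iff int_numeral by blast+
  then have "val_ge v 1 (4 - 3)" by (rule ge_diff[rotated])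
  then show False by (simp add: val_ge_def v_one)
qed

text \<open>The transformed \<open>b6\<close> and \<open>b8\<close> are polynomials in
  \<open>r\<close> alone, and at least one of them has a unit leading coefficient, so
  \<open>r\<close> is integral. After that the formulas for \<open>a2\<close> and \<open>a6\<close>
  are monic quadratic equations for \<open>s\<close> and for \<open>t\<close>.\<close>

lemma w_trans_int_params:
  assumes A: "w_integral v A" and B: "w_integral v (w_trans u r s t A)" and u: "u \<noteq> 0" "integral v u"
  shows "integral v r \<and> integral v s \<and> integral v t"
proof -
  obtain a1 a2 a3 a4 a6 where A': "A = (a1,a2,a3,a4,a6)" by (cases A)
  obtain x1 x2 x3 x4 x6 where B': "w_trans u r s t A = (x1,x2,x3,x4,x6)" by (cases "w_trans u r s t A")
  have a: "integral v a1" "integral v a2" "integral v a3" "integral v a4" "integral v a6"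
    using A by (auto simp: A' w_integral_def)
  have x: "integral v x1" "integral v x2" "integral v x3" "integral v x4" "integral v x6"
    using B by (auto simp: B' w_integral_def)
  have e: "u * x1 = a1 + 2 * s" "u^2 * x2 = a2 - s * a1 + 3 * r - s\<^sup>2" "u^3 * x3 = a3 + r * a1 + 2 * t"
     "u^4 * x4 = a4 - s * a3 + 2 * r * a2 - (t + r * s) * a1 + 3 * r\<^sup>2 - 2 * s * t"
     "u^6 * x6 = a6 + r * a4 + r\<^sup>2 * a2 + r ^ 3 - t * a3 - t\<^sup>2 - r * t * a1"
    using B' u by (auto simp: A' w_trans_def)
  define c2 c4 c6 c8 where c: "c2 = a1\<^sup>2 + 4 * a2" "c4 = a1 * a3 + 2 * a4" "c6 = a3\<^sup>2 + 4 * a6"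
     "c8 = a1\<^sup>2 * a6 + 4 * a2 * a6 - a1 * a3 * a4 + a2 * a3\<^sup>2 - a4\<^sup>2"
  have ci: "integral v c2" "integral v c4" "integral v c6" "integral v c8" unfolding c by (intro int_intros a)+
  have b6: "4 * r^3 + c2 * r^2 + (2 * c4) * r + c6 = (u^3 * x3)\<^sup>2 + 4 * (u^6 * x6)"
    unfolding c e by algebra
  have b8: "3 * r^4 + c2 * r^3 + (3 * c4) * r^2 + (3 * c6) * r + c8
     = (u*x1)\<^sup>2 * (u^6 * x6) + 4 * (u^2 * x2) * (u^6 * x6) - (u * x1) * (u^3 * x3) * (u^4 * x4) + (u^2 * x2) * (u^3 * x3)\<^sup>2 - (u^4 * x4)\<^sup>2"
    unfolding c e by algebra
  have r: "integral v r" using three_or_four_unit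
  proof
    assume 3: "3 \<noteq> (0::'a) \<and> v 3 = 0"
    have I: "integral v (3 * r^4 + c2 * r^3 + (3 * c4) * r^2 + (3 * c6) * r + c8)"
      unfolding b8 by (intro int_intros x u)
    show ?thesis using 3 int_root4_lead_unit[OF _ _ ci(1) int_mult[OF int_numeral ci(2)] int_mult[OF int_numeral ci(3)] ci(4) I] by blast
  next
    assume 4: "4 \<noteq> (0::'a) \<and> v 4 = 0"
    have I: "integral v (4 * r^3 + c2 * r^2 + (2 * c4) * r + c6)"
      unfolding b6 by (intro int_intros x u)
    show ?thesis using 4 int_root_lead_unit[OF _ _ ci(1) int_mult[OF int_numeral ci(2)] ci(3) I] by blast
  qed
  have "s^2 + a1 * s + (- a2 - 3 * r) = - (u^2 * x2)" unfolding e by algebra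
  moreover have "integral v (- (u^2 * x2))" by (intro int_intros x u)
  ultimately have "integral v (s^2 + a1 * s + (- a2 - 3 * r))" by simp
  then have s: "integral v s"
    by (rule int_root2[rotated 2]) (intro int_intros a r)+
  have "t^2 + (a3 + r * a1) * t + (- a6 - r * a4 - r^2 * a2 - r^3) = - (u^6 * x6)" unfolding e by algebra
  moreover have "integral v (- (u^6 * x6))" by (intro int_intros x u)
  ultimately have "integral v (t^2 + (a3 + r * a1) * t + (- a6 - r * a4 - r^2 * a2 - r^3))" by simp
  then have "integral v t"
    by (rule int_root2[rotated 2]) (intro int_intros a r)+
  then show ?thesis using r s by blast
qed

lemma tc_ainv_integral:
  assumes "form_integral v F"
  shows "w_integral v (tc_ainv F)"
proof -
  have "integral v (F n)" for n using assms by (cases n) (simp add: form_integral_def form_val_ge_def integral_def)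
  then show ?thesis unfolding w_integral_def tc_ainv_def Let_def prod.case
    by (intro conjI int_intros)
qed

lemma w_disc_integral: "w_integral v A \<Longrightarrow> integral v (w_disc A)"
  unfolding w_integral_def w_disc_def Let_def by (cases A) (simp add: int_simps)

text \<open>The \<open>LEAST\<close> in \<open>min_disc_val\<close> is meaningful because the
  identity change of coordinates qualifies: an integral equation has a discriminant of nonnegative
  valuation.\<close>

lemma min_disc_val_attained:
  assumes "w_integral v A" "w_disc A \<noteq> 0"
  obtains u r s t where "u \<noteq> 0" "w_integral v (w_trans u r s t A)" "w_disc (w_trans u r s t A) \<noteq> 0"
     "v (w_disc (w_trans u r s t A)) = int (min_disc_val v A)"
proof -
  define Pr where "Pr n \<longleftrightarrow> (\<exists>u r s t. u \<noteq> 0 \<and> w_integral v (w_trans u r s t A) \<and>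
        w_disc (w_trans u r s t A) \<noteq> 0 \<and> v (w_disc (w_trans u r s t A)) = int n)" for n
  have "0 \<le> v (w_disc A)" using w_disc_integral[OF assms(1)] assms(2) by (auto simp: integral_def val_ge_def)
  then have "Pr (nat (v (w_disc A)))" unfolding Pr_def using assms
    by (intro exI[of _ 1] exI[of _ 0]) (simp add: w_trans_id)
  then have "Pr (LEAST n. Pr n)" by (rule LeastI)
  then show ?thesis using that unfolding Pr_def min_disc_val_def by blast
qed

text \<open>Let \<open>u, r, s, t\<close> lead to a minimal equation. Positive level means that
  \<open>u\<close> is not a unit; performing the translation without the scaling leaves the factor
  \<open>u^i\<close> on the i-th coefficient.\<close>

lemma positive_level:
  assumes F: "form_integral v F" and disc: "tc_disc F \<noteq> 0" and lev: "0 < tc_level v F"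
  obtains r s t b1 b2 b3 b4 b6 where "integral v r" "integral v s" "integral v t"
    "w_trans 1 r s t (tc_ainv F) = (b1,b2,b3,b4,b6)"
    "val_ge v 1 b1" "val_ge v 2 b2" "val_ge v 3 b3" "val_ge v 4 b4" "val_ge v 6 b6"
proof -
  let ?A = "tc_ainv F"
  note A = tc_ainv_integral[OF F]
  have d: "w_disc ?A \<noteq> 0" using disc by (simp add: tc_disc_def)
  obtain u r s t where u: "u \<noteq> 0" and B: "w_integral v (w_trans u r s t ?A)"
     and "w_disc (w_trans u r s t ?A) \<noteq> 0" and m: "v (w_disc (w_trans u r s t ?A)) = int (min_disc_val v ?A)"
    by (rule min_disc_val_attained[OF A d])
  have "v (w_disc ?A) - 12 * v u = int (min_disc_val v ?A)"
    using m u d by (simp add: w_disc_trans v_divide v_power)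
  \<comment> \<open>\<open>tc_level\<close> rounds down, so a positive value means a difference of
    at least 12.\<close>
  moreover have "12 \<le> v (w_disc ?A) - int (min_disc_val v ?A)"
    using lev by (simp add: tc_level_def tc_disc_def)
  ultimately have vu: "1 \<le> v u" by linarith
  then have iu: "val_ge v 1 u" "integral v u" by (auto simp: val_ge_def integral_def)
  have rst: "integral v r \<and> integral v s \<and> integral v t"
    by (rule w_trans_int_params[OF A B u iu(2)])
  obtain x1 x2 x3 x4 x6 where x: "w_trans u r s t ?A = (x1,x2,x3,x4,x6)" by (cases "w_trans u r s t ?A")
  have xi: "integral v x1" "integral v x2" "integral v x3" "integral v x4" "integral v x6"
    using B by (auto simp: x w_integral_def)
  have e: "w_trans 1 r s t ?A = (u * x1, u^2 * x2, u^3 * x3, u^4 * x4, u^6 * x6)"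
    using x u by (cases ?A) (auto simp: w_trans_def)
  have pw: "val_ge v (int k) (u ^ k)" for k using ge_power[OF iu(1), of k] by simp
  show ?thesis
    by (rule that[OF _ _ _ e])
      (use rst xi pw[of 1] pw[of 2] pw[of 3] pw[of 4] pw[of 6] in \<open>simp_all add: ge_mult_int\<close>)
qed

text \<open>Coordinate changes form a group, so equivalent equations are minimised over the same
  set.\<close>

lemma min_disc_val_trans:
  assumes u: "u \<noteq> 0"
  shows "min_disc_val v (w_trans u r s t A) = min_disc_val v A"
proof -
  note inv = w_trans_inverse[OF u, of r s t A]
  have imp: "(\<exists>u r s t. u \<noteq> 0 \<and> w_integral v (w_trans u r s t A) \<and>
        w_disc (w_trans u r s t A) \<noteq> 0 \<and> v (w_disc (w_trans u r s t A)) = int n)"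
    if u: "u \<noteq> 0" and B: "\<exists>u' r' s' t'. u' \<noteq> 0 \<and> w_integral v (w_trans u' r' s' t' (w_trans u r s t A)) \<and>
        w_disc (w_trans u' r' s' t' (w_trans u r s t A)) \<noteq> 0 \<and> v (w_disc (w_trans u' r' s' t' (w_trans u r s t A))) = int n"
    for u r s t A n
  proof -
    from B obtain u' r' s' t' where u': "u' \<noteq> 0" and C: "w_integral v (w_trans u' r' s' t' (w_trans u r s t A)) \<and>
        w_disc (w_trans u' r' s' t' (w_trans u r s t A)) \<noteq> 0 \<and> v (w_disc (w_trans u' r' s' t' (w_trans u r s t A))) = int n"
      by blast
    have "u * u' \<noteq> 0" using u u' by simp
    then show ?thesis using C unfolding w_trans_compose[OF u u'] by blast
  qed
  have "1 / u \<noteq> 0" using u by simp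
  note imp' = imp[OF this, of "- r / u^2" "- s / u" "(r * s - t) / u^3" "w_trans u r s t A", unfolded inv]
  show ?thesis unfolding min_disc_val_def
    by (rule arg_cong[of _ _ Least], rule ext, rule iffI, erule imp[OF u], erule imp')
qed

text \<open>The minimal discriminant belongs to the Jacobian and does not move, while the
  discriminant of the form moves with \<open>c * det3 M\<close>. Consequently the level is kept as
  soon as that product is a unit, and a smaller discriminant forces it to have negative
  valuation.\<close>

lemma equiv_disc_level:
  assumes M: "det3 M \<noteq> 0" and F: "ternary_cubic F" and c: "c \<noteq> 0" and d: "tc_disc F \<noteq> 0"
  shows "v (tc_disc (\<lambda>n. c * tf_subst F M n)) = v (tc_disc F) + 12 * v (c * det3 M)"
    and "min_disc_val v (tc_ainv (\<lambda>n. c * tf_subst F M n)) = min_disc_val v (tc_ainv F)"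
    and "tc_disc (\<lambda>n. c * tf_subst F M n) \<noteq> 0"
proof -
  obtain u r s t where u: "u * (c * det3 M) = 1 \<or> u * (c * det3 M) = -1" "u \<noteq> 0"
    and e: "tc_ainv (\<lambda>n. c * tf_subst F M n) = w_trans u r s t (tc_ainv F)"
    by (rule tc_ainv_equiv[OF infinite_field M F c])
  have "v (u * (c * det3 M)) = 0" using u(1) v_one v_minus_one by auto
  then have "v u + v (c * det3 M) = 0" using v_mult[OF u(2), of "c * det3 M"] M c by simp
  moreover have d': "w_disc (tc_ainv F) \<noteq> 0" using d by (simp add: tc_disc_def)
  ultimately show "v (tc_disc (\<lambda>n. c * tf_subst F M n)) = v (tc_disc F) + 12 * v (c * det3 M)"
    using u(2) by (simp add: tc_disc_def e w_disc_trans v_divide v_power)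
  show "tc_disc (\<lambda>n. c * tf_subst F M n) \<noteq> 0"
    using u(2) d' by (simp add: tc_disc_def e w_disc_trans)
  show "min_disc_val v (tc_ainv (\<lambda>n. c * tf_subst F M n)) = min_disc_val v (tc_ainv F)"
    unfolding e by (rule min_disc_val_trans[OF u(2)])
qed

end

section \<open>Reduction\<close>

text \<open>The Jacobian is a translate of the cuspidal cubic \<open>y\<^sup>2 = x\<^sup>3\<close>.\<close>
definition cuspidal :: "'c::field tform \<Rightarrow> bool" where
  "cuspidal G \<longleftrightarrow> (\<exists>r s t. w_trans 1 r s t (tc_ainv G) = (0,0,0,0,0))"

definition map5 :: "('x \<Rightarrow> 'y) \<Rightarrow> 'x \<times> 'x \<times> 'x \<times> 'x \<times> 'x \<Rightarrow> 'y \<times> 'y \<times> 'y \<times> 'y \<times> 'y" where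
  "map5 f = (\<lambda>(a,b,c,d,e). (f a, f b, f c, f d, f e))"

text \<open>The target will be the closure of the residue field, so \<open>\<rho>\<close> is a
  homomorphism on integral elements without being assumed surjective.\<close>

locale reduction = dval v for v :: "'a::field \<Rightarrow> int" +
  fixes \<rho> :: "'a \<Rightarrow> 'c::field"
  assumes rho_add: "integral v x \<Longrightarrow> integral v y \<Longrightarrow> \<rho> (x + y) = \<rho> x + \<rho> y"
    and rho_mult: "integral v x \<Longrightarrow> integral v y \<Longrightarrow> \<rho> (x * y) = \<rho> x * \<rho> y"
    and rho_one [simp]: "\<rho> 1 = 1"
    and rho_eq_0: "integral v x \<Longrightarrow> \<rho> x = 0 \<longleftrightarrow> val_ge v 1 x"
begin

lemma rho_zero [simp]: "\<rho> 0 = 0"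
  by (simp add: rho_eq_0)

lemma rho_uminus: "integral v x \<Longrightarrow> \<rho> (- x) = - \<rho> x"
  using rho_add[of x "- x"] by (simp add: int_uminus eq_neg_iff_add_eq_0 add.commute)

lemma rho_diff: "integral v x \<Longrightarrow> integral v y \<Longrightarrow> \<rho> (x - y) = \<rho> x - \<rho> y"
  using rho_add[of x "- y"] by (simp add: int_uminus rho_uminus)

lemma rho_power: "integral v x \<Longrightarrow> \<rho> (x ^ n) = \<rho> x ^ n"
  by (induction n) (simp_all add: rho_mult int_power)

lemma rho_of_nat: "\<rho> (of_nat n) = of_nat n"
  by (induction n) (simp_all add: rho_add int_of_nat)

lemma rho_numeral: "\<rho> (numeral n) = numeral n"
  using rho_of_nat[of "numeral n"] by simp

lemmas rho_simps = rho_add rho_diff rho_uminus rho_mult rho_power rho_numeral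

lemma rho_sum: "(\<And>i. i \<in> A \<Longrightarrow> integral v (f i)) \<Longrightarrow> \<rho> (sum f A) = (\<Sum>i\<in>A. \<rho> (f i))"
  by (induction A rule: infinite_finite_induct) (simp_all add: rho_add int_sum)

text \<open>Reduction is a homomorphism only on integral elements; tracking integrality and the reduction
  together computes the reduction of a large polynomial by one pass of introduction rules.\<close>
definition lifts :: "'c \<Rightarrow> 'a \<Rightarrow> bool" where
  "lifts c x \<longleftrightarrow> integral v x \<and> \<rho> x = c"

lemma lifts_intros:
  "lifts a x \<Longrightarrow> lifts b y \<Longrightarrow> lifts (a + b) (x + y)"
  "lifts a x \<Longrightarrow> lifts b y \<Longrightarrow> lifts (a - b) (x - y)"
  "lifts a x \<Longrightarrow> lifts b y \<Longrightarrow> lifts (a * b) (x * y)"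
  "lifts a x \<Longrightarrow> lifts (- a) (- x)"
  "lifts a x \<Longrightarrow> lifts (a ^ n) (x ^ n)"
  "lifts (numeral k) (numeral k)"
  by (simp_all add: lifts_def rho_simps int_simps)

lemma lifts_rho: "integral v x \<Longrightarrow> lifts (\<rho> x) x"
  by (simp add: lifts_def)

lemma lifts_eq: "lifts c x \<Longrightarrow> \<rho> x = c"
  by (simp add: lifts_def)

definition red_form :: "'a tform \<Rightarrow> 'c tform" where "red_form F = (\<lambda>n. \<rho> (F n))"
definition red_mat :: "(nat \<Rightarrow> nat \<Rightarrow> 'a) \<Rightarrow> nat \<Rightarrow> nat \<Rightarrow> 'c" where "red_mat M = (\<lambda>i j. \<rho> (M i j))"

lemma form_integral_iff: "form_integral v F \<longleftrightarrow> (\<forall>n. integral v (F n))"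
  by (simp add: form_integral_def form_val_ge_def integral_def)

lemma form_integralD: "form_integral v F \<Longrightarrow> integral v (F n)"
  unfolding form_integral_iff by blast

lemma form_integral_mult:
  assumes f: "form_integral v f" and g: "form_integral v g"
  shows "form_integral v (tf_mult f g)" "red_form (tf_mult f g) = tf_mult (red_form f) (red_form g)"
proof -
  have fg: "integral v (f m * g n)" for m n by (intro int_mult form_integralD f g)
  show "form_integral v (tf_mult f g)" unfolding form_integral_iff tf_mult_def
    by (auto intro!: int_sum fg)
  have "red_form (tf_mult f g) (n1,n2,n3) = tf_mult (red_form f) (red_form g) (n1,n2,n3)" for n1 n2 n3
  proof -
    have "red_form (tf_mult f g) (n1,n2,n3) = (\<Sum>i\<le>n1. \<Sum>j\<le>n2. \<Sum>k\<le>n3. \<rho> (f (i,j,k) * g (n1 - i, n2 - j, n3 - k)))"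
      unfolding red_form_def tf_mult_def prod.case
      by (subst rho_sum, intro int_sum fg, rule sum.cong[OF refl], subst rho_sum, intro int_sum fg,
          rule sum.cong[OF refl], rule rho_sum, rule fg)
    then show ?thesis by (simp add: tf_mult_def red_form_def rho_mult form_integralD f g)
  qed
  then show "red_form (tf_mult f g) = tf_mult (red_form f) (red_form g)"
    by (intro ext) (metis prod_cases3)
qed

lemma form_integral_pow_lin:
  assumes "integral v a" "integral v b" "integral v c"
  shows "form_integral v (tf_pow (tf_lin a b c) n)
    \<and> red_form (tf_pow (tf_lin a b c) n) = tf_pow (tf_lin (\<rho> a) (\<rho> b) (\<rho> c)) n"
proof (induction n)
  case 0
  show ?case by (auto simp: form_integral_iff tf_one_def red_form_def fun_eq_iff)
next
  case (Suc n)
  have l: "form_integral v (tf_lin a b c)" "red_form (tf_lin a b c) = tf_lin (\<rho> a) (\<rho> b) (\<rho> c)"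
    using assms by (auto simp: form_integral_iff tf_lin_def red_form_def fun_eq_iff)
  show ?case using form_integral_mult[OF l(1) conjunct1[OF Suc]] Suc by (simp add: l(2))
qed

lemma tf_subst_integral:
  assumes F: "form_integral v F" and M: "\<And>i j. i < 3 \<Longrightarrow> j < 3 \<Longrightarrow> integral v (M i j)"
  shows "form_integral v (tf_subst F M)" "red_form (tf_subst F M) = tf_subst (red_form F) (red_mat M)"
proof -
  define l where "l j = tf_lin (M 0 j) (M 1 j) (M 2 j)" for j
  define l' where "l' j = tf_lin (\<rho> (M 0 j)) (\<rho> (M 1 j)) (\<rho> (M 2 j))" for j
  define T where "T i j k = tf_mult (tf_pow (l 0) i) (tf_mult (tf_pow (l 1) j) (tf_pow (l 2) k))" for i j k
  have p: "form_integral v (tf_pow (l j) n)" "red_form (tf_pow (l j) n) = tf_pow (l' j) n" if "j < 3" for j n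
    using form_integral_pow_lin[OF M M M, of 0 j 1 j 2 j n] that unfolding l_def l'_def by simp_all
  have T: "form_integral v (T i j k)" for i j k
    unfolding T_def by (intro form_integral_mult(1) p) simp_all
  have rT: "red_form (T i j k) = tf_mult (tf_pow (l' 0) i) (tf_mult (tf_pow (l' 1) j) (tf_pow (l' 2) k))" for i j k
    unfolding T_def by (simp add: form_integral_mult p)
  have eq: "tf_subst F M = (\<lambda>n. \<Sum>i\<le>3. \<Sum>j\<le>3. \<Sum>k\<le>3. F (i,j,k) * T i j k n)"
    unfolding tf_subst_def Let_def T_def l_def ..
  have FT: "integral v (F m * T i j k n)" for m i j k n by (intro int_mult form_integralD F T)
  show "form_integral v (tf_subst F M)" unfolding form_integral_iff eq
    by (auto intro!: int_sum FT)
  show "red_form (tf_subst F M) = tf_subst (red_form F) (red_mat M)"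
  proof
    fix n
    have "red_form (tf_subst F M) n = (\<Sum>i\<le>3. \<Sum>j\<le>3. \<Sum>k\<le>3. \<rho> (F (i,j,k) * T i j k n))"
      unfolding eq red_form_def[of "\<lambda>n. \<Sum>i\<le>3. \<Sum>j\<le>3. \<Sum>k\<le>3. F (i,j,k) * T i j k n"]
      by (subst rho_sum, intro int_sum FT, rule sum.cong[OF refl], subst rho_sum, intro int_sum FT,
          rule sum.cong[OF refl], rule rho_sum, rule FT)
    also have "\<dots> = (\<Sum>i\<le>3. \<Sum>j\<le>3. \<Sum>k\<le>3. red_form F (i,j,k) * red_form (T i j k) n)"
      by (simp add: red_form_def rho_mult form_integralD F T)
    also have "\<dots> = tf_subst (red_form F) (red_mat M) n"
      unfolding rT by (simp add: tf_subst_def Let_def red_mat_def l'_def)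
    finally show "red_form (tf_subst F M) n = tf_subst (red_form F) (red_mat M) n" .
  qed
qed

lemma ternary_cubic_red: "ternary_cubic F \<Longrightarrow> ternary_cubic (red_form F)"
  by (simp add: ternary_cubic_def red_form_def)

lemma red_form_eq_0: "form_integral v F \<Longrightarrow> red_form F = (\<lambda>_. 0) \<longleftrightarrow> form_val_ge v 1 F"
  unfolding form_val_ge_def red_form_def fun_eq_iff using rho_eq_0[OF form_integralD, of F] by blast

lemma tc_ainv_red:
  assumes F: "form_integral v F"
  shows "tc_ainv (red_form F) = map5 \<rho> (tc_ainv F)"
proof -
  have l: "lifts (\<rho> (F n)) (F n)" for n by (rule lifts_rho[OF form_integralD[OF F]])
  show ?thesis
    unfolding tc_ainv_def Let_def map5_def prod.case red_form_def prod.inject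
    by (intro conjI lifts_eq[symmetric] lifts_intros l)
qed

lemma w_trans_red:
  assumes A: "w_integral v A" and i: "integral v r" "integral v s" "integral v t"
  shows "w_trans 1 (\<rho> r) (\<rho> s) (\<rho> t) (map5 \<rho> A) = map5 \<rho> (w_trans 1 r s t A)"
proof -
  obtain a1 a2 a3 a4 a6 where A': "A = (a1,a2,a3,a4,a6)" by (cases A)
  have a: "integral v a1" "integral v a2" "integral v a3" "integral v a4" "integral v a6"
    using A by (auto simp: A' w_integral_def)
  note l = a[THEN lifts_rho] i[THEN lifts_rho]
  show ?thesis unfolding A' w_trans_def map5_def prod.case prod.inject div_by_1 power_one
    by (intro conjI lifts_eq[symmetric] lifts_intros l)
qed

lemma cuspidal_red:
  assumes F: "form_integral v F" and disc: "tc_disc F \<noteq> 0" and lev: "0 < tc_level v F"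
  shows "cuspidal (red_form F)"
proof -
  obtain r s t b1 b2 b3 b4 b6 where i: "integral v r" "integral v s" "integral v t"
    and e: "w_trans 1 r s t (tc_ainv F) = (b1,b2,b3,b4,b6)"
    and b: "val_ge v 1 b1" "val_ge v 2 b2" "val_ge v 3 b3" "val_ge v 4 b4" "val_ge v 6 b6"
    by (rule positive_level[OF F disc lev])
  have z: "\<rho> x = 0" if "val_ge v n x" "1 \<le> n" for n x
    using that rho_eq_0[of x] ge_mono[of n x] by (simp add: integral_def)
  have "w_trans 1 (\<rho> r) (\<rho> s) (\<rho> t) (tc_ainv (red_form F)) = (0,0,0,0,0)"
    unfolding tc_ainv_red[OF F] w_trans_red[OF tc_ainv_integral[OF F] i] e
    using z[OF b(1)] z[OF b(2)] z[OF b(3)] z[OF b(4)] z[OF b(5)] by (simp add: map5_def)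
  then show ?thesis unfolding cuspidal_def by blast
qed

lemma red_det3:
  assumes "\<And>i j. i < 3 \<Longrightarrow> j < 3 \<Longrightarrow> integral v (M i j)"
  shows "det3 (red_mat M) = \<rho> (det3 M)" "integral v (det3 M)"
proof -
  have i: "integral v (M 0 0)" "integral v (M 0 1)" "integral v (M 0 2)" "integral v (M 1 0)" "integral v (M 1 1)"
    "integral v (M 1 2)" "integral v (M 2 0)" "integral v (M 2 1)" "integral v (M 2 2)"
    by (simp_all add: assms)
  show "integral v (det3 M)" unfolding det3_def by (intro int_intros i)
  note l = i[THEN lifts_rho]
  show "det3 (red_mat M) = \<rho> (det3 M)" unfolding det3_def red_mat_def
    by (intro lifts_eq[symmetric] lifts_intros l)
qed

lemma GL3_O_iff: "GL3_O v M \<longleftrightarrow> (\<forall>i<3. \<forall>j<3. integral v (M i j)) \<and> det3 (red_mat M) \<noteq> 0"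
proof -
  have "det3 (red_mat M) \<noteq> 0 \<longleftrightarrow> det3 M \<noteq> 0 \<and> v (det3 M) = 0" if "\<forall>i<3. \<forall>j<3. integral v (M i j)"
    using that red_det3[of M] rho_eq_0 unit_iff by auto
  then show ?thesis unfolding GL3_O_def by blast
qed

lemma GL3_O_D: "GL3_O v M \<Longrightarrow> i < 3 \<Longrightarrow> j < 3 \<Longrightarrow> integral v (M i j)"
  by (simp add: GL3_O_def)

lemma GL3_O_mm: "GL3_O v A \<Longrightarrow> GL3_O v B \<Longrightarrow> GL3_O v (mm A B)"
proof -
  assume A: "GL3_O v A" and B: "GL3_O v B"
  have "integral v (mm A B i j)" if "i < 3" "j < 3" for i j
    unfolding mm_def by (intro int_add int_mult GL3_O_D[OF A] GL3_O_D[OF B] that) simp_all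
  moreover have "det3 (mm A B) \<noteq> 0" "v (det3 (mm A B)) = 0"
    using A B by (simp_all add: GL3_O_def det3_mm v_mult)
  ultimately show ?thesis by (simp add: GL3_O_def)
qed

lemma GL3_O_inv3:
  assumes M: "GL3_O v M"
  shows "GL3_O v (inv3 M)"
proof -
  have d: "det3 M \<noteq> 0" "v (det3 M) = 0" using M by (simp_all add: GL3_O_def)
  then have i: "integral v (1 / det3 M)" by (simp add: integral_def val_ge_def v_inverse)
  have "integral v (inv3 M i j)" for i j
  proof -
    have "integral v (adj3 M i j)"
      unfolding adj3_def mat9_def by (auto intro!: int_diff int_mult GL3_O_D[OF M])
    from int_mult[OF this i] show ?thesis by (simp add: inv3_def)
  qed
  then show ?thesis using d by (simp add: GL3_O_def det3_inv3 v_inverse)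
qed

lemma GL3_O_elem_gen: "elem_gen (integral v) A \<Longrightarrow> GL3_O v A"
proof (induction rule: elem_gen.induct)
  case (mult A B) then show ?case by (intro GL3_O_mm)
qed (auto simp: GL3_O_def mat9_def det3_def v_one v_minus_one)

lemma smith_valuation:
  assumes "det3 M \<noteq> 0"
  obtains V x y z U where "GL3_O v V" "GL3_O v U" "x \<noteq> 0" "y \<noteq> 0" "z \<noteq> 0"
    "mat9 (M 0 0) (M 0 1) (M 0 2) (M 1 0) (M 1 1) (M 1 2) (M 2 0) (M 2 1) (M 2 2)
       = mm V (mm (mat9 x 0 0 0 y 0 0 0 z) U)"
proof -
  interpret gauss_elim "integral v"
    by standard (use int_totality in \<open>auto simp: int_simps\<close>)
  show ?thesis using smith_mat[OF assms] GL3_O_elem_gen that by metis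
qed

end

section \<open>Singular cubics with cuspidal Jacobian\<close>

lemma cuspidalI:
  assumes "u \<noteq> 0" "w_trans u r s t (tc_ainv G) = (0,0,0,0,0)"
  shows "cuspidal G"
proof -
  have "w_trans 1 r s t (tc_ainv G) = (0,0,0,0,0)"
    using assms by (cases "tc_ainv G") (simp add: w_trans_def)
  then show ?thesis unfolding cuspidal_def by blast
qed

definition point_or_line :: "('c::field \<times> 'c \<times> 'c) set \<Rightarrow> bool" where
  "point_or_line S \<longleftrightarrow> (\<exists>P. P \<noteq> (0,0,0) \<and> S = proj_point P) \<or> (\<exists>L. L \<noteq> (0,0,0) \<and> S = proj_line L)"

text \<open>The action on line coordinates dual to \<open>vm\<close>: pulling the linear form
  \<open>L\<close> back along \<open>M\<close>.\<close>

definition mv :: "(nat \<Rightarrow> nat \<Rightarrow> 'a::comm_semiring_1) \<Rightarrow> 'a \<times> 'a \<times> 'a \<Rightarrow> 'a \<times> 'a \<times> 'a" where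
  "mv M L = (case L of (a,b,c) \<Rightarrow>
     (M 0 0 * a + M 0 1 * b + M 0 2 * c, M 1 0 * a + M 1 1 * b + M 1 2 * c, M 2 0 * a + M 2 1 * b + M 2 2 * c))"

lemma vm_smult: "vm (l * x, l * y, l * z) M = (case vm (x,y,z) M of (a,b,c) \<Rightarrow> (l * a, l * b, l * c))"
  by (simp add: vm_def algebra_simps)

lemma vm_proj_point:
  fixes M :: "nat \<Rightarrow> nat \<Rightarrow> 'a::field"
  assumes M: "det3 M \<noteq> 0"
  shows "vm X M \<in> proj_point (vm P M) \<longleftrightarrow> X \<in> proj_point P"
proof
  assume "vm X M \<in> proj_point (vm P M)"
  then obtain l where l: "l \<noteq> 0" "vm X M = (case vm P M of (x,y,z) \<Rightarrow> (l * x, l * y, l * z))"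
    by (auto simp: proj_point_def split: prod.splits)
  obtain x y z where P: "P = (x,y,z)" by (cases P)
  have "vm X M = vm (l * x, l * y, l * z) M" unfolding l(2) P vm_smult ..
  then have "X = (l * x, l * y, l * z)" using vm_inv3(1)[OF M] by metis
  then show "X \<in> proj_point P" using l(1) by (auto simp: proj_point_def P)
next
  assume "X \<in> proj_point P"
  then show "vm X M \<in> proj_point (vm P M)"
    by (auto simp: proj_point_def vm_smult split: prod.splits)
qed

definition dot3 :: "'a::comm_semiring_1 \<times> 'a \<times> 'a \<Rightarrow> 'a \<times> 'a \<times> 'a \<Rightarrow> 'a" where
  "dot3 L X = (case L of (a,b,c) \<Rightarrow> case X of (x,y,z) \<Rightarrow> a * x + b * y + c * z)"

lemma mem_proj_line: "X \<in> proj_line L \<longleftrightarrow> X \<noteq> (0,0,0) \<and> dot3 L X = 0"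
  by (cases X; cases L) (simp add: proj_line_def dot3_def)

lemma dot3_vm: "dot3 L (vm X M) = dot3 (mv M L) X"
  by (cases X; cases L) (simp add: dot3_def vm_def mv_def algebra_simps)

lemma vm_proj_line:
  fixes M :: "nat \<Rightarrow> nat \<Rightarrow> 'a::field"
  assumes M: "det3 M \<noteq> 0"
  shows "vm X M \<in> proj_line L \<longleftrightarrow> X \<in> proj_line (mv M L)"
  unfolding mem_proj_line dot3_vm vm_eq_zero_iff[OF M] ..

lemma mv_mm: "mv A (mv B L) = mv (mm A B) L"
  by (cases L) (simp add: mv_def mm_def algebra_simps)

lemma mv_eq_0:
  fixes M :: "nat \<Rightarrow> nat \<Rightarrow> 'a::field"
  assumes M: "det3 M \<noteq> 0" and z: "mv M L = (0,0,0)"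
  shows "L = (0,0,0)"
proof -
  have "mv (inv3 M) (mv M L) = L"
    unfolding mv_mm using mm_inv3(2)[OF M] by (cases L) (simp add: mv_def)
  moreover have "mv (inv3 M) (0,0,0) = (0,0,0)" by (simp add: mv_def)
  ultimately show ?thesis using z by simp
qed

locale alg_closed =
  fixes dummy :: "'c::field itself"
  assumes ac: "\<And>p :: 'c poly. 0 < degree p \<Longrightarrow> \<exists>z. poly p z = 0"
begin

text \<open>Over a finite field, adding 1 to the product of all \<open>X - a\<close> gives a
  nonconstant polynomial without a root.\<close>

lemma infinite_closed: "infinite (UNIV :: 'c set)"
proof
  assume fin: "finite (UNIV :: 'c set)"
  let ?p = "(\<Prod>a\<in>(UNIV :: 'c set). [:- a, 1:]) + 1"
  have "poly ?p z = 1" for z using fin by (simp add: poly_prod prod_zero)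
  then have np: "\<And>z. poly ?p z \<noteq> 0" by simp
  have "degree (\<Prod>a\<in>(UNIV :: 'c set). [:- a, 1:]) = card (UNIV :: 'c set)"
    by (subst degree_prod_eq_sum_degree) auto
  moreover have "0 < card (UNIV :: 'c set)" using fin by (simp add: card_gt_0_iff)
  ultimately have "0 < degree ?p" by (subst degree_add_eq_left) simp_all
  from ac[OF this] np show False by blast
qed

lemma quadratic_root: "a \<noteq> 0 \<Longrightarrow> \<exists>z::'c. a * z^2 + b * z + c = 0"
  using ac[of "[:c, b, a:]"] by (auto simp: algebra_simps power2_eq_square)

lemma sqrt_exists: "\<exists>z::'c. z^2 = c"
  using quadratic_root[of 1 0 "- c"] by auto

lemma cubic_root: "a \<noteq> 0 \<Longrightarrow> \<exists>z::'c. a * z^3 + b * z^2 + c * z + d = 0"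
  using ac[of "[:d, c, b, a:]"] by (auto simp: algebra_simps power2_eq_square power3_eq_cube)

text \<open>Undoing the coordinate change of the substituted Jacobian and then translating to the
  cusp is again one coordinate change; its scaling is discarded by \<open>cuspidalI\<close>.\<close>

lemma cuspidal_subst:
  fixes G :: "'c tform"
  assumes G: "ternary_cubic G" and c: "cuspidal G" and M: "det3 M \<noteq> 0"
  shows "cuspidal (tf_subst G M)"
proof -
  obtain r0 s0 t0 where z: "w_trans 1 r0 s0 t0 (tc_ainv G) = (0,0,0,0,0)" using c unfolding cuspidal_def by blast
  obtain u r s t where u: "u \<noteq> 0" and e: "tc_ainv (\<lambda>n. 1 * tf_subst G M n) = w_trans u r s t (tc_ainv G)"
    by (rule tc_ainv_equiv[OF infinite_closed M G one_neq_zero])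
  have u': "1 / u \<noteq> 0" using u by simp
  have "w_trans 1 r0 s0 t0 (w_trans (1/u) (- r / u^2) (- s / u) ((r * s - t) / u^3) (tc_ainv (tf_subst G M))) = (0,0,0,0,0)"
    using z unfolding e[unfolded mult_1_left] w_trans_inverse[OF u] .
  then show ?thesis unfolding w_trans_compose[OF u' one_neq_zero] by (rule cuspidalI[rotated]) (use u in simp)
qed

lemma point_or_line_subst:
  fixes G :: "'c tform"
  assumes G: "ternary_cubic G" and M: "det3 M \<noteq> 0" and pl: "point_or_line (singset (tf_subst G M))"
  shows "point_or_line (singset G)"
proof -
  have M': "det3 (inv3 M) \<noteq> 0" using M by (simp add: det3_inv3)
  have mem: "Y \<in> singset G \<longleftrightarrow> vm Y (inv3 M) \<in> singset (tf_subst G M)" for Y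
    by (simp add: singset_subst[OF infinite_closed G M] vm_inv3[OF M])
  from pl show ?thesis unfolding point_or_line_def
  proof (elim disjE exE conjE)
    fix P assume P: "P \<noteq> (0,0,0)" "singset (tf_subst G M) = proj_point P"
    have "singset G = proj_point (vm P M)"
      using mem vm_proj_point[OF M', of _ "vm P M"] by (auto simp: P vm_inv3[OF M])
    then show "(\<exists>P. P \<noteq> (0,0,0) \<and> singset G = proj_point P) \<or> (\<exists>L. L \<noteq> (0,0,0) \<and> singset G = proj_line L)"
      using vm_eq_zero_iff[OF M] P by blast
  next
    fix L assume L: "L \<noteq> (0,0,0)" "singset (tf_subst G M) = proj_line L"
    have "singset G = proj_line (mv (inv3 M) L)"
      using mem vm_proj_line[OF M'] by (auto simp: L)
    then show "(\<exists>P. P \<noteq> (0,0,0) \<and> singset G = proj_point P) \<or> (\<exists>L. L \<noteq> (0,0,0) \<and> singset G = proj_line L)"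
      using mv_eq_0[OF M'] L by blast
  qed
qed

end

text \<open>The surviving monomials make \<open>G\<close> equal to \<open>z^2\<close> times a
  nonzero linear form, and the double line is its whole singular locus.\<close>

lemma singset_line:
  fixes G :: "'c::field tform"
  assumes G: "ternary_cubic G" and nz: "G \<noteq> (\<lambda>_. 0)"
    and z: "G (3,0,0) = 0" "G (0,3,0) = 0" "G (2,1,0) = 0" "G (1,2,0) = 0" "G (2,0,1) = 0" "G (0,2,1) = 0" "G (1,1,1) = 0"
  shows "singset G = proj_line (0,0,1)"
proof -
  have nz': "\<not> (G (1,0,2) = 0 \<and> G (0,1,2) = 0 \<and> G (0,0,3) = 0)"
    using nz z ternary_cubic_ext[OF G, of "\<lambda>_. 0"] by (auto simp: ternary_cubic_def)
  have "(x,y,w) \<in> singset G \<longleftrightarrow> (x,y,w) \<in> proj_line (0,0,1)" for x y w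
  proof (cases "w = 0")
    case True
    then show ?thesis
      unfolding mem_singset[OF G] z by (auto simp: proj_line_def)
  next
    case False
    have "(x,y,w) \<notin> singset G"
    proof
      assume "(x,y,w) \<in> singset G"
      then have e: "G (0,0,3) * w^3 + G (1,0,2) * x * w^2 + G (0,1,2) * y * w^2 = 0" "G (1,0,2) * w^2 = 0" "G (0,1,2) * w^2 = 0"
        unfolding mem_singset[OF G] z by simp_all
      then have "G (1,0,2) = 0" "G (0,1,2) = 0" using False by simp_all
      then show False using e(1) nz' False by simp
    qed
    then show ?thesis using False by (simp add: proj_line_def)
  qed
  then show ?thesis by auto
qed

text \<open>Here \<open>G\<close> is a multiple of \<open>x y^2\<close> plus a binary cubic in
  \<open>y, z\<close>. The derivative in \<open>x\<close> forces \<open>y = 0\<close>, and then the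
  coefficients of \<open>z^3\<close> and \<open>y z^2\<close> decide: the locus is the line
  \<open>y = 0\<close> if both vanish and the point \<open>(1:0:0)\<close> otherwise.\<close>

lemma singset_point_square:
  fixes G :: "'c::field tform"
  assumes G: "ternary_cubic G" and nz: "G (1,2,0) \<noteq> 0"
    and z: "G (3,0,0) = 0" "G (2,1,0) = 0" "G (2,0,1) = 0" "G (1,1,1) = 0" "G (1,0,2) = 0"
  shows "point_or_line (singset G)"
proof -
  have Y: "y = 0" if "(x,y,w) \<in> singset G" for x y w
    using that nz unfolding mem_singset[OF G] z by simp
  show ?thesis
  proof (cases "G (0,0,3) = 0 \<and> G (0,1,2) = 0")
    case True
    have "(x,y,w) \<in> singset G \<longleftrightarrow> (x,y,w) \<in> proj_line (0,1,0)" for x y w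
    proof (cases "y = 0")
      case y: True
      show ?thesis
        unfolding mem_singset[OF G] proj_line_def mem_Collect_eq z y prod.case
        using True by simp
    next
      case False
      then show ?thesis using Y[of x y w] by (auto simp: proj_line_def)
    qed
    then have "singset G = proj_line (0,1,0)" by auto
    then show ?thesis unfolding point_or_line_def by (intro disjI2 exI[of _ "(0,1,0)"]) simp
  next
    case False
    have W: "w = 0" if s: "(x,y,w) \<in> singset G" for x y w
    proof -
      have "G (0,0,3) * w^3 = 0" "G (0,1,2) * w^2 = 0"
        using s unfolding Y[OF s] mem_singset[OF G] z by simp_all
      then show "w = 0" using False by auto
    qed
    have "(x,y,w) \<in> singset G \<longleftrightarrow> (x,y,w) \<in> proj_point (1,0,0)" for x y w
    proof (cases "y = 0 \<and> w = 0")
      case True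
      then show ?thesis
        unfolding mem_singset[OF G] proj_point_def mem_Collect_eq z prod.case
        by simp
    next
      case False
      then show ?thesis using Y[of x y w] W[of x y w] by (auto simp: proj_point_def)
    qed
    then have "singset G = proj_point (1,0,0)" by auto
    then show ?thesis unfolding point_or_line_def by (intro disjI1 exI[of _ "(1,0,0)"]) simp
  qed
qed

lemma singset_100:
  fixes G :: "'c::field tform"
  assumes G: "ternary_cubic G"
  shows "(1,0,0) \<in> singset G \<longleftrightarrow> G (3,0,0) = 0 \<and> G (2,1,0) = 0 \<and> G (2,0,1) = 0"
  unfolding mem_singset[OF G] by auto

text \<open>When \<open>(1:0:0)\<close> is singular, \<open>a3, a4, a6\<close> vanish and
  \<open>b2 = a1^2 + 4 a2\<close> is the discriminant of the quadratic form in \<open>y, z\<close>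
  giving the tangent cone. A cusp instead of a node on the Jacobian makes \<open>b2\<close>
  vanish.\<close>

lemma cuspidal_at_100:
  fixes G :: "'c::field tform"
  assumes c: "cuspidal G" and z: "G (3,0,0) = 0" "G (2,1,0) = 0" "G (2,0,1) = 0"
  shows "G (1,1,1) ^ 2 = 4 * G (1,2,0) * G (1,0,2)"
proof -
  obtain r s t where "w_trans 1 r s t (tc_ainv G) = (0,0,0,0,0)" using c unfolding cuspidal_def by blast
  moreover have "tc_ainv G = (G (1,1,1), - (G (1,2,0) * G (1,0,2)), 0, 0, 0)"
    unfolding tc_ainv_def Let_def z by simp
  ultimately have e: "G (1,1,1) + 2 * s = 0" "- (G (1,2,0) * G (1,0,2)) - s * G (1,1,1) + 3 * r - s^2 = 0"
    "r * G (1,1,1) + 2 * t = 0"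
    "- (2 * r) * (G (1,2,0) * G (1,0,2)) - (t + r * s) * G (1,1,1) + 3 * r^2 - 2 * s * t = 0"
    "- (r^2) * (G (1,2,0) * G (1,0,2)) + r^3 - t^2 - r * t * G (1,1,1) = 0"
    by (simp_all add: w_trans_def)
  define D where "D = G (1,1,1) ^ 2 - 4 * G (1,2,0) * G (1,0,2)"
  have 1: "D = - 12 * r" using e(1,2) unfolding D_def by algebra
  \<comment> \<open>The transformed \<open>b4\<close> and \<open>b6\<close> yield
    \<open>6 r^2 = 0\<close> and \<open>8 r^3 = 0\<close>; their combination avoids any division by
    2 or 3.\<close>
  have 2: "2 * r^3 = 0" 
  proof -
    have "r * D + 6 * r^2 = 0" using e(1,2,3,4) unfolding D_def by algebra
    with 1 have a: "6 * r^2 = 0" by algebra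
    have "r^2 * D + 4 * r^3 = 0" using e(1,2,3,5) unfolding D_def by algebra
    with 1 have b: "8 * r^3 = 0" by algebra
    have "2 * r^3 = 8 * r^3 - r * (6 * r^2)" by algebra
    then show ?thesis by (simp only: a b) simp
  qed
  then have "2 * r = 0" by auto
  then have "D = 0" using 1 by algebra
  then show ?thesis by (simp add: D_def)
qed

context alg_closed begin

text \<open>The tangent cone is a double line; the shear along its root \<open>l\<close> turns it
  into \<open>y^2\<close>, which is the situation of \<open>singset_point_square\<close>.\<close>

lemma point_or_line_100_square:
  fixes G :: "'c tform"
  assumes G: "ternary_cubic G" and c: "cuspidal G" and z: "G (3,0,0) = 0" "G (2,1,0) = 0" "G (2,0,1) = 0"
    and nz: "G (1,2,0) \<noteq> 0"
  shows "point_or_line (singset G)"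
proof -
  obtain l where l: "G (1,2,0) * l^2 + G (1,1,1) * l + G (1,0,2) = 0" using quadratic_root[OF nz] by blast
  have "(2 * G (1,2,0) * l + G (1,1,1))^2 = 0" using l cuspidal_at_100[OF c z] by algebra
  then have l2: "2 * G (1,2,0) * l + G (1,1,1) = 0" by simp
  let ?M = "mat9 1 0 0 0 1 0 0 l 1"
  have "point_or_line (singset (tf_subst G ?M))"
  proof (rule singset_point_square[OF ternary_cubic_subst[OF G]])
    show "tf_subst G ?M (1,2,0) \<noteq> 0"
      unfolding tf_subst_eq_form[OF infinite_closed G] mat9_entries' cubic_form_coeffs using nz z by simp
    show "tf_subst G ?M (3,0,0) = 0" "tf_subst G ?M (2,1,0) = 0" "tf_subst G ?M (2,0,1) = 0"
      unfolding tf_subst_eq_form[OF infinite_closed G] mat9_entries' cubic_form_coeffs using z by simp_all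
    show "tf_subst G ?M (1,1,1) = 0"
      unfolding tf_subst_eq_form[OF infinite_closed G] mat9_entries' cubic_form_coeffs z using l2 by (simp add: algebra_simps)
    show "tf_subst G ?M (1,0,2) = 0"
      unfolding tf_subst_eq_form[OF infinite_closed G] mat9_entries' cubic_form_coeffs z using l by (simp add: algebra_simps)
  qed
  then show ?thesis by (rule point_or_line_subst[OF G, rotated]) (simp add: det3_def)
qed

lemma point_or_line_100:
  fixes G :: "'c tform"
  assumes G: "ternary_cubic G" and c: "cuspidal G" and nz: "G \<noteq> (\<lambda>_. 0)"
    and s: "(1,0,0) \<in> singset G"
  shows "point_or_line (singset G)"
proof -
  have z: "G (3,0,0) = 0" "G (2,1,0) = 0" "G (2,0,1) = 0" using s singset_100[OF G] by simp_all
  let ?S = "mat9 1 0 0 0 0 1 0 1 0 :: nat \<Rightarrow> nat \<Rightarrow> 'c"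
  have dS: "det3 ?S \<noteq> 0" by (simp add: det3_def)
  consider "G (1,2,0) \<noteq> 0" | "G (1,0,2) \<noteq> 0" | "G (1,2,0) = 0" "G (1,0,2) = 0" "G (1,1,1) = 0"
    using cuspidal_at_100[OF c z] by fastforce
  then show ?thesis
  proof cases
    case 1
    then show ?thesis using point_or_line_100_square[OF G c z] by blast
  next
    case 2
    have "point_or_line (singset (tf_subst G ?S))"
      by (rule point_or_line_100_square[OF ternary_cubic_subst[OF G] cuspidal_subst[OF G c dS]])
        (use 2 z in \<open>simp_all only: tf_subst_swap12[OF infinite_closed G] cubic_form_coeffs, simp_all\<close>)
    then show ?thesis by (rule point_or_line_subst[OF G dS])
  next
    \<comment> \<open>Without a tangent cone \<open>G\<close> is a binary cubic in
      \<open>y, z\<close>. A further singular point is then a multiple root of it; moving that point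
      to \<open>(0:1:0)\<close> exhibits a double line.\<close>
    case 3
    show ?thesis
    proof (cases "\<exists>x y w. (x,y,w) \<in> singset G \<and> (y,w) \<noteq> (0,0)")
      case True
      then obtain x y w where X: "(x,y,w) \<in> singset G" and yw: "(y,w) \<noteq> (0,0)" by blast
      obtain M where M: "det3 M \<noteq> 0" and row: "M 0 0 = 1" "M 0 1 = 0" "M 0 2 = 0" "M 1 0 = x" "M 1 1 = y" "M 1 2 = w"
      proof (cases "y = 0")
        case True
        then show ?thesis using yw by (intro that[of "mat9 1 0 0 x y w 0 1 0"]) (simp_all add: det3_def)
      next
        case False
        then show ?thesis by (intro that[of "mat9 1 0 0 x y w 0 0 1"]) (simp_all add: det3_def)
      qed
      let ?H = "tf_subst G M"
      note H = ternary_cubic_subst[OF G, of M]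
      have "vm (0,1,0) M = (x,y,w)" using row by (simp add: vm_def)
      then have "(0,1,0) \<in> singset ?H" using X singset_subst[OF infinite_closed G M] by simp
      then have h: "?H (0,3,0) = 0" "?H (1,2,0) = 0" "?H (0,2,1) = 0"
        unfolding mem_singset[OF H] by auto
      have h': "?H (3,0,0) = 0" "?H (2,1,0) = 0" "?H (2,0,1) = 0" "?H (1,1,1) = 0"
        unfolding tf_subst_eq_form[OF infinite_closed G] cubic_form_coeffs row z 3 by simp_all
      have "?H \<noteq> (\<lambda>_. 0)"
      proof
        assume "?H = (\<lambda>_. 0)"
        then have "tf_subst (\<lambda>_. 0) (inv3 M) = G" using tf_subst_inv3[OF infinite_closed G M] by simp
        then show False using nz by (auto simp: tf_subst_def Let_def fun_eq_iff)
      qed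
      then have "singset ?H = proj_line (0,0,1)" by (rule singset_line[OF H]) (simp_all only: h h')
      then have "point_or_line (singset ?H)" unfolding point_or_line_def by (intro disjI2 exI[of _ "(0,0,1)"]) simp
      then show ?thesis by (rule point_or_line_subst[OF G M])
    next
      case False
      have "(x,0,0) \<in> singset G" if "x \<noteq> 0" for x
        using that z unfolding mem_singset[OF G] by simp
      then have "X \<in> singset G \<longleftrightarrow> X \<in> proj_point (1,0,0)" for X
        using False by (cases X) (auto simp: proj_point_def singset_def)
      then have "singset G = proj_point (1,0,0)" by blast
      then show ?thesis unfolding point_or_line_def by (intro disjI1 exI[of _ "(1,0,0)"]) simp
    qed
  qed
qed

lemma point_or_line_of_singular:
  fixes G :: "'c tform"
  assumes G: "ternary_cubic G" and c: "cuspidal G" and nz: "G \<noteq> (\<lambda>_. 0)"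
    and s: "singset G \<noteq> {}"
  shows "point_or_line (singset G)"
proof -
  obtain x y w where X: "(x,y,w) \<in> singset G" using s by auto
  then have "(x,y,w) \<noteq> (0,0,0)" by (simp add: singset_def)
  then consider "x \<noteq> 0" | "x = 0" "y \<noteq> 0" | "x = 0" "y = 0" "w \<noteq> 0" by auto
  then obtain M where M: "det3 M \<noteq> 0" and row: "M 0 0 = x" "M 0 1 = y" "M 0 2 = w"
  proof cases
    case 1 then show ?thesis by (intro that[of "mat9 x y w 0 1 0 0 0 1"]) (simp_all add: det3_def)
  next
    case 2 then show ?thesis by (intro that[of "mat9 x y w 1 0 0 0 0 1"]) (simp_all add: det3_def)
  next
    case 3 then show ?thesis by (intro that[of "mat9 x y w 0 1 0 1 0 0"]) (simp_all add: det3_def)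
  qed
  have "vm (1,0,0) M = (x,y,w)" using row by (simp add: vm_def)
  then have "(1,0,0) \<in> singset (tf_subst G M)" using X singset_subst[OF infinite_closed G M] by simp
  moreover have "tf_subst G M \<noteq> (\<lambda>_. 0)"
  proof
    assume "tf_subst G M = (\<lambda>_. 0)"
    then have "tf_subst (\<lambda>_. 0) (inv3 M) = G" using tf_subst_inv3[OF infinite_closed G M] by simp
    then show False using nz by (auto simp: tf_subst_def Let_def fun_eq_iff)
  qed
  ultimately have "point_or_line (singset (tf_subst G M))"
    using point_or_line_100[OF ternary_cubic_subst[OF G] cuspidal_subst[OF G c M]] by blast
  then show ?thesis by (rule point_or_line_subst[OF G M])
qed

end

section \<open>Existence of a singular point\<close>

lemma singular_kernel:
  fixes N :: "nat \<Rightarrow> nat \<Rightarrow> 'a::field"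
  assumes "det3 N = 0"
  obtains L where "L \<noteq> (0,0,0)" "mv N L = (0,0,0)"
proof -
  obtain a b c d e f g h i where n: "N 0 0 = a" "N 0 1 = b" "N 0 2 = c" "N 1 0 = d" "N 1 1 = e" "N 1 2 = f"
    "N 2 0 = g" "N 2 1 = h" "N 2 2 = i" by blast
  have D: "a*e*i + b*f*g + c*d*h - a*f*h - b*d*i - c*e*g = 0" using assms unfolding det3_def n by simp
  have mv: "mv N (x,y,z) = (a*x+b*y+c*z, d*x+e*y+f*z, g*x+h*y+i*z)" for x y z
    unfolding mv_def n by simp
  \<comment> \<open>A nonzero cross product of two rows is a kernel vector. If all three vanish the
    rows are proportional, and a vector orthogonal to one suitable row is orthogonal to all.\<close>
  consider (01) "(b*f - c*e, c*d - a*f, a*e - b*d) \<noteq> (0,0,0)" | (02) "(b*i - c*h, c*g - a*i, a*h - b*g) \<noteq> (0,0,0)"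
    | (12) "(e*i - f*h, f*g - d*i, d*h - e*g) \<noteq> (0,0,0)"
    | (par) "b*f = c*e" "c*d = a*f" "a*e = b*d" "b*i = c*h" "c*g = a*i" "a*h = b*g" "e*i = f*h" "f*g = d*i" "d*h = e*g"
    by fastforce
  then show ?thesis
  proof cases
    case 01
    moreover have "mv N (b*f - c*e, c*d - a*f, a*e - b*d) = (0,0,0)"
      unfolding mv prod.inject by (insert D, intro conjI; (algebra | simp add: algebra_simps))
    ultimately show ?thesis by (rule that)
  next
    case 02
    moreover have "mv N (b*i - c*h, c*g - a*i, a*h - b*g) = (0,0,0)"
      unfolding mv prod.inject by (insert D, intro conjI; (algebra | simp add: algebra_simps))
    ultimately show ?thesis by (rule that)
  next
    case 12
    moreover have "mv N (e*i - f*h, f*g - d*i, d*h - e*g) = (0,0,0)"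
      unfolding mv prod.inject by (insert D, intro conjI; (algebra | simp add: algebra_simps))
    ultimately show ?thesis by (rule that)
  next
    case par
    consider "a \<noteq> 0 \<or> b \<noteq> 0" | "d \<noteq> 0 \<or> e \<noteq> 0" | "g \<noteq> 0 \<or> h \<noteq> 0"
      | "a = 0" "b = 0" "d = 0" "e = 0" "g = 0" "h = 0" by blast
    then show ?thesis
    proof cases
      case 1
      have "mv N (b, - a, 0) = (0,0,0)" unfolding mv prod.inject by (insert par, intro conjI; (algebra | simp add: algebra_simps))
      then show ?thesis using 1 by (intro that[of "(b, - a, 0)"]) auto
    next
      case 2
      have "mv N (e, - d, 0) = (0,0,0)" unfolding mv prod.inject by (insert par, intro conjI; (algebra | simp add: algebra_simps))
      then show ?thesis using 2 by (intro that[of "(e, - d, 0)"]) auto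
    next
      case 3
      have "mv N (h, - g, 0) = (0,0,0)" unfolding mv prod.inject by (insert par, intro conjI; (algebra | simp add: algebra_simps))
      then show ?thesis using 3 by (intro that[of "(h, - g, 0)"]) auto
    next
      case 4
      then show ?thesis by (intro that[of "(1,0,0)"]) (simp_all add: mv)
    qed
  qed
qed

text \<open>The branch quartic of the projection of a cubic from one of its points: \<open>I\<close> and \<open>J\<close> say that its two
  basic invariants vanish, so it has a triple root, and \<open>e\<close> is a root of its second derivative. Either
  \<open>e\<close> or the other root of the second derivative is the triple root.\<close>
lemma quartic_triple_root:
  fixes q :: "'a::field"
  assumes two: "(2::'a) \<noteq> 0" and q: "q \<noteq> 0" and c2: "c2 = 3 * r" and I: "c1 * c3 + c0 * q^2 = 3 * r^2"
    and J: "4 * (- (c0 * c2 * q^2) - c0 * c3^2 + r^3) + c1^2 * q^2 = 0"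
    and e: "q^2 * e^2 - 2 * c3 * e - 2 * r = 0"
  shows "\<exists>z. q^2 * z^4 = 4 * (c3 * z^3 + c2 * z^2 + c1 * z + c0) \<and> q^2 * z^3 = 3 * c3 * z^2 + 2 * c2 * z + c1"
proof -
  have four: "(4::'a) \<noteq> 0"
  proof -
    have "(4::'a) = 2 * 2" by simp
    then show ?thesis using two by (metis mult_eq_0_iff)
  qed
  \<comment> \<open>\<open>C0\<close>, \<open>4 * C1\<close> and \<open>4 * C3\<close> are the
    coefficients in orders 0, 1 and 3 of the quartic
    \<open>4 (c3 z^3 + c2 z^2 + c1 z + c0) - q^2 z^4\<close> expanded at \<open>e\<close>; order 2
    vanishes by the choice of \<open>e\<close>.\<close>
  define C1 where "C1 = 3 * c3 * e^2 + 2 * c2 * e + c1 - q^2 * e^3"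
  define C0 where "C0 = 4 * (c3 * e^3 + c2 * e^2 + c1 * e + c0) - q^2 * e^4"
  define C3 where "C3 = c3 - q^2 * e"
  have r: "2 * r = q^2 * e^2 - 2 * c3 * e" using e by algebra
  have I': "4 * (C1 * C3) + C0 * q^2 = 0"
  proof -
    have "4 * (4 * (C1 * C3) + C0 * q^2) = 0" using I r c2 unfolding C1_def C0_def C3_def by algebra
    then show ?thesis using four mult_eq_0_iff by blast
  qed
  have J': "C0 * C3^2 = C1^2 * q^2"
  proof -
    have "8 * (C0 * C3^2 - C1^2 * q^2) = 0" using I J r c2 unfolding C1_def C0_def C3_def by algebra
    moreover have "(8::'a) = 2 * 4" by simp
    ultimately show ?thesis using two four by (metis eq_iff_diff_eq_0 mult_eq_0_iff)
  qed
  have "C1 * (4 * C3^3 + C1 * q^4) = 0" using I' J' by algebra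
  then consider "C1 = 0" | "C1 * q^4 = - (4 * C3^3)" by (auto simp: eq_neg_iff_add_eq_0 add.commute)
  then show ?thesis
  proof cases
    case 1
    then have "C0 = 0" using I' q by simp
    with 1 show ?thesis unfolding C1_def C0_def by (intro exI[of _ e]) (simp add: algebra_simps)
  next
    case 2
    \<comment> \<open>Besides 0, this is the other zero of the second derivative of the shifted
      quartic.\<close>
    define y where "y = 2 * C3 / q^2"
    have y: "q^2 * y = 2 * C3" using q by (simp add: y_def)
    have T1: "q^2 * (e + y)^3 - (3 * c3 * (e + y)^2 + 2 * c2 * (e + y) + c1) = q^2 * y^3 - 3 * C3 * y^2 - C1"
      using r c2 unfolding C1_def C3_def by algebra
    have T0: "q^2 * (e + y)^4 - 4 * (c3 * (e + y)^3 + c2 * (e + y)^2 + c1 * (e + y) + c0)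
        = q^2 * y^4 - 4 * C3 * y^3 - 4 * C1 * y - C0"
      using r c2 unfolding C1_def C0_def C3_def by algebra
    have a: "q^4 * (q^2 * y^3 - 3 * C3 * y^2 - C1) = 0" using y 2 by algebra
    have "q^6 * (q^2 * y^4) = 16 * C3^4" "q^6 * (4 * C3 * y^3) = 32 * C3^4" using y by algebra+
    moreover have "q^6 * (4 * C1 * y) = - (32 * C3^4)" using y 2 by algebra
    moreover have "q^6 * C0 = 16 * C3^4"
    proof -
      have "q^6 * C0 = - 4 * (C1 * q^4) * C3" using I' by algebra
      then show ?thesis unfolding 2 by algebra
    qed
    ultimately have b: "q^6 * (q^2 * y^4 - 4 * C3 * y^3 - 4 * C1 * y - C0) = 0" by (simp add: algebra_simps)
    show ?thesis
      by (rule exI[of _ "e + y"]) (use a b q in \<open>simp add: T0[symmetric] T1[symmetric]\<close>)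
  qed
qed

context alg_closed begin

text \<open>In characteristic 2 with \<open>a\<^sub>1 = 0\<close> the partial derivatives are linear in \<open>x\<^sup>2, y\<^sup>2, z\<^sup>2\<close>, and \<open>a\<^sub>3\<close> is the
  determinant of this linear system.\<close>
lemma singular_point_char2:
  fixes G :: "'c tform"
  assumes G: "ternary_cubic G" and c: "cuspidal G" and two: "(2::'c) = 0"
  shows "singset G \<noteq> {}"
proof -
  obtain r s t where "w_trans 1 r s t (tc_ainv G) = (0,0,0,0,0)" using c unfolding cuspidal_def by blast
  then have 1: "G (1,1,1) + 2 * s = 0" and 3: "fst (snd (snd (tc_ainv G))) + r * G (1,1,1) + 2 * t = 0"
    by (auto simp: w_trans_def tc_ainv_def Let_def)
  have a1: "G (1,1,1) = 0" using 1 two by simp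
  have a3: "fst (snd (snd (tc_ainv G))) = 0" using 3 two a1 by simp
  define N where "N = mat9 (G (3,0,0)) (G (1,2,0)) (G (1,0,2)) (G (2,1,0)) (G (0,3,0)) (G (0,1,2)) (G (2,0,1)) (G (0,2,1)) (G (0,0,3))"
  have "det3 N = 0"
  proof -
    have "det3 N = fst (snd (snd (tc_ainv G))) + 2 * (G (1,2,0) * G (0,1,2) * G (2,0,1)
       + G (1,0,2) * G (2,1,0) * G (0,2,1) - 4 * G (3,0,0) * G (0,3,0) * G (0,0,3))"
      unfolding N_def det3_def mat9_entries' tc_ainv_def Let_def fst_conv snd_conv by algebra
    then show ?thesis by (simp add: a3 two)
  qed
  then obtain L where L: "L \<noteq> (0,0,0)" "mv N L = (0,0,0)" by (rule singular_kernel)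
  obtain a b c where abc: "L = (a,b,c)" by (cases L)
  obtain x y z where xyz: "x^2 = a" "y^2 = b" "z^2 = c" using sqrt_exists by metis
  have n: "G (3,0,0) * x^2 + G (1,2,0) * y^2 + G (1,0,2) * z^2 = 0"
    "G (2,1,0) * x^2 + G (0,3,0) * y^2 + G (0,1,2) * z^2 = 0"
    "G (2,0,1) * x^2 + G (0,2,1) * y^2 + G (0,0,3) * z^2 = 0"
    using L(2) unfolding abc mv_def N_def mat9_entries' xyz by simp_all
  have "(x,y,z) \<noteq> (0,0,0)" using L(1) xyz unfolding abc by auto
  moreover have "tf_eval (tf_dx G) (x,y,z) = 2 * (G (3,0,0) * x^2 + G (2,1,0) * x * y + G (2,0,1) * x * z)"
    "tf_eval (tf_dy G) (x,y,z) = 2 * (G (0,3,0) * y^2 + G (1,2,0) * x * y + G (0,2,1) * y * z)"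
    "tf_eval (tf_dz G) (x,y,z) = 2 * (G (0,0,3) * z^2 + G (1,0,2) * x * z + G (0,1,2) * y * z)"
    unfolding tf_eval_derivs[OF G] using n a1 by algebra+
  moreover have "tf_eval G (x,y,z) = 0"
    unfolding tf_eval_cubic[OF G] using n a1 by algebra
  ultimately have "(x,y,z) \<in> singset G" by (simp add: singset_def two)
  then show ?thesis by blast
qed

lemma singset_subst_nonempty:
  fixes G :: "'c tform"
  assumes G: "ternary_cubic G" and M: "det3 M \<noteq> 0" and ne: "singset (tf_subst G M) \<noteq> {}"
  shows "singset G \<noteq> {}"
  using ne singset_subst[OF infinite_closed G M] by blast

text \<open>The curve is \<open>y x^2 + q z^2 x + c(y,z) = 0\<close> with a binary cubic
  \<open>c\<close>. As a quadratic in \<open>x\<close> it has discriminant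
  \<open>q^2 z^4 - 4 y c(y,z)\<close>, and a multiple root of this quartic lies under a singular
  point. For \<open>q = 0\<close> the root may sit at \<open>y = 0\<close>, so that case is handled
  separately.\<close>

lemma singular_point_normal_form:
  fixes G :: "'c tform"
  assumes G: "ternary_cubic G" and c: "cuspidal G" and two: "(2::'c) \<noteq> 0"
    and z: "G (3,0,0) = 0" "G (2,1,0) = 1" "G (2,0,1) = 0" "G (1,2,0) = 0" "G (1,1,1) = 0"
  shows "singset G \<noteq> {}"
proof -
  define q c0 c1 c2 c3 where n: "q = G (1,0,2)" "c0 = G (0,3,0)" "c1 = G (0,2,1)" "c2 = G (0,1,2)" "c3 = G (0,0,3)"
  obtain r s t where "w_trans 1 r s t (tc_ainv G) = (0,0,0,0,0)" using c unfolding cuspidal_def by blast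
  moreover have "tc_ainv G = (0, - c2, - (c1 * q), c3 * c1 + c0 * q^2, - (c0 * c2 * q^2) - c0 * c3^2)"
    unfolding tc_ainv_def Let_def z n by simp
  ultimately have e: "2 * s = 0" "- c2 + 3 * r - s^2 = 0" "- (c1 * q) + 2 * t = 0"
    "c3 * c1 + c0 * q^2 + s * (c1 * q) - 2 * r * c2 + 3 * r^2 - 2 * s * t = 0"
    "- (c0 * c2 * q^2) - c0 * c3^2 + r * (c3 * c1 + c0 * q^2) - r^2 * c2 + r^3 + t * (c1 * q) - t^2 = 0"
    by (simp_all add: w_trans_def)
  have s: "s = 0" using e(1) two by simp
  have c2: "c2 = 3 * r" using e(2) s by simp
  have I: "c1 * c3 + c0 * q^2 = 3 * r^2" using e(4) s c2 by algebra
  have J: "4 * (- (c0 * c2 * q^2) - c0 * c3^2 + r^3) + c1^2 * q^2 = 0" using e(3,5) I c2 by algebra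
  have S: "(x,y,w) \<in> singset G"
    if "(x,y,w) \<noteq> (0,0,0)" "x^2 * y + q * x * w^2 + c0 * y^3 + c1 * y^2 * w + c2 * y * w^2 + c3 * w^3 = 0"
      "2 * x * y + q * w^2 = 0" "x^2 + 3 * c0 * y^2 + 2 * c1 * y * w + c2 * w^2 = 0"
      "2 * q * x * w + c1 * y^2 + 2 * c2 * y * w + 3 * c3 * w^2 = 0" for x y w
    using that unfolding mem_singset[OF G] z n
    by (simp add: algebra_simps)
  show ?thesis
  proof (cases "q = 0")
    case True
    show ?thesis
    proof (cases "c3 = 0")
      case True
      with J \<open>q = 0\<close> have "4 * r^3 = 0" by simp
      moreover have "(4::'c) = 2 * 2" by simp
      ultimately have "r = 0" using two by (metis mult_eq_0_iff power_eq_0_iff)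
      then have "(0,0,1) \<in> singset G" using True \<open>q = 0\<close> c2 by (intro S) simp_all
      then show ?thesis by blast
    next
      case False
      \<comment> \<open>With \<open>q = 0\<close> the vanishing invariants make the binary cubic
        equal to \<open>c3 (z - w y)^3\<close>.\<close>
      define w where "w = - r / c3"
      have w: "c3 * w = - r" using False by (simp add: w_def)
      have I': "c1 * c3 = 3 * r^2" using I \<open>q = 0\<close> by simp
      have "4 * (r^3 - c0 * c3^2) = 0" using J \<open>q = 0\<close> by (simp add: algebra_simps)
      moreover have "(4::'c) = 2 * 2" by simp
      ultimately have J': "r^3 = c0 * c3^2" using two by (metis eq_iff_diff_eq_0 mult_eq_0_iff)
      have "c3 * (c3 * c1 - 3 * r^2) = 0" using I' by algebra
      have c1: "c1 = 3 * c3 * w^2"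
      proof -
        have "c3 * (c1 - 3 * c3 * w^2) = 0" using I' w by algebra
        then show ?thesis using False by simp
      qed
      have c0: "c0 = - (c3 * w^3)"
      proof -
        have "c3^2 * (c0 + c3 * w^3) = 0" using J' w by algebra
        then show ?thesis using False by (simp add: eq_neg_iff_add_eq_0)
      qed
      have r: "r = - (c3 * w)" using w by simp
      have "(0,1,w) \<in> singset G"
        by (rule S) (simp_all add: \<open>q = 0\<close> c2 c1 c0 r, algebra+)
      then show ?thesis by blast
    qed
  next
    case False
    then have "q^2 \<noteq> 0" by simp
    from quadratic_root[OF this, of "- 2 * c3" "- 2 * r"] obtain e where "q^2 * e^2 - 2 * c3 * e - 2 * r = 0" by auto
    from quartic_triple_root[OF two False c2 I J this] obtain w where
      w: "q^2 * w^4 = 4 * (c3 * w^3 + c2 * w^2 + c1 * w + c0)" "q^2 * w^3 = 3 * c3 * w^2 + 2 * c2 * w + c1" by blast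
    \<comment> \<open>Over a root of the discriminant the quadratic in \<open>x\<close> has this
      double root.\<close>
    define x where "x = - (q * w^2) / 2"
    have x: "2 * x = - (q * w^2)" using two by (simp add: x_def)
    have four: "(4::'c) \<noteq> 0"
    proof -
      have "(4::'c) = 2 * 2" by simp
      then show ?thesis using two by (metis mult_eq_0_iff)
    qed
    have 1: "x^2 + q * x * w^2 + c0 + c1 * w + c2 * w^2 + c3 * w^3 = 0"
    proof -
      have "4 * (x^2 + q * x * w^2 + c0 + c1 * w + c2 * w^2 + c3 * w^3) = 0" using x w(1) by algebra
      then show ?thesis using four mult_eq_0_iff by blast
    qed
    have 2: "2 * q * x * w + c1 + 2 * c2 * w + 3 * c3 * w^2 = 0" using x w(2) by algebra
    have 3: "x^2 + 3 * c0 + 2 * c1 * w + c2 * w^2 = 0" using 1 2 x by algebra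
    have "(x,1,w) \<in> singset G" by (rule S) (use 1 2 3 x in simp_all)
    then show ?thesis by blast
  qed
qed

text \<open>At a smooth point \<open>(1:0:0)\<close> the first matrix makes the tangent
  \<open>y = 0\<close> with coefficient 1. The second completes the square in \<open>x\<close>,
  removing \<open>x y^2\<close> and \<open>x y z\<close>, and needs division by 2.\<close>

lemma singular_point_tangent:
  fixes G :: "'c tform"
  assumes G: "ternary_cubic G" and c: "cuspidal G" and two: "(2::'c) \<noteq> 0"
    and z: "G (3,0,0) = 0" "G (2,1,0) \<noteq> 0"
  shows "singset G \<noteq> {}"
proof -
  define a where "a = G (2,1,0)"
  have a: "a \<noteq> 0" using z by (simp add: a_def)
  let ?M = "mat9 1 0 0 0 (1/a) 0 0 (- G (2,0,1) / a) 1"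
  let ?H = "tf_subst G ?M"
  have dM: "det3 ?M \<noteq> 0" using a by (simp add: det3_def)
  note H = ternary_cubic_subst[OF G, of ?M]
  have h: "?H (3,0,0) = 0" "?H (2,1,0) = 1" "?H (2,0,1) = 0"
    unfolding tf_subst_eq_form[OF infinite_closed G] mat9_entries' cubic_form_coeffs a_def[symmetric] z(1)
    using a by simp_all
  let ?N = "mat9 1 0 0 (- ?H (1,2,0) / 2) 1 0 (- ?H (1,1,1) / 2) 0 1"
  let ?K = "tf_subst ?H ?N"
  have dN: "det3 ?N \<noteq> 0" by (simp add: det3_def)
  have k: "?K (3,0,0) = 0" "?K (2,1,0) = 1" "?K (2,0,1) = 0" "?K (1,2,0) = 0" "?K (1,1,1) = 0"
    unfolding tf_subst_eq_form[OF infinite_closed H, of ?N] mat9_entries' cubic_form_coeffs h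
    using two by simp_all
  have "singset ?K \<noteq> {}"
    by (rule singular_point_normal_form[OF ternary_cubic_subst[OF H] cuspidal_subst[OF H cuspidal_subst[OF G c dM] dN] two k])
  then have "singset ?H \<noteq> {}" by (rule singset_subst_nonempty[OF H dN])
  then show ?thesis by (rule singset_subst_nonempty[OF G dM])
qed

lemma singular_point_on_curve:
  fixes G :: "'c tform"
  assumes G: "ternary_cubic G" and c: "cuspidal G" and two: "(2::'c) \<noteq> 0" and z: "G (3,0,0) = 0"
  shows "singset G \<noteq> {}"
proof -
  let ?S = "mat9 1 0 0 0 0 1 0 1 0 :: nat \<Rightarrow> nat \<Rightarrow> 'c"
  have dS: "det3 ?S \<noteq> 0" by (simp add: det3_def)
  consider "G (2,1,0) \<noteq> 0" | "G (2,0,1) \<noteq> 0" | "G (2,1,0) = 0" "G (2,0,1) = 0" by blast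
  then show ?thesis
  proof cases
    case 1 then show ?thesis by (rule singular_point_tangent[OF G c two z])
  next
    case 2
    have h: "tf_subst G ?S (3,0,0) = 0" "tf_subst G ?S (2,1,0) \<noteq> 0"
      unfolding tf_subst_swap12[OF infinite_closed G] cubic_form_coeffs using z 2 by simp_all
    show ?thesis
      by (rule singset_subst_nonempty[OF G dS], rule singular_point_tangent[OF ternary_cubic_subst[OF G] cuspidal_subst[OF G c dS] two h])
  next
    case 3
    then have "(1,0,0) \<in> singset G" using singset_100[OF G] z by simp
    then show ?thesis by blast
  qed
qed

lemma singular_point_exists:
  fixes G :: "'c tform"
  assumes G: "ternary_cubic G" and c: "cuspidal G"
  shows "singset G \<noteq> {}"
proof (cases "(2::'c) = 0")
  case True then show ?thesis by (rule singular_point_char2[OF G c])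
next
  case two: False
  show ?thesis
  proof (cases "G (3,0,0) = 0")
    case True then show ?thesis by (rule singular_point_on_curve[OF G c two])
  next
    case False
    \<comment> \<open>The point \<open>(x:1:0)\<close> where the curve meets \<open>z = 0\<close>,
      to be moved to \<open>(1:0:0)\<close>.\<close>
    obtain x where x: "G (3,0,0) * x^3 + G (2,1,0) * x^2 + G (1,2,0) * x + G (0,3,0) = 0"
      using cubic_root[OF False] by blast
    let ?M = "mat9 x 1 0 1 0 0 0 0 1"
    have dM: "det3 ?M \<noteq> 0" by (simp add: det3_def)
    have h: "tf_subst G ?M (3,0,0) = 0"
      unfolding tf_subst_eq_form[OF infinite_closed G] mat9_entries' cubic_form_coeffs using x by (simp add: algebra_simps)
    show ?thesis
      by (rule singset_subst_nonempty[OF G dM], rule singular_point_on_curve[OF ternary_cubic_subst[OF G] cuspidal_subst[OF G c dM] two h])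
  qed
qed

lemma cuspidal_point_or_line:
  fixes G :: "'c tform"
  assumes G: "ternary_cubic G" and c: "cuspidal G" and nz: "G \<noteq> (\<lambda>_. 0)"
  shows "point_or_line (singset G)"
  by (rule point_or_line_of_singular[OF G c nz singular_point_exists[OF G c]])

end

section \<open>Descent to the perfect field\<close>

locale closure =
  fixes emb :: "'k::field \<Rightarrow> 'c::field"
  assumes closure: "algebraic_closure emb"
begin

sublocale alg_closed "TYPE('c)"
  by standard (use closure in \<open>auto simp: algebraic_closure_def\<close>)

lemma emb_add: "emb (x + y) = emb x + emb y" and emb_mult: "emb (x * y) = emb x * emb y" and emb_1: "emb 1 = 1"
  using closure by (simp_all add: algebraic_closure_def)

lemma emb_0: "emb 0 = 0"
proof -
  have "emb 0 + emb 0 = emb 0 + 0" using emb_add[of 0 0] by (simp only: add_0_right)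
  then show ?thesis by (simp only: add_left_cancel)
qed

lemma emb_uminus: "emb (- x) = - emb x"
  using emb_add[of x "- x"] by (simp add: emb_0 eq_neg_iff_add_eq_0 add.commute)

lemma emb_eq_0_iff: "emb x = 0 \<longleftrightarrow> x = 0"
proof
  assume x: "emb x = 0"
  show "x = 0"
  proof (rule ccontr)
    assume "x \<noteq> 0"
    then have "emb (x * inverse x) = 1" by (simp add: emb_1)
    then show False by (simp add: emb_mult x)
  qed
qed (simp add: emb_0)

lemma emb_of_nat: "emb (of_nat n) = of_nat n"
  by (induction n) (simp_all add: emb_0 emb_1 emb_add)

lemma emb_power: "emb (x ^ n) = emb x ^ n"
  by (induction n) (simp_all add: emb_1 emb_mult)

lemma CHAR_emb: "CHAR('c) = CHAR('k)"
proof (rule CHAR_eqI)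
  have "of_nat CHAR('k) = (0 :: 'k)" by simp
  then show "of_nat CHAR('k) = (0 :: 'c)" by (metis emb_of_nat emb_0)
next
  fix n assume "of_nat n = (0 :: 'c)"
  then have "of_nat n = (0 :: 'k)" by (metis emb_of_nat emb_eq_0_iff)
  then show "CHAR('k) dvd n" by (simp add: of_nat_eq_0_iff_char_dvd)
qed

text \<open>Closure under sums and products is a sufficient definition of an intermediate field:
  inverses follow from algebraicity in \<open>subext_inverse\<close>.\<close>

definition subext :: "'c set \<Rightarrow> bool" where
  "subext L \<longleftrightarrow> range emb \<subseteq> L \<and> (\<forall>x\<in>L. \<forall>y\<in>L. x + y \<in> L \<and> x * y \<in> L)"

text \<open>Homomorphisms are kept partial, on a subfield containing the coordinates of interest.
  Conjugation then needs no automorphism of the whole closure and no transfinite extension.\<close>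

definition hom_on :: "'c set \<Rightarrow> ('c \<Rightarrow> 'c) \<Rightarrow> bool" where
  "hom_on L \<sigma> \<longleftrightarrow> subext L \<and> (\<forall>x\<in>L. \<forall>y\<in>L. \<sigma> (x + y) = \<sigma> x + \<sigma> y \<and> \<sigma> (x * y) = \<sigma> x * \<sigma> y) \<and>
     (\<forall>c. \<sigma> (emb c) = emb c)"

definition coeffs_in :: "'c set \<Rightarrow> 'c poly \<Rightarrow> bool" where
  "coeffs_in L f \<longleftrightarrow> (\<forall>i. coeff f i \<in> L)"

lemma subextD:
  assumes "subext L"
  shows "emb c \<in> L" "0 \<in> L" "1 \<in> L" "x \<in> L \<Longrightarrow> y \<in> L \<Longrightarrow> x + y \<in> L" "x \<in> L \<Longrightarrow> y \<in> L \<Longrightarrow> x * y \<in> L"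
    "x \<in> L \<Longrightarrow> - x \<in> L" "x \<in> L \<Longrightarrow> y \<in> L \<Longrightarrow> x - y \<in> L" "x \<in> L \<Longrightarrow> x ^ n \<in> L"
proof -
  show e: "emb c \<in> L" for c using assms by (auto simp: subext_def)
  show "0 \<in> L" "1 \<in> L" using e[of 0] e[of 1] by (simp_all add: emb_0 emb_1)
  show a: "x \<in> L \<Longrightarrow> y \<in> L \<Longrightarrow> x + y \<in> L" and m: "x \<in> L \<Longrightarrow> y \<in> L \<Longrightarrow> x * y \<in> L" for x y
    using assms by (auto simp: subext_def)
  show u: "x \<in> L \<Longrightarrow> - x \<in> L" for x
    using m[of "emb (- 1)" x] e[of "- 1"] by (simp add: emb_uminus emb_1)
  show "x \<in> L \<Longrightarrow> y \<in> L \<Longrightarrow> x - y \<in> L" using a[of x "- y"] u[of y] by simp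
  show "x \<in> L \<Longrightarrow> x ^ n \<in> L" using m \<open>1 \<in> L\<close> by (induction n) simp_all
qed

lemma subext_sum: "subext L \<Longrightarrow> (\<And>i. i \<in> A \<Longrightarrow> f i \<in> L) \<Longrightarrow> sum f A \<in> L"
  by (induction A rule: infinite_finite_induct) (simp_all add: subextD)

lemma subext_poly:
  assumes "subext L" "coeffs_in L f" "z \<in> L"
  shows "poly f z \<in> L"
  unfolding poly_altdef using assms by (intro subext_sum subextD) (auto simp: coeffs_in_def)

lemma algebraic: "\<exists>p :: 'k poly. p \<noteq> 0 \<and> poly (map_poly emb p) z = 0"
  using closure by (simp add: algebraic_closure_def)

lemma coeffs_in_map_emb: "subext L \<Longrightarrow> coeffs_in L (map_poly emb p)"
  by (simp add: coeffs_in_def coeff_map_poly emb_0 subextD)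

text \<open>A relation of least degree for \<open>w\<close> has nonzero constant term, as otherwise
  a factor \<open>w\<close> could be cancelled. Solving it for that term gives the inverse as a
  polynomial in \<open>w\<close>.\<close>

lemma subext_inverse:
  assumes L: "subext L" and w: "w \<in> L" "w \<noteq> 0"
  shows "inverse w \<in> L"
proof -
  define Pr where "Pr p \<longleftrightarrow> p \<noteq> 0 \<and> poly (map_poly emb p) w = 0" for p :: "'k poly"
  obtain p where p: "Pr p" and min: "\<And>p'. Pr p' \<Longrightarrow> degree p \<le> degree p'"
    using algebraic[of w] ex_has_least_nat[of Pr _ degree] unfolding Pr_def by metis
  obtain c q where pc: "p = pCons c q" by (cases p)
  have ev: "emb c + w * poly (map_poly emb q) w = 0"
    using p by (simp add: Pr_def pc map_poly_pCons emb_0)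
  have "c \<noteq> 0"
  proof
    assume c: "c = 0"
    then have q: "q \<noteq> 0" using p by (auto simp: Pr_def pc)
    then have "Pr q" using ev c w by (simp add: Pr_def emb_0)
    from min[OF this] show False using q by (simp add: pc c)
  qed
  then have ec: "emb c \<noteq> 0" by (simp add: emb_eq_0_iff)
  have ic: "emb (inverse c) * emb c = 1" using \<open>c \<noteq> 0\<close> by (simp add: emb_mult[symmetric] emb_1)
  have "inverse w = - (poly (map_poly emb q) w * emb (inverse c))"
  proof -
    have "w * (- (poly (map_poly emb q) w * emb (inverse c))) = 1" using ev ic by algebra
    then show ?thesis using w(2) by (simp add: field_simps)
  qed
  then show ?thesis using L w by (auto intro!: subextD subext_poly coeffs_in_map_emb)
qed

lemma hom_onD:
  assumes "hom_on L \<sigma>"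
  shows "subext L" "x \<in> L \<Longrightarrow> y \<in> L \<Longrightarrow> \<sigma> (x + y) = \<sigma> x + \<sigma> y" "x \<in> L \<Longrightarrow> y \<in> L \<Longrightarrow> \<sigma> (x * y) = \<sigma> x * \<sigma> y"
    "\<sigma> (emb c) = emb c" "\<sigma> 0 = 0" "\<sigma> 1 = 1" "x \<in> L \<Longrightarrow> \<sigma> (- x) = - \<sigma> x" "x \<in> L \<Longrightarrow> y \<in> L \<Longrightarrow> \<sigma> (x - y) = \<sigma> x - \<sigma> y"
proof -
  show L: "subext L" using assms by (simp add: hom_on_def)
  show e: "\<sigma> (emb c) = emb c" for c using assms by (simp add: hom_on_def)
  show z: "\<sigma> 0 = 0" and "\<sigma> 1 = 1" using e[of 0] e[of 1] by (simp_all add: emb_0 emb_1)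
  show a: "x \<in> L \<Longrightarrow> y \<in> L \<Longrightarrow> \<sigma> (x + y) = \<sigma> x + \<sigma> y" and "x \<in> L \<Longrightarrow> y \<in> L \<Longrightarrow> \<sigma> (x * y) = \<sigma> x * \<sigma> y" for x y
    using assms by (auto simp: hom_on_def)
  show u: "x \<in> L \<Longrightarrow> \<sigma> (- x) = - \<sigma> x" for x
    using a[of x "- x"] subextD(6)[OF L, of x] z by (simp add: eq_neg_iff_add_eq_0 add.commute)
  show "x \<in> L \<Longrightarrow> y \<in> L \<Longrightarrow> \<sigma> (x - y) = \<sigma> x - \<sigma> y"
    using a[of x "- y"] subextD(6)[OF L, of y] u[of y] by simp
qed

lemma hom_on_eq_0:
  assumes h: "hom_on L \<sigma>" and x: "x \<in> L" "\<sigma> x = 0"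
  shows "x = 0"
proof (rule ccontr)
  assume n: "x \<noteq> 0"
  have "\<sigma> (x * inverse x) = \<sigma> x * \<sigma> (inverse x)"
    by (rule hom_onD(3)[OF h x(1) subext_inverse[OF hom_onD(1)[OF h] x(1) n]])
  then show False using n x hom_onD(6)[OF h] by simp
qed

lemma hom_on_sum: "hom_on L \<sigma> \<Longrightarrow> (\<And>i. i \<in> A \<Longrightarrow> f i \<in> L) \<Longrightarrow> \<sigma> (sum f A) = (\<Sum>i\<in>A. \<sigma> (f i))"
  by (induction A rule: infinite_finite_induct) (simp_all add: hom_onD subext_sum)

lemma coeffs_in_simps:
  assumes L: "subext L"
  shows "coeffs_in L f \<Longrightarrow> coeffs_in L g \<Longrightarrow> coeffs_in L (f + g)"
    "coeffs_in L f \<Longrightarrow> coeffs_in L g \<Longrightarrow> coeffs_in L (f - g)"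
    "coeffs_in L f \<Longrightarrow> coeffs_in L g \<Longrightarrow> coeffs_in L (f * g)"
    "a \<in> L \<Longrightarrow> coeffs_in L f \<Longrightarrow> coeffs_in L (smult a f)"
    "a \<in> L \<Longrightarrow> coeffs_in L f \<Longrightarrow> coeffs_in L (monom a n * f)"
    "a \<in> L \<Longrightarrow> coeffs_in L [:a:]" "coeffs_in L [:0,1:]"
  using L unfolding coeffs_in_def
  by (auto simp: subextD coeff_monom_mult coeff_mult coeff_pCons intro!: subext_sum split: nat.splits)

lemma map_poly_hom:
  assumes h: "hom_on L \<sigma>" and f: "coeffs_in L f" and g: "coeffs_in L g"
  shows "map_poly \<sigma> (f + g) = map_poly \<sigma> f + map_poly \<sigma> g"
    "map_poly \<sigma> (f - g) = map_poly \<sigma> f - map_poly \<sigma> g"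
    "map_poly \<sigma> (f * g) = map_poly \<sigma> f * map_poly \<sigma> g"
    "a \<in> L \<Longrightarrow> map_poly \<sigma> (smult a f) = smult (\<sigma> a) (map_poly \<sigma> f)"
    "a \<in> L \<Longrightarrow> map_poly \<sigma> (monom a n * f) = monom (\<sigma> a) n * map_poly \<sigma> f"
proof -
  note L = hom_onD(1)[OF h]
  note 0 = hom_onD(5)[OF h]
  show "map_poly \<sigma> (f * g) = map_poly \<sigma> f * map_poly \<sigma> g"
  proof (rule poly_eqI)
    fix n
    have "\<sigma> (coeff (f * g) n) = (\<Sum>i\<le>n. \<sigma> (coeff f i * coeff g (n - i)))"
      unfolding coeff_mult using f g subextD(5)[OF L] by (intro hom_on_sum[OF h]) (auto simp: coeffs_in_def)
    also have "\<dots> = (\<Sum>i\<le>n. \<sigma> (coeff f i) * \<sigma> (coeff g (n - i)))"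
      using f g by (intro sum.cong refl hom_onD(3)[OF h]) (auto simp: coeffs_in_def)
    finally show "coeff (map_poly \<sigma> (f * g)) n = coeff (map_poly \<sigma> f * map_poly \<sigma> g) n"
      by (simp add: coeff_map_poly 0 coeff_mult)
  qed
qed (use f g in \<open>auto intro!: poly_eqI simp: coeff_map_poly hom_onD[OF h] coeff_monom_mult coeffs_in_def\<close>)

text \<open>Adjoining one element: \<open>poly f z\<close> is sent to the conjugated polynomial
  evaluated at \<open>z'\<close>. The representative \<open>f\<close> is picked by
  \<open>SOME\<close>, and independence of it amounts to relations of \<open>z\<close> being carried
  to relations of \<open>z'\<close>.\<close>

lemma hom_on_extend:
  assumes h: "hom_on L \<sigma>" and m: "coeffs_in L m" "m \<noteq> 0" "poly m z = 0"
    and min: "\<And>f. coeffs_in L f \<Longrightarrow> f \<noteq> 0 \<Longrightarrow> poly f z = 0 \<Longrightarrow> degree m \<le> degree f"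
    and z': "poly (map_poly \<sigma> m) z' = 0"
  obtains L' \<sigma>' where "hom_on L' \<sigma>'" "L \<subseteq> L'" "z \<in> L'" "\<And>x. x \<in> L \<Longrightarrow> \<sigma>' x = \<sigma> x" "\<sigma>' z = z'"
proof -
  note L = hom_onD(1)[OF h]
  note 0 = hom_onD(5)[OF h]
  \<comment> \<open>Induction on the degree by pseudo-division: multiplying \<open>f\<close> by the
    leading coefficient of \<open>m\<close> allows its top term to be cancelled without
    inverses.\<close>
  have key: "poly (map_poly \<sigma> f) z' = 0" if "coeffs_in L f" "poly f z = 0" for f
    using that
  proof (induction "degree f" arbitrary: f rule: less_induct)
    case less
    show ?case
    proof (cases "f = 0")
      case False
      define a b n where "a = lead_coeff m" and "b = lead_coeff f" and "n = degree f - degree m"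
      have ab: "a \<in> L" "b \<in> L" "a \<noteq> 0" using m less.prems by (simp_all add: a_def b_def coeffs_in_def)
      have dm: "degree m \<le> degree f" by (rule min[OF less.prems(1) False less.prems(2)])
      have df: "0 < degree f"
      proof (rule ccontr)
        assume "\<not> 0 < degree f"
        then obtain c where "f = [:c:]" using degree_eq_zeroE by blast
        then show False using less.prems(2) False by simp
      qed
      define g where "g = smult a f - monom b n * m"
      have gL: "coeffs_in L g" unfolding g_def
        by (intro coeffs_in_simps[OF L] ab less.prems m)
      have gz: "poly g z = 0" using less.prems(2) m(3) by (simp add: g_def)
      have "coeff g i = 0" if "degree f \<le> i" for i
      proof (cases "i = degree f")
        case True
        then show ?thesis using dm by (simp add: g_def coeff_monom_mult a_def b_def n_def)
      next
        case False
        then have "degree f < i" using that by simp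
        moreover from this have "degree m < i - n" using dm by (simp add: n_def)
        ultimately show ?thesis by (simp add: g_def coeff_monom_mult coeff_eq_0)
      qed
      then have "degree g < degree f" using df degree_le[of "degree f - 1" g] by fastforce
      then have "poly (map_poly \<sigma> g) z' = 0" using less.hyps gL gz by blast
      moreover have "map_poly \<sigma> g = smult (\<sigma> a) (map_poly \<sigma> f) - monom (\<sigma> b) n * map_poly \<sigma> m"
        unfolding g_def map_poly_hom(2)[OF h coeffs_in_simps(4)[OF L ab(1) less.prems(1)] coeffs_in_simps(5)[OF L ab(2) m(1)]]
          map_poly_hom(4)[OF h less.prems(1) less.prems(1) ab(1)] map_poly_hom(5)[OF h m(1) m(1) ab(2)] ..
      ultimately have "\<sigma> a * poly (map_poly \<sigma> f) z' = 0" by (simp add: z')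
      moreover have "\<sigma> a \<noteq> 0" using hom_on_eq_0[OF h ab(1)] ab(3) by blast
      ultimately show ?thesis by simp
    qed simp
  qed
  define L' where "L' = {poly f z | f. coeffs_in L f}"
  define \<sigma>' where "\<sigma>' w = poly (map_poly \<sigma> (SOME f. coeffs_in L f \<and> poly f z = w)) z'" for w
  have sg: "\<sigma>' (poly f z) = poly (map_poly \<sigma> f) z'" if f: "coeffs_in L f" for f
  proof -
    define g where "g = (SOME g. coeffs_in L g \<and> poly g z = poly f z)"
    have "coeffs_in L g \<and> poly g z = poly f z" unfolding g_def by (rule someI[of _ f]) (use f in simp)
    then have g: "coeffs_in L g" "poly g z = poly f z" by auto
    have "poly (map_poly \<sigma> (g - f)) z' = 0"
      using key[of "g - f"] coeffs_in_simps(2)[OF L g(1) f] g(2) by simp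
    then show ?thesis unfolding \<sigma>'_def g_def[symmetric] by (simp add: map_poly_hom(2)[OF h g(1) f])
  qed
  have c: "coeffs_in L [:x:]" if "x \<in> L" for x using coeffs_in_simps(6)[OF L that] .
  have cs: "\<sigma>' x = \<sigma> x" and cL: "x \<in> L'" if "x \<in> L" for x
    using sg[OF c[OF that]] c[OF that] by (auto simp: map_poly_pCons 0 L'_def intro!: exI[of _ "[:x:]"])
  have sub: "subext L'" unfolding subext_def
  proof (intro conjI ballI subsetI)
    fix x assume "x \<in> range emb" then show "x \<in> L'" using cL subextD(1)[OF L] by auto
  next
    fix x y assume "x \<in> L'" "y \<in> L'"
    then obtain f g where fg: "coeffs_in L f" "coeffs_in L g" "x = poly f z" "y = poly g z" by (auto simp: L'_def)
    show "x + y \<in> L'" unfolding L'_def using coeffs_in_simps(1)[OF L fg(1,2)] fg by (auto intro!: exI[of _ "f + g"])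
    show "x * y \<in> L'" unfolding L'_def using coeffs_in_simps(3)[OF L fg(1,2)] fg by (auto intro!: exI[of _ "f * g"])
  qed
  have "hom_on L' \<sigma>'" unfolding hom_on_def
  proof (intro conjI ballI allI sub)
    fix x y assume "x \<in> L'" "y \<in> L'"
    then obtain f g where fg: "coeffs_in L f" "coeffs_in L g" "x = poly f z" "y = poly g z" by (auto simp: L'_def)
    show "\<sigma>' (x + y) = \<sigma>' x + \<sigma>' y"
      using sg[OF fg(1)] sg[OF fg(2)] sg[OF coeffs_in_simps(1)[OF L fg(1,2)]] by (simp add: fg map_poly_hom(1)[OF h fg(1,2)])
    show "\<sigma>' (x * y) = \<sigma>' x * \<sigma>' y"
      using sg[OF fg(1)] sg[OF fg(2)] sg[OF coeffs_in_simps(3)[OF L fg(1,2)]] by (simp add: fg map_poly_hom(3)[OF h fg(1,2)])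
  next
    fix c show "\<sigma>' (emb c) = emb c" using cs[OF subextD(1)[OF L]] hom_onD(4)[OF h] by simp
  qed
  moreover have "\<sigma>' z = z'"
    using sg[OF coeffs_in_simps(7)[OF L]] by (simp add: map_poly_pCons 0 hom_onD(6)[OF h])
  moreover have "z \<in> L'" unfolding L'_def using coeffs_in_simps(7)[OF L] by (auto intro!: exI[of _ "[:0,1:]"])
  ultimately show ?thesis using that cL cs by blast
qed

lemma minimal_poly:
  assumes L: "subext L"
  obtains m where "coeffs_in L m" "m \<noteq> 0" "poly m z = 0"
    "\<And>f. coeffs_in L f \<Longrightarrow> f \<noteq> 0 \<Longrightarrow> poly f z = 0 \<Longrightarrow> degree m \<le> degree f"
proof -
  define Pr where "Pr f \<longleftrightarrow> coeffs_in L f \<and> f \<noteq> 0 \<and> poly f z = 0" for f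
  obtain p where p: "p \<noteq> 0" "poly (map_poly emb p) z = 0" using algebraic by blast
  have "map_poly emb p \<noteq> 0" using p(1) by (auto simp: map_poly_eq_0_iff emb_0 emb_eq_0_iff)
  then have "Pr (map_poly emb p)" using p coeffs_in_map_emb[OF L] by (simp add: Pr_def)
  then obtain m where "Pr m" "\<And>f. Pr f \<Longrightarrow> degree m \<le> degree f"
    using ex_has_least_nat[of Pr _ degree] by metis
  then show ?thesis using that unfolding Pr_def by blast
qed

text \<open>The conjugated minimal polynomial keeps its degree, because a homomorphism of fields
  does not kill the leading coefficient; hence it has a root to which \<open>z\<close> can be
  sent.\<close>

lemma hom_on_extend_any:
  assumes h: "hom_on L \<sigma>"
  obtains L' \<sigma>' where "hom_on L' \<sigma>'" "L \<subseteq> L'" "z \<in> L'" "\<And>x. x \<in> L \<Longrightarrow> \<sigma>' x = \<sigma> x"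
proof -
  obtain m where m: "coeffs_in L m" "m \<noteq> 0" "poly m z = 0"
    and min: "\<And>f. coeffs_in L f \<Longrightarrow> f \<noteq> 0 \<Longrightarrow> poly f z = 0 \<Longrightarrow> degree m \<le> degree f"
    by (rule minimal_poly[OF hom_onD(1)[OF h], where z = z]) blast
  have "0 < degree m"
  proof (rule ccontr)
    assume "\<not> 0 < degree m"
    then obtain c where "m = [:c:]" using degree_eq_zeroE by blast
    then show False using m(2,3) by simp
  qed
  moreover have "degree m \<le> degree (map_poly \<sigma> m)"
  proof (rule le_degree)
    have "\<sigma> (lead_coeff m) \<noteq> 0" using hom_on_eq_0[OF h, of "lead_coeff m"] m by (auto simp: coeffs_in_def)
    then show "coeff (map_poly \<sigma> m) (degree m) \<noteq> 0" by (simp add: coeff_map_poly hom_onD(5)[OF h])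
  qed
  ultimately have "0 < degree (map_poly \<sigma> m)" by simp
  then obtain z' where "poly (map_poly \<sigma> m) z' = 0" using ac by blast
  show ?thesis
    by (rule hom_on_extend[OF h m _ \<open>poly (map_poly \<sigma> m) z' = 0\<close>]) (erule (2) min, rule that)
qed

end

locale perfect_closure = closure emb for emb :: "'k::field \<Rightarrow> 'c::field" +
  assumes perfect: "perfect_field TYPE('k)"
begin

text \<open>Perfectness makes the minimal polynomial of \<open>a\<close> separable. Being of degree
  at least 2, it has a root other than \<open>a\<close>, and sending \<open>a\<close> there extends
  the identity of the base field.\<close>

lemma conjugate_exists:
  assumes a: "a \<notin> range emb"
  obtains L \<sigma> where "hom_on L \<sigma>" "a \<in> L" "\<sigma> a \<noteq> a"
proof -
  define L0 where "L0 = range emb"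
  have L0: "subext L0" unfolding subext_def L0_def by (auto simp: emb_add[symmetric] emb_mult[symmetric])
  have id: "hom_on L0 (\<lambda>x. x)" by (simp add: hom_on_def L0)
  obtain m where m: "coeffs_in L0 m" "m \<noteq> 0" "poly m a = 0"
    and min: "\<And>f. coeffs_in L0 f \<Longrightarrow> f \<noteq> 0 \<Longrightarrow> poly f a = 0 \<Longrightarrow> degree m \<le> degree f"
    by (rule minimal_poly[OF L0, where z = a]) blast
  have sep: "pderiv m \<noteq> 0"
  proof
    assume pd: "pderiv m = 0"
    have deg: "0 < degree m"
    proof (rule ccontr)
      assume "\<not> 0 < degree m"
      then obtain c where "m = [:c:]" using degree_eq_zeroE by blast
      then show False using m(2,3) by simp
    qed
    have dvd: "CHAR('k) dvd i" if "coeff m i \<noteq> 0" for i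
    proof (cases i)
      case (Suc j)
      have "of_nat (Suc j) * coeff m (Suc j) = 0" using pd coeff_pderiv[of m j] by simp
      then have "of_nat i = (0::'c)" using that Suc by simp
      then show ?thesis by (simp add: of_nat_eq_0_iff_char_dvd CHAR_emb)
    qed simp
    define p where "p = CHAR('k)"
    have pd: "p dvd degree m" using dvd[of "degree m"] m(2) by (simp add: p_def)
    then have p0: "p \<noteq> 0" using deg by auto
    then have prm: "prime p" using prime_CHAR_semidom[where ?'a = 'k] by (simp add: p_def)
    have "\<exists>d. emb d ^ p = coeff m i" for i
    proof -
      have "coeff m i \<in> range emb" using m(1) unfolding coeffs_in_def L0_def by blast
      then obtain c where "coeff m i = emb c" by blast
      moreover have "\<forall>y::'k. \<exists>x. x ^ p = y" using perfect p0 unfolding perfect_field_def p_def by blast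
      then obtain d where "d ^ p = c" by blast
      ultimately show ?thesis by (intro exI[of _ d]) (simp add: emb_power[symmetric])
    qed
    then have "\<forall>i. \<exists>d. emb d ^ p = coeff m i" by blast
    from choice[OF this] obtain d where d: "\<And>i. emb (d i) ^ p = coeff m i" by blast
    define n where "n = degree m div p"
    have np: "degree m = n * p" using pd by (simp add: n_def)
    \<comment> \<open>If the derivative vanishes, only exponents divisible by the characteristic
      occur, and the coefficients have roots of that order. By additivity of the p-th power,
      \<open>h\<close> satisfies \<open>poly h a ^ p = poly m a = 0\<close> and has smaller degree
      than \<open>m\<close>.\<close>
    define h where "h = (\<Sum>j\<le>n. monom (emb (d (j * p))) j)"
    have ch: "coeff h j = (if j \<le> n then emb (d (j * p)) else 0)" for j
      by (simp add: h_def coeff_sum)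
    have hL: "coeffs_in L0 h" using subextD(1,2)[OF L0] by (simp add: coeffs_in_def ch)
    have hn: "h \<noteq> 0"
    proof
      assume "h = 0"
      then have "emb (d (degree m)) = 0" using ch[of n] np by simp
      then have "lead_coeff m = 0 ^ p" using d[of "degree m"] by simp
      then show False using m(2) p0 by (simp add: zero_power)
    qed
    have "poly h a ^ p = (\<Sum>j\<le>n. (emb (d (j * p)) * a ^ j) ^ p)"
      unfolding h_def poly_sum poly_monom
      by (rule freshmans_dream_sum) (use prm in \<open>simp_all add: CHAR_emb p_def\<close>)
    also have "\<dots> = (\<Sum>j\<le>n. coeff m (j * p) * a ^ (j * p))"
      by (simp only: power_mult_distrib d power_mult)
    also have "\<dots> = (\<Sum>i\<in>(\<lambda>j. j * p) ` {..n}. coeff m i * a ^ i)"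
    proof -
      have "inj_on (\<lambda>j. j * p) {..n}" using p0 by (simp add: inj_on_def)
      then show ?thesis by (simp add: sum.reindex)
    qed
    also have "\<dots> = (\<Sum>i\<le>degree m. coeff m i * a ^ i)"
    proof (rule sum.mono_neutral_left)
      show "(\<lambda>j. j * p) ` {..n} \<subseteq> {..degree m}" by (auto simp: np)
      show "\<forall>i\<in>{..degree m} - (\<lambda>j. j * p) ` {..n}. coeff m i * a ^ i = 0"
      proof
        fix i assume i: "i \<in> {..degree m} - (\<lambda>j. j * p) ` {..n}"
        have "coeff m i = 0"
        proof (rule ccontr)
          assume "coeff m i \<noteq> 0"
          then have "p dvd i" using dvd unfolding p_def by blast
          then obtain j where j: "i = j * p" by (metis dvdE mult.commute)
          then have "j \<le> n" using i p0 by (auto simp: np)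
          then show False using i j by auto
        qed
        then show "coeff m i * a ^ i = 0" by simp
      qed
    qed simp
    also have "\<dots> = 0" using m(3) by (simp add: poly_altdef)
    finally have "poly h a = 0" using p0 by simp
    from min[OF hL hn this] have "n * p \<le> degree h" by (simp add: np)
    also have "degree h \<le> n" by (rule degree_le) (simp add: ch)
    finally have le: "n * p \<le> n" .
    have "0 < n" using deg unfolding np by (cases n) simp_all
    then have "n * 1 < n * p" using prime_gt_1_nat[OF prm] by (intro mult_strict_left_mono)
    then show False using le by simp
  qed
  obtain q where q: "m = [:- a, 1:] * q" using m(3) by (auto simp: poly_eq_0_iff_dvd dvd_def)
  have "0 < degree q"
  proof (rule ccontr)
    assume "\<not> 0 < degree q"
    then obtain c where c: "q = [:c:]" using degree_eq_zeroE by blast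
    have mc: "m = [:- (a * c), c:]" unfolding q c by simp
    then have "c \<noteq> 0" using m(2) by auto
    have "coeff m 0 \<in> L0" "coeff m 1 \<in> L0" using m(1) by (auto simp: coeffs_in_def)
    then have "a * c \<in> L0" "c \<in> L0" using subextD(6)[OF L0, of "- (a * c)"] by (simp_all add: mc)
    then have "(a * c) * inverse c \<in> L0" using subext_inverse[OF L0] subextD(5)[OF L0] \<open>c \<noteq> 0\<close> by blast
    then show False using a \<open>c \<noteq> 0\<close> by (simp add: L0_def mult.assoc)
  qed
  then obtain a' where a': "poly q a' = 0" using ac by blast
  have "a' \<noteq> a"
  proof
    assume "a' = a"
    moreover have "poly (pderiv m) a = poly [:- a, 1:] a * poly (pderiv q) a + poly q a * poly (pderiv [:- a, 1:]) a"
      by (simp only: q pderiv_mult poly_add poly_mult)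
    ultimately have "poly (pderiv m) a = 0" using a' by simp
    moreover have "coeffs_in L0 (pderiv m)"
    proof -
      have "of_nat n \<in> L0" for n using subextD(1)[OF L0, of "of_nat n"] by (simp add: emb_of_nat)
      then show ?thesis using m(1) subextD(5)[OF L0] unfolding coeffs_in_def coeff_pderiv by blast
    qed
    ultimately have "degree m \<le> degree (pderiv m)" using min sep by blast
    moreover have "degree (pderiv m) \<le> degree m - 1" by (rule degree_le) (auto simp: coeff_pderiv coeff_eq_0)
    moreover have "0 < degree m" using \<open>0 < degree q\<close> m(2) unfolding q by (subst degree_mult_eq) auto
    ultimately show False by simp
  qed
  moreover have "map_poly (\<lambda>x. x) m = m" by (rule map_poly_idI) simp
  then have "poly (map_poly (\<lambda>x. x) m) a' = 0" using a' by (simp add: q)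
  ultimately have r: "poly (map_poly (\<lambda>x. x) m) a' = 0" and n: "a' \<noteq> a" by blast+
  show ?thesis
  proof (rule hom_on_extend[OF id m _ r])
    fix L' \<sigma>' assume "hom_on L' \<sigma>'" "a \<in> L'" "\<sigma>' a = a'"
    then show thesis using that[of L' \<sigma>'] n by simp
  qed (rule min)
qed

text \<open>The extra element \<open>b\<close> enlarges the domain, so that a point with coordinates
  \<open>1, a, b\<close> can be conjugated as a whole.\<close>

lemma conjugate_exists2:
  assumes a: "a \<notin> range emb"
  obtains L \<sigma> where "hom_on L \<sigma>" "a \<in> L" "b \<in> L" "\<sigma> a \<noteq> a"
proof -
  obtain L \<sigma> where 1: "hom_on L \<sigma>" "a \<in> L" "\<sigma> a \<noteq> a" by (rule conjugate_exists[OF a])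
  obtain L' \<sigma>' where "hom_on L' \<sigma>'" "L \<subseteq> L'" "b \<in> L'" "\<And>x. x \<in> L \<Longrightarrow> \<sigma>' x = \<sigma> x"
    by (rule hom_on_extend_any[OF 1(1), of b]) blast
  then show ?thesis using 1 that[of L' \<sigma>'] by auto
qed

text \<open>The equations of the locus have coefficients in the base field, so conjugates of
  solutions are solutions. \<open>T a' a\<close> records that \<open>a\<close> lies in the domain
  and has conjugate \<open>a'\<close>, and is propagated through the polynomials.\<close>

lemma conjugate_singular:
  assumes G: "ternary_cubic G" and g: "\<And>n. G n \<in> range emb" and h: "hom_on L \<sigma>"
    and L: "x \<in> L" "y \<in> L" "z \<in> L" and s: "(x,y,z) \<in> singset G" and nz: "(\<sigma> x, \<sigma> y, \<sigma> z) \<noteq> (0,0,0)"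
  shows "(\<sigma> x, \<sigma> y, \<sigma> z) \<in> singset G"
proof -
  define T where "T a' a \<longleftrightarrow> a \<in> L \<and> \<sigma> a = a'" for a' a
  note sub = hom_onD(1)[OF h]
  have tn: "T (of_nat k) (of_nat k)" for k
    using subextD(1)[OF sub, of "of_nat k"] hom_onD(4)[OF h, of "of_nat k"] by (simp add: T_def emb_of_nat)
  have t: "T a' a \<Longrightarrow> T b' b \<Longrightarrow> T (a' + b') (a + b)" "T a' a \<Longrightarrow> T b' b \<Longrightarrow> T (a' * b') (a * b)" for a a' b b'
    by (auto simp: T_def subextD[OF sub] hom_onD[OF h])
  have tp: "T a' a \<Longrightarrow> T (a' ^ k) (a ^ k)" for a a' k
    using tn[of 1] t(2) by (induction k) simp_all
  have tnum: "T (numeral k) (numeral k)" for k using tn[of "numeral k"] by simp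
  have tG: "T (G n) (G n)" for n
  proof -
    obtain c where "G n = emb c" using g[of n] by blast
    then show ?thesis by (simp add: T_def subextD[OF sub] hom_onD[OF h])
  qed
  have tx: "T (\<sigma> x) x" "T (\<sigma> y) y" "T (\<sigma> z) z" using L by (simp_all add: T_def)
  have D: "T a' a \<Longrightarrow> a = 0 \<Longrightarrow> a' = 0" for a a' by (auto simp: T_def hom_onD(5)[OF h])
  have e: "tf_eval G (x,y,z) = 0" "tf_eval (tf_dx G) (x,y,z) = 0" "tf_eval (tf_dy G) (x,y,z) = 0" "tf_eval (tf_dz G) (x,y,z) = 0"
    using s by (simp_all add: singset_def)
  have "tf_eval G (\<sigma> x, \<sigma> y, \<sigma> z) = 0"
    by (rule D[OF _ e(1)], unfold tf_eval_cubic[OF G], intro t tp tnum tG tx)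
  moreover have "tf_eval (tf_dx G) (\<sigma> x, \<sigma> y, \<sigma> z) = 0"
    by (rule D[OF _ e(2)], unfold tf_eval_derivs[OF G], intro t tp tnum tG tx)
  moreover have "tf_eval (tf_dy G) (\<sigma> x, \<sigma> y, \<sigma> z) = 0"
    by (rule D[OF _ e(3)], unfold tf_eval_derivs[OF G], intro t tp tnum tG tx)
  moreover have "tf_eval (tf_dz G) (\<sigma> x, \<sigma> y, \<sigma> z) = 0"
    by (rule D[OF _ e(4)], unfold tf_eval_derivs[OF G], intro t tp tnum tG tx)
  ultimately show ?thesis using nz by (simp add: singset_def)
qed

lemma rational_if_fixed:
  assumes "\<And>L \<sigma>. hom_on L \<sigma> \<Longrightarrow> a \<in> L \<Longrightarrow> b \<in> L \<Longrightarrow> \<sigma> a = a"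
  obtains c where "a = emb c"
proof (cases "a \<in> range emb")
  case False
  then show ?thesis using conjugate_exists2[OF False, of b] assms by metis
qed blast

lemma proj_point_scale: "c \<noteq> 0 \<Longrightarrow> proj_point (c * x, c * y, c * z) = proj_point (x, y, z :: 'c)"
proof -
  assume c: "c \<noteq> 0"
  show ?thesis unfolding proj_point_def prod.case
  proof (intro set_eqI iffI)
    fix X assume "X \<in> {(l * (c * x), l * (c * y), l * (c * z)) |l. l \<noteq> 0}"
    then obtain l where "l \<noteq> 0" "X = (l * (c * x), l * (c * y), l * (c * z))" by blast
    then show "X \<in> {(l * x, l * y, l * z) |l. l \<noteq> 0}" using c by (auto intro!: exI[of _ "l * c"])
  next
    fix X assume "X \<in> {(l * x, l * y, l * z) |l. l \<noteq> 0}"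
    then obtain l where "l \<noteq> 0" "X = (l * x, l * y, l * z)" by blast
    then show "X \<in> {(l * (c * x), l * (c * y), l * (c * z)) |l. l \<noteq> 0}" using c by (auto intro!: exI[of _ "l / c"])
  qed
qed

lemma proj_line_scale: "c \<noteq> 0 \<Longrightarrow> proj_line (c * x, c * y, c * z) = proj_line (x, y, z :: 'c)"
proof -
  assume c: "c \<noteq> 0"
  have "(c * x) * u + (c * y) * v + (c * z) * w = c * (x * u + y * v + z * w)" for u v w by (simp add: algebra_simps)
  then show ?thesis unfolding proj_line_def prod.case using c by simp
qed

lemma normalise_coords:
  assumes "P \<noteq> (0,0,0)"
  obtains (1) c y z where "c \<noteq> 0" "P = (c * 1, c * y, c * z)"
    | (2) c z where "c \<noteq> 0" "P = (c * 0, c * 1, c * z)"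
    | (3) c where "c \<noteq> 0" "P = (c * 0, c * 0, c * (1::'c))"
proof -
  obtain x y z where P: "P = (x,y,z)" by (cases P)
  then consider "x \<noteq> 0" | "x = 0" "y \<noteq> 0" | "x = 0" "y = 0" "z \<noteq> 0" using assms by auto
  then show ?thesis
  proof cases
    case 1 then show ?thesis using that(1)[of x "y/x" "z/x"] P by simp
  next
    case 2 then show ?thesis using that(2)[of y "z/y"] P by simp
  next
    case 3 then show ?thesis using that(3)[of z] P by simp
  qed
qed

text \<open>Coordinates are normalised so that the first nonzero one is 1, which makes them unique.
  A point of the locus is sent back into the locus by conjugation; for a line this is applied to its
  points with coordinates such as \<open>(-b:1:0)\<close> and \<open>(-c:0:1)\<close>. Either way
  the coordinates are fixed, hence rational.\<close>

lemma singset_rational: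
  assumes G: "ternary_cubic G" and g: "\<And>n. G n \<in> range emb" and pl: "point_or_line (singset G)"
  shows "(\<exists>P. P \<noteq> (0,0,0) \<and> singset G = proj_point (map3 emb P)) \<or>
         (\<exists>L. L \<noteq> (0,0,0) \<and> singset G = proj_line (map3 emb L))"
  using pl unfolding point_or_line_def
proof (elim disjE exE conjE)
  fix P assume P: "P \<noteq> (0,0,0)" "singset G = proj_point P"
  note cs = conjugate_singular[OF G g]
  from P(1) show ?thesis
  proof (cases rule: normalise_coords)
    case (1 k b c)
    have S: "singset G = proj_point (1, b, c)" unfolding P(2) 1(2) by (rule proj_point_scale[OF 1(1)])
    have fix2: "\<sigma> b = b \<and> \<sigma> c = c" if h: "hom_on L \<sigma>" "b \<in> L" "c \<in> L" for L \<sigma>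
    proof -
      have "(1, b, c) \<in> singset G" unfolding S proj_point_def by (auto intro!: exI[of _ 1])
      from cs[OF h(1) subextD(3)[OF hom_onD(1)[OF h(1)]] h(2,3) this]
      have "(1, \<sigma> b, \<sigma> c) \<in> proj_point (1, b, c)" by (simp add: hom_onD(6)[OF h(1)] S)
      then show ?thesis by (auto simp: proj_point_def)
    qed
    obtain b' where b': "b = emb b'" by (rule rational_if_fixed[of b c]) (use fix2 in blast)+
    obtain c' where c': "c = emb c'" by (rule rational_if_fixed[of c b]) (use fix2 in blast)+
    show ?thesis by (intro disjI1 exI[of _ "(1,b',c')"]) (simp add: S b' c' map3_def emb_1)
  next
    case (2 k c)
    have S: "singset G = proj_point (0, 1, c)" unfolding P(2) 2(2) by (rule proj_point_scale[OF 2(1)])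
    have fix2: "\<sigma> c = c" if h: "hom_on L \<sigma>" "c \<in> L" for L \<sigma>
    proof -
      have "(0, 1, c) \<in> singset G" unfolding S proj_point_def by (auto intro!: exI[of _ 1])
      from cs[OF h(1) subextD(2,3)[OF hom_onD(1)[OF h(1)]] h(2) this]
      have "(0, 1, \<sigma> c) \<in> proj_point (0, 1, c)" by (simp add: hom_onD(5,6)[OF h(1)] S)
      then show ?thesis by (auto simp: proj_point_def)
    qed
    obtain c' where c': "c = emb c'" by (rule rational_if_fixed[of c c]) (use fix2 in blast)+
    show ?thesis by (intro disjI1 exI[of _ "(0,1,c')"]) (simp add: S c' map3_def emb_1 emb_0)
  next
    case (3 k)
    have S: "singset G = proj_point (0, 0, 1)" unfolding P(2) 3(2) by (rule proj_point_scale[OF 3(1)])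
    show ?thesis by (intro disjI1 exI[of _ "(0,0,1)"]) (simp add: S map3_def emb_1 emb_0)
  qed
next
  fix P assume P: "P \<noteq> (0,0,0)" "singset G = proj_line P"
  note cs = conjugate_singular[OF G g]
  from P(1) show ?thesis
  proof (cases rule: normalise_coords)
    case (1 k b c)
    have S: "singset G = proj_line (1, b, c)" unfolding P(2) 1(2) by (rule proj_line_scale[OF 1(1)])
    have fb: "\<sigma> b = b" if h: "hom_on L \<sigma>" "b \<in> L" for L \<sigma>
    proof -
      note sub = subextD[OF hom_onD(1)[OF h(1)]]
      have "(- b, 1, 0) \<in> singset G" unfolding S proj_line_def by simp
      from cs[OF h(1) sub(6)[OF h(2)] sub(3) sub(2) this]
      have "(- \<sigma> b, 1, 0) \<in> proj_line (1, b, c)" by (simp add: hom_onD(5,6)[OF h(1)] hom_onD(7)[OF h] S)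
      then show ?thesis by (simp add: proj_line_def)
    qed
    have fc: "\<sigma> c = c" if h: "hom_on L \<sigma>" "c \<in> L" for L \<sigma>
    proof -
      note sub = subextD[OF hom_onD(1)[OF h(1)]]
      have "(- c, 0, 1) \<in> singset G" unfolding S proj_line_def by simp
      from cs[OF h(1) sub(6)[OF h(2)] sub(2) sub(3) this]
      have "(- \<sigma> c, 0, 1) \<in> proj_line (1, b, c)" by (simp add: hom_onD(5,6)[OF h(1)] hom_onD(7)[OF h] S)
      then show ?thesis by (simp add: proj_line_def)
    qed
    obtain b' where b': "b = emb b'" by (rule rational_if_fixed[of b b]) (use fb in blast)+
    obtain c' where c': "c = emb c'" by (rule rational_if_fixed[of c c]) (use fc in blast)+
    show ?thesis by (intro disjI2 exI[of _ "(1,b',c')"]) (simp add: S b' c' map3_def emb_1)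
  next
    case (2 k c)
    have S: "singset G = proj_line (0, 1, c)" unfolding P(2) 2(2) by (rule proj_line_scale[OF 2(1)])
    have fc: "\<sigma> c = c" if h: "hom_on L \<sigma>" "c \<in> L" for L \<sigma>
    proof -
      note sub = subextD[OF hom_onD(1)[OF h(1)]]
      have "(0, - c, 1) \<in> singset G" unfolding S proj_line_def by simp
      from cs[OF h(1) sub(2) sub(6)[OF h(2)] sub(3) this]
      have "(0, - \<sigma> c, 1) \<in> proj_line (0, 1, c)" by (simp add: hom_onD(5,6)[OF h(1)] hom_onD(7)[OF h] S)
      then show ?thesis by (simp add: proj_line_def)
    qed
    obtain c' where c': "c = emb c'" by (rule rational_if_fixed[of c c]) (use fc in blast)+
    show ?thesis by (intro disjI2 exI[of _ "(0,1,c')"]) (simp add: S c' map3_def emb_1 emb_0)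
  next
    case (3 k)
    have S: "singset G = proj_line (0, 0, 1)" unfolding P(2) 3(2) by (rule proj_line_scale[OF 3(1)])
    show ?thesis by (intro disjI2 exI[of _ "(0,0,1)"]) (simp add: S map3_def emb_1 emb_0)
  qed
qed

end

section \<open>The procedure preserves integrality and level\<close>

locale setting = dval v for v :: "'a::field \<Rightarrow> int" +
  fixes p :: 'a and red :: "'a \<Rightarrow> 'k::field" and emb :: "'k \<Rightarrow> 'c::field"
  assumes unif: "uniformiser v p" and res: "residue_map v red"
    and perf: "perfect_field TYPE('k)" and kbar: "algebraic_closure emb"
begin

sublocale perfect_closure emb
  by standard (rule kbar, rule perf)

sublocale reduction v "\<lambda>x. emb (red x)"
proof
  fix x y assume "integral v x" "integral v y"
  then show "emb (red (x + y)) = emb (red x) + emb (red y)" "emb (red (x * y)) = emb (red x) * emb (red y)"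
    using res by (simp_all add: residue_map_def emb_add emb_mult)
next
  show "emb (red 1) = 1" using res by (simp add: residue_map_def emb_1)
next
  fix x assume "integral v x"
  then show "emb (red x) = 0 \<longleftrightarrow> val_ge v 1 x" using res by (simp add: residue_map_def emb_eq_0_iff)
qed

abbreviation \<rho> :: "'a \<Rightarrow> 'c" where "\<rho> x \<equiv> emb (red x)"

lemma p_nz: "p \<noteq> 0" and v_p: "v p = 1"
  using unif by (simp_all add: uniformiser_def)

lemma ge_p_mult: "val_ge v n (p * y) \<longleftrightarrow> val_ge v (n - 1) y"
  by (simp add: ge_mult_left[OF p_nz] v_p)

lemma int_p: "integral v p"
  by (simp add: integral_def val_ge_def v_p)

lemma ge_1_iff_p: "val_ge v 1 x \<longleftrightarrow> (\<exists>y. integral v y \<and> x = p * y)"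
proof
  assume "val_ge v 1 x"
  then have "val_ge v 1 (p * (x / p))" using p_nz by simp
  then show "\<exists>y. integral v y \<and> x = p * y" unfolding ge_p_mult integral_def
    using p_nz by (intro exI[of _ "x / p"]) simp
qed (auto simp: ge_p_mult integral_def)

lemma lift_exists: "\<exists>x. integral v x \<and> red x = c"
  using res by (simp add: residue_map_def)

lemma sing_locus_eq: "sing_locus red emb F = singset (red_form F)"
  by (simp add: sing_locus_singset tf_red_def red_form_def)

lemma red_form_subst:
  assumes "form_integral v F" "GL3_O v M"
  shows "form_integral v (tf_subst F M)" "red_form (tf_subst F M) = tf_subst (red_form F) (red_mat M)"
  using tf_subst_integral[OF assms(1), of M] GL3_O_D[OF assms(2)] by blast+

lemma det_red_GL3: "GL3_O v M \<Longrightarrow> det3 (red_mat M) \<noteq> 0"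
  by (simp add: GL3_O_iff)

lemma singset_red_subst:
  assumes "ternary_cubic F" "form_integral v F" "GL3_O v M"
  shows "X \<in> singset (red_form (tf_subst F M)) \<longleftrightarrow> vm X (red_mat M) \<in> singset (red_form F)"
  unfolding red_form_subst[OF assms(2,3)]
  by (rule singset_subst[OF infinite_closed ternary_cubic_red[OF assms(1)] det_red_GL3[OF assms(3)]])

lemma sing_locus_rational:
  assumes cubic: "ternary_cubic F" and intF: "form_integral v F" and nz: "\<not> form_val_ge v 1 F"
    and disc: "tc_disc F \<noteq> 0" and lev: "0 < tc_level v F"
  shows "(\<exists>P. P \<noteq> (0,0,0) \<and> sing_locus red emb F = proj_point (map3 emb P)) \<or>
         (\<exists>L. L \<noteq> (0,0,0) \<and> sing_locus red emb F = proj_line (map3 emb L))"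
  unfolding sing_locus_eq
proof (rule singset_rational[OF ternary_cubic_red[OF cubic]])
  show "red_form F n \<in> range emb" for n by (simp add: red_form_def)
  have "red_form F \<noteq> (\<lambda>_. 0)" using red_form_eq_0[OF intF] nz by blast
  then show "point_or_line (singset (red_form F))"
    by (rule cuspidal_point_or_line[OF ternary_cubic_red[OF cubic] cuspidal_red[OF intF disc lev]])
qed

section \<open>Moving the locus to the standard point or line\<close>

lemma GL3_O_mat9:
  assumes "integral v a" "integral v b" "integral v c" "integral v d" "integral v e" "integral v f"
    "integral v g" "integral v h" "integral v i"
    and "det3 (mat9 (\<rho> a) (\<rho> b) (\<rho> c) (\<rho> d) (\<rho> e) (\<rho> f) (\<rho> g) (\<rho> h) (\<rho> i)) \<noteq> 0"
  shows "GL3_O v (mat9 a b c d e f g h i)"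
  unfolding GL3_O_iff
proof
  show "\<forall>r<3. \<forall>s<3. integral v (mat9 a b c d e f g h i r s)" using assms by (simp add: mat9_def)
  have "red_mat (mat9 a b c d e f g h i) = mat9 (\<rho> a) (\<rho> b) (\<rho> c) (\<rho> d) (\<rho> e) (\<rho> f) (\<rho> g) (\<rho> h) (\<rho> i)"
    by (intro ext) (simp add: red_mat_def mat9_def)
  then show "det3 (red_mat (mat9 a b c d e f g h i)) \<noteq> 0" using assms by simp
qed

lemma red_mat9: "red_mat (mat9 a b c d e f g h i) = mat9 (\<rho> a) (\<rho> b) (\<rho> c) (\<rho> d) (\<rho> e) (\<rho> f) (\<rho> g) (\<rho> h) (\<rho> i)"
  by (intro ext) (simp add: red_mat_def mat9_def)

text \<open>For row vectors \<open>(1:0:0)\<close> goes to the first row of the matrix. That row is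
  a lift of the point, completed by unit vectors to a determinant that is, up to sign, the lift of a
  nonzero coordinate.\<close>

lemma move_point:
  assumes F: "ternary_cubic F" "form_integral v F" and P: "P \<noteq> (0,0,0)"
    and S: "singset (red_form F) = proj_point (map3 emb P)"
  shows "\<exists>M. GL3_O v M \<and> singset (red_form (tf_subst F M)) = proj_point (1,0,0)"
proof -
  obtain a b c where abc: "P = (a,b,c)" by (cases P)
  obtain x y z where x: "integral v x" "red x = a" and y: "integral v y" "red y = b" and z: "integral v z" "red z = c"
    using lift_exists by metis
  have "\<exists>M. GL3_O v M \<and> vm (1,0,0) (red_mat M) = map3 emb P"
  proof -
    consider "a \<noteq> 0" | "b \<noteq> 0" | "c \<noteq> 0" using P abc by auto
    then show ?thesis
    proof cases
      case 1
      then have "GL3_O v (mat9 x y z 0 1 0 0 0 1)" using x y z by (intro GL3_O_mat9) (simp_all add: det3_def emb_eq_0_iff)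
      then show ?thesis using x y z by (intro exI conjI) (assumption, simp add: red_mat9 vm_def map3_def abc)
    next
      case 2
      then have "GL3_O v (mat9 x y z 1 0 0 0 0 1)" using x y z by (intro GL3_O_mat9) (simp_all add: det3_def emb_eq_0_iff)
      then show ?thesis using x y z by (intro exI conjI) (assumption, simp add: red_mat9 vm_def map3_def abc)
    next
      case 3
      then have "GL3_O v (mat9 x y z 0 1 0 1 0 0)" using x y z by (intro GL3_O_mat9) (simp_all add: det3_def emb_eq_0_iff)
      then show ?thesis using x y z by (intro exI conjI) (assumption, simp add: red_mat9 vm_def map3_def abc)
    qed
  qed
  then obtain M where M: "GL3_O v M" "vm (1,0,0) (red_mat M) = map3 emb P" by blast
  have "singset (red_form (tf_subst F M)) = proj_point (1,0,0)"
    using singset_red_subst[OF F M(1)] vm_proj_point[OF det_red_GL3[OF M(1)], of _ "(1,0,0)"]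
    unfolding M(2) S by blast
  then show ?thesis using M(1) by blast
qed

lemma proj_line_z: "u \<noteq> 0 \<Longrightarrow> proj_line (0,0,u) = proj_line (0,0,1 :: 'c)"
  by (simp add: proj_line_def)

text \<open>The first two rows are lifts of points spanning the line, and the third is a unit vector
  off the line.\<close>

lemma move_line:
  assumes F: "ternary_cubic F" "form_integral v F" and L: "L \<noteq> (0,0,0)"
    and S: "singset (red_form F) = proj_line (map3 emb L)"
  shows "\<exists>M. GL3_O v M \<and> singset (red_form (tf_subst F M)) = proj_line (0,0,1)"
proof -
  obtain a b c where abc: "L = (a,b,c)" by (cases L)
  obtain x y z where x: "integral v x" "red x = a" and y: "integral v y" "red y = b" and z: "integral v z" "red z = c"
    using lift_exists by metis
  have i: "integral v (- x)" "integral v (- y)" "integral v (- z)" using x y z by (simp_all add: int_uminus)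
  have r: "\<rho> (- x) = - \<rho> x" "\<rho> (- y) = - \<rho> y" "\<rho> (- z) = - \<rho> z" using x y z by (simp_all add: rho_uminus)
  have "\<exists>M u. GL3_O v M \<and> u \<noteq> 0 \<and> mv (red_mat M) (map3 emb L) = (0,0,u)"
  proof -
    consider "a \<noteq> 0" | "b \<noteq> 0" | "c \<noteq> 0" using L abc by auto
    then show ?thesis
    proof cases
      case 1
      then have "GL3_O v (mat9 (- y) x 0 (- z) 0 x 1 0 0)" using x y z i by (intro GL3_O_mat9) (simp_all add: det3_def emb_eq_0_iff)
      moreover have "mv (red_mat (mat9 (- y) x 0 (- z) 0 x 1 0 0)) (map3 emb L) = (0,0,emb a)"
        using x y z by (simp add: red_mat9 mv_def map3_def abc r algebra_simps)
      ultimately show ?thesis using 1 emb_eq_0_iff by blast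
    next
      case 2
      then have "GL3_O v (mat9 y (- x) 0 0 (- z) y 0 1 0)" using x y z i by (intro GL3_O_mat9) (simp_all add: det3_def emb_eq_0_iff)
      moreover have "mv (red_mat (mat9 y (- x) 0 0 (- z) y 0 1 0)) (map3 emb L) = (0,0,emb b)"
        using x y z by (simp add: red_mat9 mv_def map3_def abc r algebra_simps)
      ultimately show ?thesis using 2 emb_eq_0_iff by blast
    next
      case 3
      then have "GL3_O v (mat9 z 0 (- x) 0 z (- y) 0 0 1)" using x y z i by (intro GL3_O_mat9) (simp_all add: det3_def emb_eq_0_iff)
      moreover have "mv (red_mat (mat9 z 0 (- x) 0 z (- y) 0 0 1)) (map3 emb L) = (0,0,emb c)"
        using x y z by (simp add: red_mat9 mv_def map3_def abc r algebra_simps)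
      ultimately show ?thesis using 3 emb_eq_0_iff by blast
    qed
  qed
  then obtain M u where M: "GL3_O v M" "u \<noteq> 0" "mv (red_mat M) (map3 emb L) = (0,0,u)" by blast
  have "singset (red_form (tf_subst F M)) = proj_line (0,0,1)"
    using singset_red_subst[OF F M(1)] vm_proj_line[OF det_red_GL3[OF M(1)], of _ "map3 emb L"]
    unfolding M(3) S proj_line_z[OF M(2)] by blast
  then show ?thesis using M(1) by blast
qed

text \<open>Both equations reduce to \<open>y^2 = x^3\<close>, and the only translation with
  \<open>u = 1\<close> preserving this equation is the trivial one. The split on 2 makes the
  argument valid in every characteristic.\<close>

lemma cusp_translation_small:
  assumes A: "val_ge v 1 a1" "val_ge v 1 a2" "val_ge v 1 a3" "val_ge v 1 a4" "val_ge v 1 a6"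
    and i: "integral v r" "integral v s" "integral v t"
    and b: "w_trans 1 r s t (a1,a2,a3,a4,a6) = (b1,b2,b3,b4,b6)"
      "val_ge v 1 b1" "val_ge v 1 b2" "val_ge v 1 b3" "val_ge v 1 b4" "val_ge v 1 b6"
  shows "val_ge v 1 r \<and> val_ge v 1 s \<and> val_ge v 1 t"
proof -
  have ia: "integral v a1" "integral v a2" "integral v a3" "integral v a4" "integral v a6"
    using A by (auto simp: integral_def elim: ge_mono)
  then have wi: "w_integral v (a1,a2,a3,a4,a6)" by (simp add: w_integral_def)
  have za: "\<rho> a1 = 0" "\<rho> a2 = 0" "\<rho> a3 = 0" "\<rho> a4 = 0" "\<rho> a6 = 0"
    using rho_eq_0 ia A by blast+
  have ib: "integral v b1" "integral v b2" "integral v b3" "integral v b4" "integral v b6"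
    using b(2-) by (auto simp: integral_def elim: ge_mono)
  have zb: "\<rho> b1 = 0" "\<rho> b2 = 0" "\<rho> b3 = 0" "\<rho> b4 = 0" "\<rho> b6 = 0"
    using rho_eq_0 ib b(2-) by blast+
  have "w_trans 1 (\<rho> r) (\<rho> s) (\<rho> t) (0,0,0,0,0) = (0,0,0,0,0)"
    using w_trans_red[OF wi i] unfolding b(1) by (simp add: map5_def za zb)
  then have e: "2 * \<rho> s = 0" "3 * \<rho> r - (\<rho> s)^2 = 0" "2 * \<rho> t = 0" "3 * (\<rho> r)^2 - 2 * \<rho> s * \<rho> t = 0" "(\<rho> r)^3 - (\<rho> t)^2 = 0"
    by (simp_all add: w_trans_def)
  have "\<rho> r = 0 \<and> \<rho> s = 0 \<and> \<rho> t = 0"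
  proof (cases "(2::'c) = 0")
    case True
    have "\<rho> r ^ 2 = 3 * \<rho> r ^ 2 - 2 * \<rho> s * \<rho> t - 2 * (\<rho> r ^ 2 - \<rho> s * \<rho> t)" by algebra
    also have "\<dots> = 0" unfolding e(4) by (simp add: True)
    finally have r: "\<rho> r = 0" by simp
    then show ?thesis using e by simp
  next
    case False
    then have "\<rho> s = 0" "\<rho> t = 0" using e by simp_all
    then show ?thesis using e by simp
  qed
  then show ?thesis using rho_eq_0 i by blast
qed


text \<open>With \<open>F (3,0,0) = p * a\<close>, the quotients of \<open>a4\<close> and
  \<open>a6\<close> by \<open>p\<close> have residues \<open>A40\<close> and \<open>A60\<close>. A
  translation by multiples of \<open>p\<close> leaves these residues alone, and positive level makes
  them zero. If the coefficient of \<open>z^3\<close> is a unit, \<open>A60\<close> is a unit times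
  \<open>a\<close>; otherwise the coefficient of \<open>y z^2\<close> is a unit and
  \<open>A40\<close> is one modulo \<open>p\<close>.\<close>

lemma square_locus_divisibility:
  assumes F: "form_integral v F" and disc: "tc_disc F \<noteq> 0" and lev: "0 < tc_level v F"
    and z: "val_ge v 1 (F (3,0,0))" "val_ge v 1 (F (2,1,0))" "val_ge v 1 (F (2,0,1))"
      "val_ge v 1 (F (1,1,1))" "val_ge v 1 (F (1,0,2))"
    and u: "\<rho> (F (1,2,0)) \<noteq> 0" "\<rho> (F (0,0,3)) \<noteq> 0 \<or> \<rho> (F (0,1,2)) \<noteq> 0"
  shows "val_ge v 2 (F (3,0,0))"
proof -
  obtain a b c d e where p: "F (3,0,0) = p * a" "F (2,1,0) = p * b" "F (2,0,1) = p * c" "F (1,1,1) = p * d" "F (1,0,2) = p * e"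
    and abc: "integral v a" "integral v b" "integral v c" "integral v d" "integral v e"
    using z unfolding ge_1_iff_p by metis
  define q f g h i where n: "q = F (1,2,0)" "f = F (0,3,0)" "g = F (0,2,1)" "h = F (0,1,2)" "i = F (0,0,3)"
  have fgh: "integral v q" "integral v f" "integral v g" "integral v h" "integral v i"
    unfolding n by (rule form_integralD[OF F])+
  note ints = abc fgh int_p
  define A1 A2 A3 A40 A41 A60 A61 where A: "A1 = d" "A2 = - (b * h) - c * g - e * q"
    "A3 = 9 * a * f * i - a * g * h - b * e * g * p - b * i * q - c * e * f * p - c * h * q"
    "A40 = - (3 * a * g * i * q) + a * h^2 * q + c * i * q^2"
    "A41 = - (3 * a * e * f * h) + a * e * g^2 - 3 * b * c * f * i + b * c * g * h + b * e * h * q + b * e^2 * f * p + b^2 * g * i + c * e * g * q + c^2 * f * h"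
    "A60 = - (a * i^2 * q^3)"
    "A61 = - (3 * a * b * d * f * h * i * p) + a * b * d * g^2 * i * p + 3 * a * b * e * f * g * i * p + 2 * a * b * e * f * h^2 * p - a * b * e * g^2 * h * p + 9 * a * b * f * i^2 * q - a * b * g * h * i * q - 3 * a * c * d * f * g * i * p + a * c * d * f * h^2 * p - a * c * e * f * g * h * p + 9 * a * c * e * f^2 * i * p + 3 * a * c * f * h * i * q - a * c * g * h^2 * q + 2 * a * c * g^2 * i * q - 3 * a * d * e * f * i * p * q + a * d * e * g * h * p * q + a * d * e^2 * f * g * p^2 + a * d * h * i * q^2 - a * d^2 * e * f * h * p^2 - a * d^2 * g * i * p * q + a * d^3 * f * i * p^2 + 2 * a * e * g * i * q^2 - a * e * h^2 * q^2 + 2 * a * e^2 * f * h * p * q - a * e^2 * g^2 * p * q - a * e^3 * f^2 * p^2 + 9 * a^2 * f * g * h * i - a^2 * f * h^3 - 27 * a^2 * f^2 * i^2 - a^2 * g^3 * i + b * c * d * e * f * h * p^2 + b * c * d * g * i * p * q - b * c * d^2 * f * i * p^2 - b * c * e * f * i * p * q - b * c * e * g * h * p * q - b * c * e^2 * f * g * p^2 - b * c * h * i * q^2 + 2 * b * c^2 * f * g * i * p - b * c^2 * f * h^2 * p + 2 * b^2 * c * f * h * i * p - b^2 * c * g^2 * i * p + b^2 * d * e * f * i * p^2 - b^2 * e * g * i * p * q - b^2 * e^2 * f * h * p^2 - b^3 * f * i^2 * p + c^2 * d * f * i * p * q - c^2 * e * f * h * p * q - c^2 * g * i * q^2 - c^3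 * f^2 * i * p"
  have iA: "integral v A1" "integral v A2" "integral v A3" "integral v A40" "integral v A41" "integral v A60" "integral v A61"
    unfolding A by (intro int_intros ints)+
  have ai: "tc_ainv F = (p * A1, p * A2, p * A3, p * (A40 + p * A41), p * (A60 + p * A61))"
    unfolding tc_ainv_def Let_def p n[symmetric] prod.inject A by (intro conjI refl; algebra)
  obtain r s t b1 b2 b3 b4 b6 where rst: "integral v r" "integral v s" "integral v t"
    and tr: "w_trans 1 r s t (tc_ainv F) = (b1,b2,b3,b4,b6)"
    and vb: "val_ge v 1 b1" "val_ge v 2 b2" "val_ge v 3 b3" "val_ge v 4 b4" "val_ge v 6 b6"
    by (rule positive_level[OF F disc lev])
  have small: "val_ge v 1 r \<and> val_ge v 1 s \<and> val_ge v 1 t"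
  proof (rule cusp_translation_small[OF _ _ _ _ _ rst tr[unfolded ai]])
    show "val_ge v 1 b1" "val_ge v 1 b2" "val_ge v 1 b3" "val_ge v 1 b4" "val_ge v 1 b6"
      using vb by (auto elim: ge_mono)
    show "val_ge v 1 (p * A1)" "val_ge v 1 (p * A2)" "val_ge v 1 (p * A3)"
      using iA by (simp_all add: ge_p_mult integral_def)
    show "val_ge v 1 (p * (A40 + p * A41))" "val_ge v 1 (p * (A60 + p * A61))"
      using int_add[OF iA(4) int_mult[OF int_p iA(5)]] int_add[OF iA(6) int_mult[OF int_p iA(7)]]
      by (simp_all add: ge_p_mult integral_def)
  qed
  then obtain r' s' t' where rst': "r = p * r'" "s = p * s'" "t = p * t'" "integral v r'" "integral v s'" "integral v t'"
    unfolding ge_1_iff_p by metis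
  define X6 where "X6 = A61 + r' * (A40 + p * A41) + p * r'^2 * A2 + p * r'^3 - t' * A3 - t'^2 - p * r' * t' * A1"
  define X4 where "X4 = A41 - s' * A3 + 2 * r' * A2 - (t' + p * r' * s') * A1 + 3 * r'^2 - 2 * s' * t'"
  have iX: "integral v X6" "integral v X4" unfolding X6_def X4_def by (intro int_intros iA int_p rst')+
  note T = tr[unfolded ai w_trans_def prod.case prod.inject rst'(1-3) div_by_1 power_one,
      THEN conjunct2, THEN conjunct2, THEN conjunct2]
  have b6: "b6 = p * (A60 + p * X6)" unfolding conjunct2[OF T, symmetric] X6_def by algebra
  have b4: "b4 = p * (A40 + p * X4)" unfolding conjunct1[OF T, symmetric] X4_def by algebra
  have low: "\<rho> y = 0" if "val_ge v 2 (p * (y + p * x))" "integral v y" "integral v x" for x y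
  proof -
    have "val_ge v 1 (y + p * x)" using that(1) by (simp add: ge_p_mult)
    moreover have "val_ge v 1 (p * x)" using that(3) by (simp add: ge_p_mult integral_def)
    ultimately have "val_ge v 1 (y + p * x - p * x)" by (rule ge_diff)
    then show ?thesis using rho_eq_0[OF that(2)] by simp
  qed
  have z6: "\<rho> A60 = 0" by (rule low[OF _ iA(6) iX(1)]) (use vb(5) in \<open>auto simp: b6 elim: ge_mono\<close>)
  have z4: "\<rho> A40 = 0" by (rule low[OF _ iA(4) iX(2)]) (use vb(4) in \<open>auto simp: b4 elim: ge_mono\<close>)
  note l = ints[THEN lifts_rho]
  have r6: "\<rho> A60 = - (\<rho> a * \<rho> i^2 * \<rho> q^3)" unfolding A
    by (rule lifts_eq) (intro lifts_intros l)
  have r4: "\<rho> A40 = - (3 * \<rho> a * \<rho> g * \<rho> i * \<rho> q) + \<rho> a * \<rho> h^2 * \<rho> q + \<rho> c * \<rho> i * \<rho> q^2" unfolding A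
    by (rule lifts_eq) (intro lifts_intros l)
  have "\<rho> a = 0"
  proof (cases "\<rho> i = 0")
    case True
    then have "\<rho> a * \<rho> h^2 * \<rho> q = 0" using r4 z4 by simp
    moreover have "\<rho> h \<noteq> 0" using u(2) True unfolding n by simp
    ultimately show ?thesis using u(1) unfolding n by simp
  next
    case False
    then show ?thesis using r6 z6 u(1) unfolding n by simp
  qed
  then have "val_ge v 1 a" using rho_eq_0[OF abc(1)] by simp
  then show ?thesis by (simp add: p(1) ge_p_mult)
qed

text \<open>The invariant \<open>a\<^sub>3\<^sup>2 + 4 a\<^sub>6\<close> is congruent modulo \<open>\<pi>\<^sup>3\<close> to the square of the coefficient of \<open>x\<^sup>3\<close> times
  the discriminant of the binary cubic.\<close>
lemma binary_locus_divisibility: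
  assumes F: "form_integral v F" and disc: "tc_disc F \<noteq> 0" and lev: "0 < tc_level v F"
    and z: "val_ge v 1 (F (3,0,0))" "val_ge v 1 (F (2,1,0))" "val_ge v 1 (F (2,0,1))"
      "val_ge v 1 (F (1,1,1))" "val_ge v 1 (F (1,0,2))" "val_ge v 1 (F (1,2,0))"
    and fghi: "\<rho> (F (0,3,0)) = f'" "\<rho> (F (0,2,1)) = g'" "\<rho> (F (0,1,2)) = h'" "\<rho> (F (0,0,3)) = i'"
    and u: "g'^2 * h'^2 - 4 * g'^3 * i' - 4 * f' * h'^3 + 18 * f' * g' * h' * i' - 27 * f'^2 * i'^2 \<noteq> 0"
  shows "val_ge v 2 (F (3,0,0))"
proof -
  obtain a b c d e q where p: "F (3,0,0) = p * a" "F (2,1,0) = p * b" "F (2,0,1) = p * c" "F (1,1,1) = p * d" "F (1,0,2) = p * e" "F (1,2,0) = p * q"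
    and abc: "integral v a" "integral v b" "integral v c" "integral v d" "integral v e" "integral v q"
    using z unfolding ge_1_iff_p by metis
  define f g h i where n: "f = F (0,3,0)" "g = F (0,2,1)" "h = F (0,1,2)" "i = F (0,0,3)"
  have fgh: "integral v f" "integral v g" "integral v h" "integral v i"
    unfolding n by (rule form_integralD[OF F])+
  note ints = abc fgh int_p
  define A1 A2 A30 A31 A4 A60 A61 where A: "A1 = d" "A2 = - (b * h) - c * g - e * p * q"
    "A30 = 9 * a * f * i - a * g * h"
    "A31 = - (b * e * g) - b * i * q - c * e * f - c * h * q"
    "A4 = - (3 * a * e * f * h) + a * e * g^2 - 3 * a * g * i * q + a * h^2 * q - 3 * b * c * f * i + b * c * g * h + b * e * h * p * q + b * e^2 * f * p + b^2 * g * i + c * e * g * p * q + c * i * p * q^2 + c^2 * f * h"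
    "A60 = 9 * a^2 * f * g * h * i - a^2 * f * h^3 - 27 * a^2 * f^2 * i^2 - a^2 * g^3 * i"
    "A61 = - (3 * a * b * d * f * h * i) + a * b * d * g^2 * i + 3 * a * b * e * f * g * i + 2 * a * b * e * f * h^2 - a * b * e * g^2 * h + 9 * a * b * f * i^2 * q - a * b * g * h * i * q - 3 * a * c * d * f * g * i + a * c * d * f * h^2 - a * c * e * f * g * h + 9 * a * c * e * f^2 * i + 3 * a * c * f * h * i * q - a * c * g * h^2 * q + 2 * a * c * g^2 * i * q - 3 * a * d * e * f * i * p * q + a * d * e * g * h * p * q + a * d * e^2 * f * g * p + a * d * h * i * p * q^2 - a * d^2 * e * f * h * p - a * d^2 * g * i * p * q + a * d^3 * f * i * p + 2 * a * e * g * i * p * q^2 - a * e * h^2 * p * q^2 + 2 * a * e^2 * f * h * p * q - a * e^2 * g^2 * p * q - a * e^3 * f^2 * p - a * i^2 * p * q^3 + b * c * d * e * f * h * p + b * c * d * g * i * p * q - b * c * d^2 * f * i * p - b * c * e * f * i * p * q - b * c * e * g * h * p * q - b * c * e^2 * f * g * p - b * c * h * i * p * q^2 + 2 * b * c^2 * f * g * i - b * c^2 * f * h^2 + 2 * b^2 * c * f * h * i - b^2 * c * g^2 * i + b^2 * d * e * f * i * p - b^2 * e * g * i * p * q - b^2 * e^2 * f * h * p - b^3 * f * i^2 + c^2 * d * f * i * p * q - c^2 * e * f * h * p * q - c^2 * g * i * p * q^2 - c^3 * f^2 * i"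
  have iA: "integral v A1" "integral v A2" "integral v A30" "integral v A31" "integral v A4" "integral v A60" "integral v A61"
    unfolding A by (intro int_intros ints)+
  have ai: "tc_ainv F = (p * A1, p * A2, p * (A30 + p * A31), p * (p * A4), p * (p * (A60 + p * A61)))"
    unfolding tc_ainv_def Let_def p n[symmetric] prod.inject A by (intro conjI refl; algebra)
  obtain r s t b1 b2 b3 b4 b6 where rst: "integral v r" "integral v s" "integral v t"
    and tr: "w_trans 1 r s t (tc_ainv F) = (b1,b2,b3,b4,b6)"
    and vb: "val_ge v 1 b1" "val_ge v 2 b2" "val_ge v 3 b3" "val_ge v 4 b4" "val_ge v 6 b6"
    by (rule positive_level[OF F disc lev])
  have ge1: "val_ge v 1 (p * x)" if "integral v x" for x using that by (simp add: ge_p_mult integral_def)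
  have small: "val_ge v 1 r \<and> val_ge v 1 s \<and> val_ge v 1 t"
  proof (rule cusp_translation_small[OF _ _ _ _ _ rst tr[unfolded ai]])
    show "val_ge v 1 b1" "val_ge v 1 b2" "val_ge v 1 b3" "val_ge v 1 b4" "val_ge v 1 b6"
      using vb by (auto elim: ge_mono)
    show "val_ge v 1 (p * A1)" "val_ge v 1 (p * A2)" "val_ge v 1 (p * (A30 + p * A31))"
        "val_ge v 1 (p * (p * A4))" "val_ge v 1 (p * (p * (A60 + p * A61)))"
      by (rule ge1, intro int_intros int_p iA)+
  qed
  then obtain r' s' t' where rst': "r = p * r'" "s = p * s'" "t = p * t'" "integral v r'" "integral v s'" "integral v t'"
    unfolding ge_1_iff_p by metis
  define X6 where "X6 = A61 + r' * A4 + r'^2 * A2 + r'^3 - t' * A31 - r' * t' * A1"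
  define X3 where "X3 = A31 + r' * A1"
  have iX: "integral v X6" "integral v X3" unfolding X6_def X3_def by (intro int_intros iA int_p rst')+
  note T = tr[unfolded ai w_trans_def prod.case prod.inject rst'(1-3) div_by_1 power_one,
      THEN conjunct2, THEN conjunct2]
  have b6: "b6 = p * (p * ((A60 - t' * A30 - t'^2) + p * X6))"
    unfolding conjunct2[OF conjunct2[OF T], symmetric] X6_def by algebra
  have b3: "b3 = p * ((A30 + 2 * t') + p * X3)" unfolding conjunct1[OF T, symmetric] X3_def by algebra
  have low: "\<rho> y = 0" if "val_ge v 1 (y + p * x)" "integral v y" "integral v x" for x y
  proof -
    have "val_ge v 1 (p * x)" using that(3) by (rule ge1)
    with that(1) have "val_ge v 1 (y + p * x - p * x)" by (rule ge_diff)
    then show ?thesis using rho_eq_0[OF that(2)] by simp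
  qed
  have i6: "integral v (A60 - t' * A30 - t'^2)" and i3: "integral v (A30 + 2 * t')"
    by (intro int_intros iA rst')+
  have z6: "\<rho> (A60 - t' * A30 - t'^2) = 0" by (rule low[OF _ i6 iX(1)]) (use vb(5) in \<open>auto simp: b6 ge_p_mult elim: ge_mono\<close>)
  have z3: "\<rho> (A30 + 2 * t') = 0" by (rule low[OF _ i3 iX(2)]) (use vb(3) in \<open>auto simp: b3 ge_p_mult elim: ge_mono\<close>)
  note l = ints[THEN lifts_rho] iA[THEN lifts_rho] rst'(4-6)[THEN lifts_rho]
  have z6': "\<rho> A60 - \<rho> t' * \<rho> A30 - \<rho> t'^2 = 0"
    unfolding z6[symmetric] by (rule lifts_eq[symmetric]) (intro lifts_intros l)
  have z3': "\<rho> A30 + 2 * \<rho> t' = 0"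
    unfolding z3[symmetric] by (rule lifts_eq[symmetric]) (intro lifts_intros l)
  note l' = ints[THEN lifts_rho]
  have fg: "\<rho> f = f'" "\<rho> g = g'" "\<rho> h = h'" "\<rho> i = i'" using fghi unfolding n by simp_all
  have r3: "\<rho> A30 = 9 * \<rho> a * f' * i' - \<rho> a * g' * h'" unfolding A fg[symmetric]
    by (rule lifts_eq) (intro lifts_intros l')
  have r6: "\<rho> A60 = 9 * \<rho> a^2 * f' * g' * h' * i' - \<rho> a^2 * f' * h'^3 - 27 * \<rho> a^2 * f'^2 * i'^2 - \<rho> a^2 * g'^3 * i'"
    unfolding A fg[symmetric] by (rule lifts_eq) (intro lifts_intros l')
  \<comment> \<open>Here \<open>t'\<close> does contribute at the order that matters; it is
    eliminated between the residues coming from \<open>b3\<close> and \<open>b6\<close>.\<close>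
  have "\<rho> A30 ^ 2 + 4 * \<rho> A60 = 0" using z3' z6' by algebra
  moreover have "\<rho> A30 ^ 2 + 4 * \<rho> A60 = \<rho> a ^ 2 * (g'^2 * h'^2 - 4 * g'^3 * i' - 4 * f' * h'^3 + 18 * f' * g' * h' * i' - 27 * f'^2 * i'^2)"
    unfolding r3 r6 by algebra
  ultimately have "\<rho> a = 0" using u by simp
  then have "val_ge v 1 a" using rho_eq_0[OF abc(1)] by simp
  then show ?thesis by (simp add: p(1) ge_p_mult)
qed

end

text \<open>Splitting off a root \<open>x\<close> factors the discriminant into the square of the
  remaining quadratic at \<open>x\<close> and the discriminant of that quadratic. The root is
  homogeneous because it may lie at infinity. The form is listed besides its derivatives because
  Euler's relation says nothing about it in characteristic 3.\<close>

lemma (in alg_closed) binary_cubic_double_root: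
  fixes f g h i :: 'c
  assumes d: "g^2 * h^2 - 4 * g^3 * i - 4 * f * h^3 + 18 * f * g * h * i - 27 * f^2 * i^2 = 0"
  obtains y z where "(y,z) \<noteq> (0,0)" "f * y^3 + g * y^2 * z + h * y * z^2 + i * z^3 = 0"
    "3 * f * y^2 + 2 * g * y * z + h * z^2 = 0" "g * y^2 + 2 * h * y * z + 3 * i * z^2 = 0"
proof (cases "f = 0")
  case True
  show ?thesis
  proof (cases "g = 0")
    case g: True
    show ?thesis by (rule that[of 1 0]) (simp_all add: True g)
  next
    case False
    have "g^2 * (h^2 - 4 * g * i) = 0" using d True by algebra
    then have D: "h^2 = 4 * g * i" using False by simp
    obtain y where y: "g * y^2 + h * y + i = 0" using quadratic_root[OF False] by blast
    have "(2 * g * y + h)^2 = 0" using y D by algebra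
    then have l: "2 * g * y + h = 0" by simp
    have m: "g * y^2 + 2 * h * y + 3 * i = 0" using y l by algebra
    have e: "g * y^2 + h * y + i = 0" by (rule y)
    show ?thesis by (rule that[of y 1]) (simp_all add: True l m e)
  qed
next
  case False
  obtain x where x: "f * x^3 + g * x^2 + h * x + i = 0" using cubic_root[OF False] by blast
  define b c where "b = g + f * x" and "c = h + g * x + f * x^2"
  have "(f * x^2 + b * x + c)^2 * (b^2 - 4 * f * c) = 0" using d x unfolding b_def c_def by algebra
  then consider "f * x^2 + b * x + c = 0" | "b^2 = 4 * f * c" by auto
  then show ?thesis
  proof cases
    case 1
    have "3 * f * x^2 + 2 * g * x + h = 0" using 1 unfolding b_def c_def by algebra
    moreover from this have "g * x^2 + 2 * h * x + 3 * i = 0" using x by algebra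
    ultimately show ?thesis using x by (intro that[of x 1]) simp_all
  next
    case 2
    obtain y where y: "f * y^2 + b * y + c = 0" using quadratic_root[OF False] by blast
    have "(2 * f * y + b)^2 = 0" using y 2 by algebra
    then have l: "2 * f * y + b = 0" by simp
    have 0: "f * y^3 + g * y^2 + h * y + i = 0"
    proof -
      have "f * y^3 + g * y^2 + h * y + i = (y - x) * (f * y^2 + b * y + c) + (f * x^3 + g * x^2 + h * x + i)"
        unfolding b_def c_def by algebra
      then show ?thesis using x y by simp
    qed
    have 1: "3 * f * y^2 + 2 * g * y + h = 0"
    proof -
      have "3 * f * y^2 + 2 * g * y + h = (f * y^2 + b * y + c) + (y - x) * (2 * f * y + b)"
        unfolding b_def c_def by algebra
      then show ?thesis using l y by simp
    qed
    have "g * y^2 + 2 * h * y + 3 * i = 0" using 0 1 by algebra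
    then show ?thesis using 0 1 by (intro that[of y 1]) simp_all
  qed
qed

text \<open>Three points of the line suffice; \<open>(1:1:0)\<close> is the one that detects the
  coefficient of \<open>x y z\<close>.\<close>

lemma singset_line_coeffs:
  fixes G :: "'c::field tform"
  assumes G: "ternary_cubic G" and S: "proj_line (0,0,1) \<subseteq> singset G"
  shows "G (3,0,0) = 0" "G (0,3,0) = 0" "G (2,1,0) = 0" "G (1,2,0) = 0" "G (2,0,1) = 0" "G (0,2,1) = 0" "G (1,1,1) = 0"
proof -
  have m: "(1,0,0) \<in> singset G" "(0,1,0) \<in> singset G" "(1,1,0) \<in> singset G"
    using S by (auto simp: proj_line_def)
  from m(1) show 1: "G (3,0,0) = 0" "G (2,1,0) = 0" "G (2,0,1) = 0"
    unfolding mem_singset[OF G] by simp_all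
  from m(2) show 2: "G (0,3,0) = 0" "G (1,2,0) = 0" "G (0,2,1) = 0"
    unfolding mem_singset[OF G] by simp_all
  from m(3) show "G (1,1,1) = 0"
    unfolding mem_singset[OF G] 1 2 by simp
qed

context setting begin

lemma rho_form: "\<rho> (F n) = red_form F n"
  by (simp add: red_form_def)

lemma rho_form_0: "form_integral v F \<Longrightarrow> red_form F n = 0 \<longleftrightarrow> val_ge v 1 (F n)"
  unfolding red_form_def using rho_eq_0[OF form_integralD] by blast

lemma level_GL3:
  assumes F: "ternary_cubic F" and disc: "tc_disc F \<noteq> 0" and M: "GL3_O v M"
  shows "tc_disc (tf_subst F M) \<noteq> 0" "tc_level v (tf_subst F M) = tc_level v F"
proof -
  have d: "det3 M \<noteq> 0" "v (det3 M) = 0" using M by (simp_all add: GL3_O_def)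
  note e = equiv_disc_level[OF d(1) F one_neq_zero disc, unfolded mult_1_left]
  show "tc_disc (tf_subst F M) \<noteq> 0" by (rule e(3))
  show "tc_level v (tf_subst F M) = tc_level v F" unfolding tc_level_def e(1,2) d(2) by simp
qed

text \<open>The double root must lie in the residue field itself, since it has to be lifted. In
  characteristic 2 it is a square root, supplied by perfectness.\<close>

lemma double_root_exists:
  assumes g: "(g111::'k)^2 = 4 * g120 * g102" and nz: "g120 \<noteq> 0"
  shows "\<exists>l. 2 * g120 * l + g111 = 0 \<and> g120 * l^2 + g111 * l + g102 = 0"
proof (cases "(2::'k) = 0")
  case True
  have "4 * g120 * g102 = 2 * (2 * g120 * g102)" by simp
  then have "g111^2 = 0" using g True by simp
  then have g0: "g111 = 0" by simp
  have "CHAR('k) dvd 2" using True of_nat_eq_0_iff_char_dvd[where ?'a = 'k, of 2] by simp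
  moreover have "CHAR('k) \<noteq> 1" using CHAR_not_1' by auto
  ultimately have "CHAR('k) = 2" using two_is_prime_nat by (auto simp: prime_nat_iff)
  then obtain l where "l^2 = - g102 / g120" using perf unfolding perfect_field_def by force
  then have "g120 * l^2 + g102 = 0" using nz by simp
  then show ?thesis using g0 True by (intro exI[of _ l]) simp
next
  case False
  define l where "l = - g111 / (2 * g120)"
  have 1: "2 * g120 * l + g111 = 0" using False nz by (simp add: l_def)
  have "4 * g120 * (g120 * l^2 + g111 * l + g102) = (2 * g120 * l + g111)^2 - (g111^2 - 4 * g120 * g102)" by algebra
  also have "\<dots> = 0" using 1 g by simp
  finally have e: "4 * g120 * (g120 * l^2 + g111 * l + g102) = 0" .
  have "(4::'k) = 2 * 2" by simp
  then have "(4::'k) \<noteq> 0" using False by (metis mult_eq_0_iff)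
  then have "g120 * l^2 + g111 * l + g102 = 0" using e nz by simp
  then show ?thesis using 1 by blast
qed

text \<open>Lifting the double root gives an integral shear that makes the tangent cone
  \<open>y^2\<close> modulo \<open>p\<close> and keeps the coefficient of \<open>x^3\<close>. As the
  locus is a single point, \<open>(0:0:1)\<close> is not singular, which provides the remaining unit
  condition.\<close>

lemma square_point_divisibility:
  assumes F: "ternary_cubic F" "form_integral v F" and disc: "tc_disc F \<noteq> 0" and lev: "0 < tc_level v F"
    and S: "singset (red_form F) = proj_point (1,0,0)" and nz: "red_form F (1,2,0) \<noteq> 0"
  shows "val_ge v 2 (F (3,0,0))"
proof -
  let ?G = "red_form F"
  note G = ternary_cubic_red[OF F(1)]
  have m: "(1,0,0) \<in> singset ?G" unfolding S proj_point_def by (auto intro!: exI[of _ 1])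
  then have z: "?G (3,0,0) = 0" "?G (2,1,0) = 0" "?G (2,0,1) = 0" using singset_100[OF G] by simp_all
  note cu = cuspidal_red[OF F(2) disc lev]
  have "emb (red (F (1,1,1)) ^ 2 - 4 * red (F (1,2,0)) * red (F (1,0,2))) = 0"
  proof -
    have "emb (4 :: 'k) = 4" using emb_of_nat[of 4] by simp
    moreover have "emb (a - b) = emb a - emb b" for a b using emb_add[of a "- b"] by (simp add: emb_uminus)
    ultimately show ?thesis using cuspidal_at_100[OF cu z] by (simp add: emb_mult emb_power red_form_def)
  qed
  then have "red (F (1,1,1)) ^ 2 = 4 * red (F (1,2,0)) * red (F (1,0,2))" by (simp add: emb_eq_0_iff)
  moreover have "red (F (1,2,0)) \<noteq> 0" using nz by (simp add: red_form_def emb_eq_0_iff)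
  ultimately obtain l0 where l0: "2 * red (F (1,2,0)) * l0 + red (F (1,1,1)) = 0"
      "red (F (1,2,0)) * l0^2 + red (F (1,1,1)) * l0 + red (F (1,0,2)) = 0"
    using double_root_exists by blast
  obtain l where l: "integral v l" "red l = l0" using lift_exists by blast
  have "emb (2 * red (F (1,2,0)) * l0 + red (F (1,1,1))) = 0"
      "emb (red (F (1,2,0)) * l0^2 + red (F (1,1,1)) * l0 + red (F (1,0,2))) = 0"
    unfolding l0 by (simp_all add: emb_0)
  then have e: "2 * ?G (1,2,0) * \<rho> l + ?G (1,1,1) = 0" "?G (1,2,0) * \<rho> l^2 + ?G (1,1,1) * \<rho> l + ?G (1,0,2) = 0"
    using emb_of_nat[of 2] by (simp_all add: emb_add emb_mult emb_power red_form_def l)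
  let ?M = "mat9 1 0 0 0 1 0 0 l 1"
  have M: "GL3_O v ?M" by (rule GL3_O_mat9) (simp_all add: l det3_def)
  let ?H = "tf_subst F ?M"
  note H = ternary_cubic_subst[OF F(1), of ?M] red_form_subst[OF F(2) M]
  have rH: "red_form ?H = tf_subst ?G (mat9 1 0 0 0 1 0 0 (\<rho> l) 1)"
    unfolding H(3) red_mat9 rho_one rho_zero ..
  have c: "red_form ?H (3,0,0) = 0" "red_form ?H (2,1,0) = 0" "red_form ?H (2,0,1) = 0"
      "red_form ?H (1,1,1) = 0" "red_form ?H (1,0,2) = 0" "red_form ?H (1,2,0) = ?G (1,2,0)"
    unfolding rH tf_subst_eq_form[OF infinite_closed G] mat9_entries' cubic_form_coeffs z using e
    by (simp_all add: algebra_simps)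
  have "(0,0,1) \<notin> singset (red_form ?H)"
  proof
    assume "(0,0,1) \<in> singset (red_form ?H)"
    then have "vm (0,0,1) (red_mat ?M) \<in> proj_point (1,0,0)"
      unfolding singset_red_subst[OF F M] S .
    then show False by (auto simp: vm_def proj_point_def red_mat9)
  qed
  then have u: "red_form ?H (0,0,3) \<noteq> 0 \<or> red_form ?H (0,1,2) \<noteq> 0"
    unfolding mem_singset[OF ternary_cubic_red[OF H(1)]]
    using c by auto
  have "val_ge v 2 (?H (3,0,0))"
    by (rule square_locus_divisibility[OF H(2)])
      (use level_GL3[OF F(1) disc M] lev c nz u rho_form_0[OF H(2)] in \<open>simp_all add: rho_form\<close>)
  moreover have "?H (3,0,0) = F (3,0,0)"
    unfolding tf_subst_eq_form[OF infinite_field F(1)] mat9_entries' cubic_form_coeffs by simp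
  ultimately show ?thesis by simp
qed

text \<open>The tangent cone at the point involves \<open>y^2\<close>, or \<open>z^2\<close>
  (reduced to the former by a swap), or vanishes. In the last case the reduction is a binary cubic
  without double roots, because a double root would be a second singular point.\<close>

lemma point_locus_divisibility:
  assumes F: "ternary_cubic F" "form_integral v F" and disc: "tc_disc F \<noteq> 0" and lev: "0 < tc_level v F"
    and S: "singset (red_form F) = proj_point (1,0,0)"
  shows "val_ge v 2 (F (3,0,0))" "val_ge v 1 (F (2,1,0))" "val_ge v 1 (F (2,0,1))"
proof -
  let ?G = "red_form F"
  note G = ternary_cubic_red[OF F(1)]
  have m: "(1,0,0) \<in> singset ?G" unfolding S proj_point_def by (auto intro!: exI[of _ 1])
  then have z: "?G (3,0,0) = 0" "?G (2,1,0) = 0" "?G (2,0,1) = 0" using singset_100[OF G] by simp_all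
  then show "val_ge v 1 (F (2,1,0))" "val_ge v 1 (F (2,0,1))" using rho_form_0[OF F(2)] by blast+
  note cu = cuspidal_at_100[OF cuspidal_red[OF F(2) disc lev] z]
  let ?S = "mat9 1 0 0 0 0 1 0 1 0 :: nat \<Rightarrow> nat \<Rightarrow> 'a"
  consider "?G (1,2,0) \<noteq> 0" | "?G (1,0,2) \<noteq> 0" | "?G (1,2,0) = 0" "?G (1,0,2) = 0" "?G (1,1,1) = 0"
    using cu by fastforce
  then show "val_ge v 2 (F (3,0,0))"
  proof cases
    case 1 then show ?thesis by (rule square_point_divisibility[OF F disc lev S])
  next
    case 2
    have M: "GL3_O v ?S" by (rule GL3_O_mat9) (simp_all add: det3_def)
    let ?H = "tf_subst F ?S"
    note H = ternary_cubic_subst[OF F(1), of ?S] red_form_subst[OF F(2) M]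
    have rS: "red_mat ?S = mat9 1 0 0 0 0 1 0 1 0" unfolding red_mat9 rho_one rho_zero ..
    have fx: "vm (1,0,0) (red_mat ?S) = (1,0,0)" by (simp add: rS vm_def)
    have SH: "singset (red_form ?H) = proj_point (1,0,0)"
      using singset_red_subst[OF F M] vm_proj_point[OF det_red_GL3[OF M], of _ "(1,0,0)"] unfolding fx S by blast
    have h: "red_form ?H (1,2,0) \<noteq> 0"
      unfolding H(3) rS tf_subst_swap12[OF infinite_closed G] cubic_form_coeffs using 2 .
    have "val_ge v 2 (?H (3,0,0))"
      by (rule square_point_divisibility[OF H(1,2) _ _ SH h]) (use level_GL3[OF F(1) disc M] lev in simp_all)
    then show ?thesis unfolding tf_subst_swap12[OF infinite_field F(1)] cubic_form_coeffs .
  next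
    case 3
    show ?thesis
    proof (rule binary_locus_divisibility[OF F(2) disc lev _ _ _ _ _ _ refl refl refl refl])
      show "val_ge v 1 (F (3,0,0))" "val_ge v 1 (F (2,1,0))" "val_ge v 1 (F (2,0,1))" "val_ge v 1 (F (1,1,1))"
          "val_ge v 1 (F (1,0,2))" "val_ge v 1 (F (1,2,0))"
        using z 3 rho_form_0[OF F(2)] by blast+
      show "(\<rho> (F (0,2,1)))\<^sup>2 * (\<rho> (F (0,1,2)))\<^sup>2 - 4 * (\<rho> (F (0,2,1))) ^ 3 * \<rho> (F (0,0,3))
          - 4 * \<rho> (F (0,3,0)) * \<rho> (F (0,1,2)) ^ 3 + 18 * \<rho> (F (0,3,0)) * \<rho> (F (0,2,1)) * \<rho> (F (0,1,2)) * \<rho> (F (0,0,3))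
          - 27 * (\<rho> (F (0,3,0)))\<^sup>2 * (\<rho> (F (0,0,3)))\<^sup>2 \<noteq> 0"
        unfolding rho_form
      proof
        assume "(?G (0,2,1))\<^sup>2 * (?G (0,1,2))\<^sup>2 - 4 * (?G (0,2,1)) ^ 3 * ?G (0,0,3)
          - 4 * ?G (0,3,0) * ?G (0,1,2) ^ 3 + 18 * ?G (0,3,0) * ?G (0,2,1) * ?G (0,1,2) * ?G (0,0,3)
          - 27 * (?G (0,3,0))\<^sup>2 * (?G (0,0,3))\<^sup>2 = 0"
        then obtain y w where yw: "(y,w) \<noteq> (0,0)"
          "?G (0,3,0) * y^3 + ?G (0,2,1) * y^2 * w + ?G (0,1,2) * y * w^2 + ?G (0,0,3) * w^3 = 0"
          "3 * ?G (0,3,0) * y^2 + 2 * ?G (0,2,1) * y * w + ?G (0,1,2) * w^2 = 0"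
          "?G (0,2,1) * y^2 + 2 * ?G (0,1,2) * y * w + 3 * ?G (0,0,3) * w^2 = 0"
          by (rule binary_cubic_double_root)
        have "(0,y,w) \<in> singset ?G"
          unfolding mem_singset[OF G] z 3
          using yw by (simp add: algebra_simps)
        then show False using yw(1) unfolding S by (auto simp: proj_point_def)
      qed
    qed
  qed
qed

lemma line_locus_divisibility:
  assumes F: "ternary_cubic F" "form_integral v F"
    and S: "proj_line (0,0,1) \<subseteq> singset (red_form F)"
  shows "val_ge v 1 (F (3,0,0))" "val_ge v 1 (F (0,3,0))" "val_ge v 1 (F (2,1,0))" "val_ge v 1 (F (1,2,0))"
    "val_ge v 1 (F (2,0,1))" "val_ge v 1 (F (0,2,1))" "val_ge v 1 (F (1,1,1))"
  using singset_line_coeffs[OF ternary_cubic_red[OF F(1)] S] rho_form_0[OF F(2)] by blast+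

text \<open>As an equivalence the step has factor \<open>p\<close> and a matrix of determinant
  \<open>1/p\<close>; for the line the roles are exchanged. The product is 1 in both cases, which is
  why the level does not change.\<close>

lemma step_point_form:
  assumes F: "ternary_cubic F"
  shows "step_point p F = (\<lambda>n. p * tf_subst F (mat9 (1/p) 0 0 0 1 0 0 0 1) n)"
proof (rule ternary_cubic_ext)
  show "ternary_cubic (step_point p F)" using F by (simp add: ternary_cubic_def step_point_def)
  show "ternary_cubic (\<lambda>n. p * tf_subst F (mat9 (1/p) 0 0 0 1 0 0 0 1) n)"
    using ternary_cubic_subst[OF F] by (simp add: ternary_cubic_def)
qed (use p_nz in \<open>simp_all only: tf_subst_diag[OF infinite_field F] cubic_form_coeffs\<close>,
     simp_all add: step_point_def power_int_def power2_eq_square power3_eq_cube field_simps)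

lemma step_line_form:
  assumes F: "ternary_cubic F"
  shows "step_line p F = (\<lambda>n. (1/p) * tf_subst F (mat9 1 0 0 0 1 0 0 0 p) n)"
proof (rule ternary_cubic_ext)
  show "ternary_cubic (step_line p F)" using F by (simp add: ternary_cubic_def step_line_def)
  show "ternary_cubic (\<lambda>n. (1/p) * tf_subst F (mat9 1 0 0 0 1 0 0 0 p) n)"
    using ternary_cubic_subst[OF F] by (simp add: ternary_cubic_def)
qed (use p_nz in \<open>simp_all only: tf_subst_diag[OF infinite_field F] cubic_form_coeffs\<close>,
     simp_all add: step_line_def power_int_def power2_eq_square power3_eq_cube field_simps)

lemma form_ge_iff:
  assumes "ternary_cubic F"
  shows "form_val_ge v n F \<longleftrightarrow> val_ge v n (F (3,0,0)) \<and> val_ge v n (F (0,3,0)) \<and> val_ge v n (F (0,0,3))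
    \<and> val_ge v n (F (2,1,0)) \<and> val_ge v n (F (2,0,1)) \<and> val_ge v n (F (1,2,0)) \<and> val_ge v n (F (0,2,1))
    \<and> val_ge v n (F (1,0,2)) \<and> val_ge v n (F (0,1,2)) \<and> val_ge v n (F (1,1,1))" (is "_ \<longleftrightarrow> ?R")
proof
  assume R: ?R
  show "form_val_ge v n F" unfolding form_val_ge_def
  proof
    fix m :: "nat \<times> nat \<times> nat" obtain i j k where m: "m = (i,j,k)" by (cases m)
    show "val_ge v n (F m)"
    proof (cases "i + j + k = 3")
      case True
      then have "i \<in> {0,1,2,3}" "j \<in> {0,1,2,3}" "k = 3 - i - j" by auto
      then show ?thesis using True R unfolding m by (auto simp: numeral_2_eq_2 numeral_3_eq_3)
    next
      case False
      then show ?thesis unfolding m homog_vanish[OF assms False] by simp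
    qed
  qed
qed (simp add: form_val_ge_def)

lemma ge_p_powi_mult: "val_ge v n (p powi m * x) \<longleftrightarrow> val_ge v (n - m) x"
proof -
  have "v (p powi m) = m"
    using p_nz v_p by (auto simp: power_int_def v_power v_inverse inverse_eq_divide)
  then show ?thesis using ge_mult_left[of "p powi m" n x] p_nz by simp
qed

lemma step_point_coeffs:
  "val_ge v n (step_point p F (i,j,k)) \<longleftrightarrow> val_ge v (n + int i - 1) (F (i,j,k))"
  unfolding step_point_def prod.case ge_p_powi_mult by (simp add: algebra_simps)

lemma step_line_coeffs:
  "val_ge v n (step_line p F (i,j,k)) \<longleftrightarrow> val_ge v (n - int k + 1) (F (i,j,k))"
  unfolding step_line_def prod.case ge_p_powi_mult by (simp add: algebra_simps)

lemma step_equiv: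
  assumes F: "ternary_cubic F" and disc: "tc_disc F \<noteq> 0" and M: "GL3_O v M"
    and D: "det3 D \<noteq> 0" and c: "c \<noteq> 0" "v (c * det3 D) = 0"
    and G: "G = (\<lambda>n. c * tf_subst (tf_subst F M) D n)"
  shows "ternary_cubic G" "tc_equiv G F" "tc_level v G = tc_level v F" "tc_disc G \<noteq> 0"
proof -
  have dM: "det3 M \<noteq> 0" "v (det3 M) = 0" using M by (simp_all add: GL3_O_def)
  have G': "G = (\<lambda>n. c * tf_subst F (mm D M) n)" unfolding G tf_subst_mm[OF infinite_field F] ..
  have dd: "det3 (mm D M) \<noteq> 0" using D dM by (simp add: det3_mm)
  show "ternary_cubic G" using ternary_cubic_subst[OF F, of "mm D M"] unfolding G' by (simp add: ternary_cubic_def)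
  show "tc_equiv G F" unfolding tc_equiv_def G' using c dd by blast
  note e = equiv_disc_level[OF dd F c(1) disc]
  have "v (c * det3 (mm D M)) = 0"
    using c D dM v_mult[of "c * det3 D" "det3 M"] by (simp add: det3_mm mult.assoc)
  then show "tc_level v G = tc_level v F" unfolding tc_level_def G' e(1,2) by simp
  show "tc_disc G \<noteq> 0" unfolding G' by (rule e(3))
qed

lemma proc_step_preserves:
  assumes F: "ternary_cubic F" "form_integral v F" and disc: "tc_disc F \<noteq> 0" and lev: "0 < tc_level v F"
    and st: "proc_step v p red emb F G"
  shows "ternary_cubic G \<and> form_integral v G \<and> tc_equiv G F \<and> tc_level v G = tc_level v F"
proof -
  obtain M where M: "GL3_O v M" and alt: "singset (red_form (tf_subst F M)) = proj_point (1,0,0) \<and> G = step_point p (tf_subst F M) \<or>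
      singset (red_form (tf_subst F M)) = proj_line (0,0,1) \<and> G = step_line p (tf_subst F M)"
    using st unfolding proc_step_def sing_locus_eq by blast
  let ?H = "tf_subst F M"
  note H = ternary_cubic_subst[OF F(1), of M] red_form_subst(1)[OF F(2) M]
  note L = level_GL3[OF F(1) disc M]
  have Hm: "val_ge v m (?H n)" if "m \<le> 0" for m n
    using form_integralD[OF H(2), of n] ge_mono that by (auto simp: integral_def)
  from alt show ?thesis
  proof
    assume A: "singset (red_form ?H) = proj_point (1,0,0) \<and> G = step_point p ?H"
    have eq: "G = (\<lambda>n. p * tf_subst ?H (mat9 (1/p) 0 0 0 1 0 0 0 1) n)" using A step_point_form[OF H(1)] by simp
    have d: "det3 (mat9 (1/p) 0 0 0 1 0 0 0 1) = 1/p" by (simp add: det3_def)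
    have E: "ternary_cubic G" "tc_equiv G F" "tc_level v G = tc_level v F"
      by (rule step_equiv[OF F(1) disc M _ p_nz _ eq]; use p_nz v_one d in simp)+
    \<comment> \<open>The step divides the coefficient of \<open>x^3\<close> by \<open>p^2\<close>
      and those of \<open>x^2 y\<close> and \<open>x^2 z\<close> by \<open>p\<close>; no other
      monomial loses anything.\<close>
    have pc: "val_ge v 2 (?H (3,0,0))" "val_ge v 1 (?H (2,1,0))" "val_ge v 1 (?H (2,0,1))"
      using point_locus_divisibility[OF H L(1)] A lev L(2) by auto
    have "form_integral v G"
      unfolding form_integral_def form_ge_iff[OF E(1)] unfolding conjunct2[OF A] step_point_coeffs
      using pc by (simp add: Hm)
    then show ?thesis using E by simp
  next
    assume A: "singset (red_form ?H) = proj_line (0,0,1) \<and> G = step_line p ?H"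
    have eq: "G = (\<lambda>n. (1/p) * tf_subst ?H (mat9 1 0 0 0 1 0 0 0 p) n)" using A step_line_form[OF H(1)] by simp
    have d: "det3 (mat9 1 0 0 0 1 0 0 0 p) = p" by (simp add: det3_def)
    have ip: "1 / p \<noteq> 0" using p_nz by simp
    have E: "ternary_cubic G" "tc_equiv G F" "tc_level v G = tc_level v F"
      by (rule step_equiv[OF F(1) disc M _ ip _ eq]; use p_nz v_one d in simp)+
    have lc: "proj_line (0,0,1) \<subseteq> singset (red_form ?H)" using A by simp
    have "form_integral v G"
      unfolding form_integral_def form_ge_iff[OF E(1)] unfolding conjunct2[OF A] step_line_coeffs
      using line_locus_divisibility[OF H lc] by (simp add: Hm)
    then show ?thesis using E by simp
  qed
qed

end

section \<open>Weights and termination\<close>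

lemma proj_point_100: "X \<in> proj_point (1,0,0) \<longleftrightarrow> (\<exists>x. x \<noteq> 0 \<and> X = (x,0,0))"
  by (auto simp: proj_point_def)

lemma tf_subst_shear_zy:
  fixes F :: "'a::field tform"
  assumes "infinite (UNIV :: 'a set)" "ternary_cubic F"
  shows "tf_subst F (mat9 1 0 0 0 1 0 0 l 1) = cubic_form
    (F (3,0,0)) (F (0,3,0)) (F (0,0,3) + l * F (0,1,2) + l^2 * F (0,2,1) + l^3 * F (0,3,0))
    (F (2,1,0)) (F (2,0,1) + l * F (2,1,0)) (F (1,2,0)) (F (0,2,1) + 3 * l * F (0,3,0))
    (F (1,0,2) + l * F (1,1,1) + l^2 * F (1,2,0)) (F (0,1,2) + 2 * l * F (0,2,1) + 3 * l^2 * F (0,3,0))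
    (F (1,1,1) + 2 * l * F (1,2,0))"
  unfolding tf_subst_eq_form[OF assms] mat9_entries' by (simp add: ac_simps)

lemma tf_subst_scale:
  "tf_subst (\<lambda>n. c * F n) M = (\<lambda>n. c * tf_subst F M n)"
  by (simp add: tf_subst_def Let_def sum_distrib_left mult.assoc)

context setting begin

text \<open>The coefficient of \<open>x\<^sup>i y\<^sup>j z\<^sup>k\<close> has valuation at least \<open>1 + a + b + c - i a - j b - k c\<close>.\<close>
definition wt :: "int \<Rightarrow> int \<Rightarrow> int \<Rightarrow> 'a tform \<Rightarrow> bool" where
  "wt a b c F \<longleftrightarrow> val_ge v (1 - 2 * a + b + c) (F (3,0,0)) \<and> val_ge v (1 + a - 2 * b + c) (F (0,3,0))
    \<and> val_ge v (1 + a + b - 2 * c) (F (0,0,3)) \<and> val_ge v (1 - a + c) (F (2,1,0)) \<and> val_ge v (1 - a + b) (F (2,0,1))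
    \<and> val_ge v (1 - b + c) (F (1,2,0)) \<and> val_ge v (1 + a - b) (F (0,2,1)) \<and> val_ge v (1 + b - c) (F (1,0,2))
    \<and> val_ge v (1 + a - c) (F (0,1,2)) \<and> val_ge v 1 (F (1,1,1))"

lemma wt_0_iff: "ternary_cubic F \<Longrightarrow> wt 0 0 0 F \<longleftrightarrow> form_val_ge v 1 F"
  unfolding form_ge_iff wt_def by auto

lemma wt_swap01:
  assumes F: "ternary_cubic F" and w: "wt a b c F"
  shows "wt b a c (tf_subst F (mat9 0 1 0 1 0 0 0 0 1))"
  using w unfolding wt_def tf_subst_swap01[OF infinite_field F] cubic_form_coeffs by (simp add: algebra_simps)

lemma wt_swap12:
  assumes F: "ternary_cubic F" and w: "wt a b c F"
  shows "wt a c b (tf_subst F (mat9 1 0 0 0 0 1 0 1 0))"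
  using w unfolding wt_def tf_subst_swap12[OF infinite_field F] cubic_form_coeffs by (simp add: algebra_simps)

text \<open>Each new coefficient only receives contributions from monomials in which some
  \<open>z\<close> is replaced by \<open>y\<close>, and their bounds are at least as strong because
  \<open>b \<le> c\<close>.\<close>

lemma wt_shear:
  assumes F: "ternary_cubic F" and w: "wt a b c F" and bc: "b \<le> c" and l: "integral v l"
  shows "wt a b c (tf_subst F (mat9 1 0 0 0 1 0 0 l 1))"
proof -
  have w': "val_ge v (1 - 2 * a + b + c) (F (3,0,0))" "val_ge v (1 + a - 2 * b + c) (F (0,3,0))"
    "val_ge v (1 + a + b - 2 * c) (F (0,0,3))" "val_ge v (1 - a + c) (F (2,1,0))" "val_ge v (1 - a + b) (F (2,0,1))"
    "val_ge v (1 - b + c) (F (1,2,0))" "val_ge v (1 + a - b) (F (0,2,1))" "val_ge v (1 + b - c) (F (1,0,2))"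
    "val_ge v (1 + a - c) (F (0,1,2))" "val_ge v 1 (F (1,1,1))"
    using w unfolding wt_def by auto
  have li: "integral v l" "integral v (l^2)" "integral v (l^3)" "integral v (2 * l)" "integral v (3 * l)" "integral v (3 * l^2)"
    by (intro int_intros l)+
  have "val_ge v (1 + a + b - 2 * c) (F (0,0,3) + l * F (0,1,2) + l^2 * F (0,2,1) + l^3 * F (0,3,0))"
    by (intro ge_add ge_int_mult li w'; (rule ge_mono[OF w'(9)] | rule ge_mono[OF w'(7)] | rule ge_mono[OF w'(2)]); use bc in simp)
  moreover have "val_ge v (1 - a + b) (F (2,0,1) + l * F (2,1,0))"
    by (intro ge_add ge_int_mult li w'; rule ge_mono[OF w'(4)]; use bc in simp)
  moreover have "val_ge v (1 + a - b) (F (0,2,1) + 3 * l * F (0,3,0))"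
    by (intro ge_add ge_int_mult[of "3 * l"] li w'; rule ge_mono[OF w'(2)]; use bc in simp)
  moreover have "val_ge v (1 + b - c) (F (1,0,2) + l * F (1,1,1) + l^2 * F (1,2,0))"
    by (intro ge_add ge_int_mult li w'; (rule ge_mono[OF w'(10)] | rule ge_mono[OF w'(6)]); use bc in simp)
  moreover have "val_ge v (1 + a - c) (F (0,1,2) + 2 * l * F (0,2,1) + 3 * l^2 * F (0,3,0))"
    by (intro ge_add ge_int_mult[of "2 * l"] ge_int_mult[of "3 * l^2"] li w'; (rule ge_mono[OF w'(7)] | rule ge_mono[OF w'(2)]); use bc in simp)
  moreover have "val_ge v 1 (F (1,1,1) + 2 * l * F (1,2,0))"
    by (intro ge_add ge_int_mult[of "2 * l"] li w'; rule ge_mono[OF w'(6)]; use bc in simp)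
  ultimately show ?thesis
    unfolding wt_def tf_subst_shear_zy[OF infinite_field F] cubic_form_coeffs using w' by simp
qed

text \<open>The first weight is normalised to 0, as only differences count. The index serves as the
  termination measure; the classes are not disjoint.\<close>

definition wt_class :: "nat \<Rightarrow> 'a tform \<Rightarrow> bool" where
  "wt_class n F \<longleftrightarrow> (n = 0 \<and> wt 0 0 0 F) \<or> (n = 1 \<and> wt 0 0 1 F) \<or> (n = 2 \<and> wt 0 1 1 F)
     \<or> (n = 3 \<and> wt 0 1 2 F) \<or> (n = 4 \<and> wt 0 2 3 F)"

text \<open>Weights refer to fixed coordinates, but the procedure determines its result only up to
  \<open>GL3_O\<close>; hence the closure under substitutions.\<close>

definition in_class :: "nat \<Rightarrow> 'a tform \<Rightarrow> bool" where
  "in_class n F \<longleftrightarrow> (\<exists>U. GL3_O v U \<and> wt_class n (tf_subst F U))"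

lemma in_class_subst:
  assumes F: "ternary_cubic F" and U: "GL3_O v U" and c: "in_class n (tf_subst F U)"
  shows "in_class n F"
proof -
  obtain W where "GL3_O v W" "wt_class n (tf_subst (tf_subst F U) W)" using c unfolding in_class_def by blast
  then show ?thesis unfolding in_class_def tf_subst_mm[OF infinite_field F] using GL3_O_mm[OF _ U] by blast
qed

lemma GL3_O_id3: "GL3_O v id3"
  by (simp add: GL3_O_def id3_def det3_def v_one)

lemma in_classI:
  assumes "ternary_cubic F" "wt_class n F"
  shows "in_class n F"
  unfolding in_class_def using assms tf_subst_id3[OF infinite_field] GL3_O_id3 by metis

lemma swap12_GL3: "GL3_O v (mat9 1 0 0 0 0 1 0 1 0)"
  by (rule GL3_O_mat9) (simp_all add: det3_def)

lemma swap01_GL3: "GL3_O v (mat9 0 1 0 1 0 0 0 0 1)"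
  by (rule GL3_O_mat9) (simp_all add: det3_def)

text \<open>Divisibility of all coefficients by \<open>p\<close> says that the reduced form is zero,
  which an invertible reduced matrix cannot change.\<close>

lemma in_class_0:
  assumes F: "ternary_cubic F" "form_integral v F" and c: "in_class 0 F"
  shows "form_val_ge v 1 F"
proof -
  obtain U where U: "GL3_O v U" "wt 0 0 0 (tf_subst F U)" using c unfolding in_class_def wt_class_def by auto
  have "form_val_ge v 1 (tf_subst F U)" using wt_0_iff[OF ternary_cubic_subst[OF F(1)]] U(2) by blast
  then have "tf_subst (red_form F) (red_mat U) = (\<lambda>_. 0)"
    using red_form_eq_0[OF red_form_subst(1)[OF F(2) U(1)]] unfolding red_form_subst(2)[OF F(2) U(1)] by blast
  then have "red_form F = tf_subst (\<lambda>_. 0) (inv3 (red_mat U))"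
    using tf_subst_inv3[OF infinite_closed ternary_cubic_red[OF F(1)] det_red_GL3[OF U(1)]] by simp
  also have "\<dots> = (\<lambda>_. 0)" by (simp add: tf_subst_def Let_def fun_eq_iff)
  finally show ?thesis using red_form_eq_0[OF F(2)] by simp
qed

lemma wt_sort:
  assumes F: "ternary_cubic F" and w: "wt a b c F"
  shows "\<exists>U a b c. GL3_O v U \<and> a \<le> b \<and> b \<le> c \<and> wt a b c (tf_subst F U)"
proof -
  let ?P = "\<lambda>F. \<exists>U a b c. GL3_O v U \<and> a \<le> b \<and> b \<le> c \<and> wt a b c (tf_subst F U)"
  have base: "?P F" if "ternary_cubic F" "wt a b c F" "a \<le> b" "b \<le> c" for F a b c
    using that GL3_O_id3 tf_subst_id3[OF infinite_field that(1)] by (metis (no_types))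
  have trans: "?P F" if F: "ternary_cubic F" and V: "GL3_O v V" and P: "?P (tf_subst F V)" for F V
    using P GL3_O_mm[OF _ V] unfolding tf_subst_mm[OF infinite_field F] by blast
  have s12: "?P F" if F: "ternary_cubic F" and w: "wt a b c F" and ab: "a \<le> b" "a \<le> c" for F a b c
  proof (cases "b \<le> c")
    case True then show ?thesis using base F w ab by blast
  next
    case False
    show ?thesis
      by (rule trans[OF F swap12_GL3], rule base[OF ternary_cubic_subst[OF F] wt_swap12[OF F w]]) (use ab False in auto)
  qed
  have s01: "?P F" if F: "ternary_cubic F" and w: "wt a b c F" and bc: "a \<le> c \<or> b \<le> c" for F a b c
  proof -
    consider "a \<le> b" "a \<le> c" | "b \<le> a" "b \<le> c" using bc by linarith
    then show ?thesis
    proof cases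
      case 1 then show ?thesis using s12 F w by blast
    next
      case 2
      show ?thesis by (rule trans[OF F swap01_GL3], rule s12[OF ternary_cubic_subst[OF F] wt_swap01[OF F w]]) (use 2 in auto)
    qed
  qed
  show ?thesis
  proof (cases "a \<le> c \<or> b \<le> c")
    case True then show ?thesis using s01 F w by blast
  next
    case False
    show ?thesis by (rule trans[OF F swap12_GL3], rule s01[OF ternary_cubic_subst[OF F] wt_swap12[OF F w]]) (use False in auto)
  qed
qed

text \<open>Bounds that are not positive follow from integrality, so large differences of weights
  may be lowered. The sign of \<open>a - 2 b + c\<close>, which governs the coefficient of
  \<open>y^3\<close>, separates \<open>(0,1,2)\<close> from \<open>(0,2,3)\<close>; in the latter
  case \<open>b - a\<close> is at least 2.\<close>

lemma wt_reduce:
  assumes F: "ternary_cubic F" "form_integral v F" and w: "wt a b c F" and o: "a \<le> b" "b \<le> c"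
  shows "\<exists>n\<le>4. wt_class n F"
proof -
  have I: "val_ge v m (F n)" if "m \<le> 0" for m n
    using form_integralD[OF F(2), of n] ge_mono that by (auto simp: integral_def)
  note W = w[unfolded wt_def]
  consider "a = b" "b = c" | "a = b" "b < c" | "a < b" "b = c" | "a < b" "2 * (b - a) \<le> c - a"
    | "a < b" "b < c" "c - a < 2 * (b - a)" using o by linarith
  then show ?thesis
  proof cases
    case 1
    have "wt 0 0 0 F" unfolding wt_def
      by (insert W, elim conjE, intro conjI; ((rule I, simp; fail) | erule ge_mono, use 1 in simp))
    then show ?thesis unfolding wt_class_def by (intro exI[of _ 0]) simp
  next
    case 2
    have "wt 0 0 1 F" unfolding wt_def
      by (insert W, elim conjE, intro conjI; ((rule I, simp; fail) | erule ge_mono, use 2 in simp))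
    then show ?thesis unfolding wt_class_def by (intro exI[of _ 1]) simp
  next
    case 3
    have "wt 0 1 1 F" unfolding wt_def
      by (insert W, elim conjE, intro conjI; ((rule I, simp; fail) | erule ge_mono, use 3 in simp))
    then show ?thesis unfolding wt_class_def by (intro exI[of _ 2]) simp
  next
    case 4
    have "wt 0 1 2 F" unfolding wt_def
      by (insert W, elim conjE, intro conjI; ((rule I, simp; fail) | erule ge_mono, use 4 in simp))
    then show ?thesis unfolding wt_class_def by (intro exI[of _ 3]) simp
  next
    case 5
    have "wt 0 2 3 F" unfolding wt_def
      by (insert W, elim conjE, intro conjI; ((rule I, simp; fail) | erule ge_mono, use 5 in simp))
    then show ?thesis unfolding wt_class_def by (intro exI[of _ 4]) simp
  qed
qed

text \<open>In the Smith form of the minimising matrix the left factor is absorbed into the integral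
  target and the right one into \<open>F\<close>. What remains is a diagonal substitution whose
  exponents are the weights.\<close>

lemma non_minimal_in_class:
  assumes F: "ternary_cubic F" "form_integral v F" and disc: "tc_disc F \<noteq> 0" and nm: "tc_non_minimal v F"
  shows "\<exists>n\<le>4. in_class n F"
proof -
  obtain G where G: "form_integral v G" "tc_equiv G F" "v (tc_disc G) < v (tc_disc F)"
    using nm unfolding tc_non_minimal_def tc_minimal_def by auto
  obtain c M where c: "c \<noteq> 0" and M: "det3 M \<noteq> 0" and eq: "G = (\<lambda>n. c * tf_subst F M n)"
    using G(2) unfolding tc_equiv_def by blast
  have neg: "v (c * det3 M) < 0" using G(3) equiv_disc_level(1)[OF M F(1) c disc] unfolding eq by simp
  obtain V x y z U where V: "GL3_O v V" and U: "GL3_O v U" and nz: "x \<noteq> 0" "y \<noteq> 0" "z \<noteq> 0"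
    and sm: "mat9 (M 0 0) (M 0 1) (M 0 2) (M 1 0) (M 1 1) (M 1 2) (M 2 0) (M 2 1) (M 2 2)
       = mm V (mm (mat9 x 0 0 0 y 0 0 0 z) U)"
    by (rule smith_valuation[OF M])
  let ?D = "mat9 x 0 0 0 y 0 0 0 z"
  let ?H = "tf_subst F U"
  note H = ternary_cubic_subst[OF F(1), of U] red_form_subst(1)[OF F(2) U]
  define K where "K = (\<lambda>n. c * tf_subst ?H ?D n)"
  have Kc: "ternary_cubic K" using ternary_cubic_subst[OF H(1), of ?D] by (simp add: K_def ternary_cubic_def)
  have dU: "det3 U \<noteq> 0" "v (det3 U) = 0" and dV: "det3 V \<noteq> 0" "v (det3 V) = 0"
    using U V by (simp_all add: GL3_O_def)
  have KG: "tf_subst K V = G"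
    unfolding K_def tf_subst_scale eq tf_subst_mat9[of F M] sm
      tf_subst_mm[OF infinite_field F(1)] tf_subst_mm[OF infinite_field H(1)] by (simp add: mm_assoc)
  have "K = tf_subst G (inv3 V)" unfolding KG[symmetric] using tf_subst_inv3[OF infinite_field Kc dV(1)] by simp
  then have Ki: "form_integral v K" using red_form_subst(1)[OF G(1) GL3_O_inv3[OF V]] by simp
  have "det3 M = det3 V * (det3 ?D * det3 U)" unfolding det3_mat9[of M] sm det3_mm ..
  moreover have "det3 ?D = x * y * z" by (simp add: det3_def)
  ultimately have vs: "v c + v x + v y + v z < 0"
    using neg nz c dU dV by (simp add: v_mult)
  have Kv: "val_ge v 0 (K n)" for n using form_integralD[OF Ki] by (simp add: integral_def)
  \<comment> \<open>A smaller discriminant means \<open>v c + v x + v y + v z < 0\<close>. By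
    integrality of the valuation this sum is at most -1, which is the origin of the 1 in
    \<open>wt\<close>.\<close>
  have ge: "val_ge v (1 + v x + v y + v z - m) t" if "val_ge v 0 (c * (s * t))" "s \<noteq> 0" "v s = m" for s t m
  proof -
    have "val_ge v (- v c - m) t" using that by (simp add: ge_mult_left[OF c] ge_mult_left[OF that(2)])
    then show ?thesis by (rule ge_mono) (use vs in simp)
  qed
  have "wt (v x) (v y) (v z) ?H"
  proof -
    have k: "val_ge v 0 (c * (x^3 * ?H (3,0,0)))" "val_ge v 0 (c * (y^3 * ?H (0,3,0)))" "val_ge v 0 (c * (z^3 * ?H (0,0,3)))"
      "val_ge v 0 (c * (x^2 * y * ?H (2,1,0)))" "val_ge v 0 (c * (x^2 * z * ?H (2,0,1)))" "val_ge v 0 (c * (x * y^2 * ?H (1,2,0)))"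
      "val_ge v 0 (c * (y^2 * z * ?H (0,2,1)))" "val_ge v 0 (c * (x * z^2 * ?H (1,0,2)))" "val_ge v 0 (c * (y * z^2 * ?H (0,1,2)))"
      "val_ge v 0 (c * (x * y * z * ?H (1,1,1)))"
      using Kv unfolding K_def tf_subst_diag[OF infinite_field H(1)] by (metis cubic_form_coeffs)+
    show ?thesis unfolding wt_def
      using ge[OF k(1), of "3 * v x"] ge[OF k(2), of "3 * v y"] ge[OF k(3), of "3 * v z"] ge[OF k(4), of "2 * v x + v y"]
        ge[OF k(5), of "2 * v x + v z"] ge[OF k(6), of "v x + 2 * v y"] ge[OF k(7), of "2 * v y + v z"]
        ge[OF k(8), of "v x + 2 * v z"] ge[OF k(9), of "v y + 2 * v z"] ge[OF k(10), of "v x + v y + v z"]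
      using nz by (simp add: v_mult v_power algebra_simps)
  qed
  from wt_sort[OF H(1) this] obtain W a b d where W: "GL3_O v W" "a \<le> b" "b \<le> d" "wt a b d (tf_subst ?H W)" by blast
  obtain n where n: "n \<le> 4" "wt_class n (tf_subst ?H W)"
    using wt_reduce[OF ternary_cubic_subst[OF H(1)] red_form_subst(1)[OF H(2) W(1)] W(4,2,3)] by blast
  have "in_class n ?H" unfolding in_class_def using W(1) n(2) by blast
  then show ?thesis using in_class_subst[OF F(1) U] n(1) by blast
qed

end

context setting begin

section \<open>Independence of the normalising matrix\<close>

lemma int_div_p: "val_ge v 1 x \<Longrightarrow> integral v (x / p)"
  using p_nz unfolding ge_1_iff_p by auto

text \<open>With \<open>D\<close> the diagonal matrix of the step, the new matrix is
  \<open>D W D^-1\<close>. It is integral because \<open>W\<close> fixes \<open>(1:0:0)\<close>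
  modulo \<open>p\<close>, so the two entries divided by \<open>p\<close> are divisible by
  it.\<close>

lemma step_point_transport:
  assumes H: "ternary_cubic H" and W: "GL3_O v W" and w: "val_ge v 1 (W 0 1)" "val_ge v 1 (W 0 2)"
  shows "\<exists>W'. GL3_O v W' \<and> step_point p (tf_subst H W) = tf_subst (step_point p H) W'"
proof -
  let ?D = "mat9 (1/p) 0 0 0 1 0 0 0 1"
  let ?W = "mat9 (W 0 0) (W 0 1) (W 0 2) (W 1 0) (W 1 1) (W 1 2) (W 2 0) (W 2 1) (W 2 2)"
  let ?V = "mat9 (W 0 0) (W 0 1 / p) (W 0 2 / p) (p * W 1 0) (W 1 1) (W 1 2) (p * W 2 0) (W 2 1) (W 2 2)"
  have iW: "integral v (W i j)" if "i < 3" "j < 3" for i j by (rule GL3_O_D[OF W that])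
  have "det3 ?V = det3 W" using p_nz by (simp add: det3_def)
  moreover have "\<forall>i<3. \<forall>j<3. integral v (?V i j)"
    using int_div_p[OF w(1)] int_div_p[OF w(2)] by (simp add: mat9_def iW int_mult int_p)
  ultimately have V: "GL3_O v ?V" using W by (simp add: GL3_O_def)
  have "mm ?D ?W = mm ?V ?D" using p_nz by (simp add: mm_mat9)
  then have "tf_subst (tf_subst H W) ?D = tf_subst (tf_subst H ?D) ?V"
    unfolding tf_subst_mat9[of H W] tf_subst_mm[OF infinite_field H] by simp
  then have "step_point p (tf_subst H W) = tf_subst (step_point p H) ?V"
    unfolding step_point_form[OF H] step_point_form[OF ternary_cubic_subst[OF H]] tf_subst_scale by simp
  then show ?thesis using V by blast
qed

lemma step_line_transport:
  assumes H: "ternary_cubic H" and W: "GL3_O v W" and w: "val_ge v 1 (W 0 2)" "val_ge v 1 (W 1 2)"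
  shows "\<exists>W'. GL3_O v W' \<and> step_line p (tf_subst H W) = tf_subst (step_line p H) W'"
proof -
  let ?D = "mat9 1 0 0 0 1 0 0 0 p"
  let ?W = "mat9 (W 0 0) (W 0 1) (W 0 2) (W 1 0) (W 1 1) (W 1 2) (W 2 0) (W 2 1) (W 2 2)"
  let ?V = "mat9 (W 0 0) (W 0 1) (W 0 2 / p) (W 1 0) (W 1 1) (W 1 2 / p) (p * W 2 0) (p * W 2 1) (W 2 2)"
  have iW: "integral v (W i j)" if "i < 3" "j < 3" for i j by (rule GL3_O_D[OF W that])
  have "det3 ?V = det3 W" using p_nz by (simp add: det3_def)
  moreover have "\<forall>i<3. \<forall>j<3. integral v (?V i j)"
    using int_div_p[OF w(1)] int_div_p[OF w(2)] by (simp add: mat9_def iW int_mult int_p)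
  ultimately have V: "GL3_O v ?V" using W by (simp add: GL3_O_def)
  have "mm ?D ?W = mm ?V ?D" using p_nz by (simp add: mm_mat9 mult.commute)
  then have "tf_subst (tf_subst H W) ?D = tf_subst (tf_subst H ?D) ?V"
    unfolding tf_subst_mat9[of H W] tf_subst_mm[OF infinite_field H] by simp
  then have "step_line p (tf_subst H W) = tf_subst (step_line p H) ?V"
    unfolding step_line_form[OF H] step_line_form[OF ternary_cubic_subst[OF H]] tf_subst_scale by simp
  then show ?thesis using V by blast
qed

lemma rho_entry_0: "GL3_O v W \<Longrightarrow> i < 3 \<Longrightarrow> j < 3 \<Longrightarrow> red_mat W i j = 0 \<Longrightarrow> val_ge v 1 (W i j)"
  using rho_eq_0[OF GL3_O_D] by (simp add: red_mat_def)

lemma change_matrix: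
  assumes F: "ternary_cubic F" and M: "GL3_O v M" and M': "GL3_O v M'"
  obtains W where "GL3_O v W" "tf_subst F M' = tf_subst (tf_subst F M) W"
proof -
  have d: "det3 M \<noteq> 0" using M by (simp add: GL3_O_def)
  let ?W = "mm M' (inv3 M)"
  have "tf_subst (tf_subst F M) ?W = tf_subst (tf_subst (tf_subst F M) (inv3 M)) M'"
    unfolding tf_subst_mm[OF infinite_field ternary_cubic_subst[OF F]] ..
  then show ?thesis
    using that[of ?W] GL3_O_mm[OF M' GL3_O_inv3[OF M]] tf_subst_inv3[OF infinite_field F d] by simp
qed

lemma proc_step_point_indep:
  assumes F: "ternary_cubic F" "form_integral v F" and M: "GL3_O v M" and M': "GL3_O v M'"
    and S: "singset (red_form (tf_subst F M)) = proj_point (1,0,0)"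
    and S': "singset (red_form (tf_subst F M')) = proj_point (1,0,0)"
  shows "\<exists>W. GL3_O v W \<and> step_point p (tf_subst F M') = tf_subst (step_point p (tf_subst F M)) W"
proof -
  let ?H = "tf_subst F M"
  note H = ternary_cubic_subst[OF F(1), of M] red_form_subst(1)[OF F(2) M]
  obtain W where W: "GL3_O v W" and e: "tf_subst F M' = tf_subst ?H W" by (rule change_matrix[OF F(1) M M'])
  have "(1,0,0) \<in> singset (red_form (tf_subst ?H W))" unfolding e[symmetric] S' proj_point_100 by auto
  then have "vm (1,0,0) (red_mat W) \<in> proj_point (1,0,0)" unfolding singset_red_subst[OF H W] S .
  then have "red_mat W 0 1 = 0" "red_mat W 0 2 = 0" by (auto simp: vm_def proj_point_100)
  then have "val_ge v 1 (W 0 1)" "val_ge v 1 (W 0 2)" using rho_entry_0[OF W] by simp_all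
  from step_point_transport[OF H(1) W this] show ?thesis unfolding e .
qed

lemma proc_step_line_indep:
  assumes F: "ternary_cubic F" "form_integral v F" and M: "GL3_O v M" and M': "GL3_O v M'"
    and S: "singset (red_form (tf_subst F M)) = proj_line (0,0,1)"
    and S': "singset (red_form (tf_subst F M')) = proj_line (0,0,1)"
  shows "\<exists>W. GL3_O v W \<and> step_line p (tf_subst F M') = tf_subst (step_line p (tf_subst F M)) W"
proof -
  let ?H = "tf_subst F M"
  note H = ternary_cubic_subst[OF F(1), of M] red_form_subst(1)[OF F(2) M]
  obtain W where W: "GL3_O v W" and e: "tf_subst F M' = tf_subst ?H W" by (rule change_matrix[OF F(1) M M'])
  have "(1,0,0) \<in> singset (red_form (tf_subst ?H W))" "(0,1,0) \<in> singset (red_form (tf_subst ?H W))"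
    unfolding e[symmetric] S' by (auto simp: proj_line_def)
  then have "vm (1,0,0) (red_mat W) \<in> proj_line (0,0,1)" "vm (0,1,0) (red_mat W) \<in> proj_line (0,0,1)"
    unfolding singset_red_subst[OF H W] S .
  then have "red_mat W 0 2 = 0" "red_mat W 1 2 = 0" by (auto simp: vm_def proj_line_def)
  then have "val_ge v 1 (W 0 2)" "val_ge v 1 (W 1 2)" using rho_entry_0[OF W] by simp_all
  from step_line_transport[OF H(1) W this] show ?thesis unfolding e .
qed

text \<open>A transition matrix would send two independent points of the line to multiples of
  \<open>(1,0,0)\<close>, contradicting invertibility modulo \<open>p\<close>.\<close>

lemma not_point_and_line:
  assumes F: "ternary_cubic F" "form_integral v F" and M: "GL3_O v M" and M': "GL3_O v M'"
    and S: "singset (red_form (tf_subst F M)) = proj_point (1,0,0)"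
    and S': "singset (red_form (tf_subst F M')) = proj_line (0,0,1)"
  shows False
proof -
  let ?H = "tf_subst F M"
  note H = ternary_cubic_subst[OF F(1), of M] red_form_subst(1)[OF F(2) M]
  obtain W where W: "GL3_O v W" and e: "tf_subst F M' = tf_subst ?H W" by (rule change_matrix[OF F(1) M M'])
  have "(1,0,0) \<in> singset (red_form (tf_subst ?H W))" "(0,1,0) \<in> singset (red_form (tf_subst ?H W))"
    unfolding e[symmetric] S' by (auto simp: proj_line_def)
  then have "vm (1,0,0) (red_mat W) \<in> proj_point (1,0,0)" "vm (0,1,0) (red_mat W) \<in> proj_point (1,0,0)"
    unfolding singset_red_subst[OF H W] S .
  then have "red_mat W 0 1 = 0" "red_mat W 0 2 = 0" "red_mat W 1 1 = 0" "red_mat W 1 2 = 0"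
    by (auto simp: vm_def proj_point_100)
  then have "det3 (red_mat W) = 0" by (simp add: det3_def)
  then show False using det_red_GL3[OF W] by simp
qed

text \<open>It suffices to follow the procedure for one normalising matrix: any two give
  \<open>GL\<^sub>3(\<O>)\<close>-equivalent results.\<close>
lemma proc_step_in_class:
  assumes F: "ternary_cubic F" "form_integral v F" and st: "proc_step v p red emb F G" and M': "GL3_O v M'"
    and alt: "(singset (red_form (tf_subst F M')) = proj_point (1,0,0) \<and> in_class m (step_point p (tf_subst F M'))) \<or>
      (singset (red_form (tf_subst F M')) = proj_line (0,0,1) \<and> in_class m (step_line p (tf_subst F M')))"
  shows "in_class m G"
proof -
  obtain M where M: "GL3_O v M" and st: "singset (red_form (tf_subst F M)) = proj_point (1,0,0) \<and> G = step_point p (tf_subst F M) \<or>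
      singset (red_form (tf_subst F M)) = proj_line (0,0,1) \<and> G = step_line p (tf_subst F M)"
    using st unfolding proc_step_def sing_locus_eq by blast
  note H = ternary_cubic_subst[OF F(1), of M]
  have cp: "ternary_cubic (step_point p (tf_subst F M))" and cl: "ternary_cubic (step_line p (tf_subst F M))"
    using H by (simp_all add: ternary_cubic_def step_point_def step_line_def)
  from st show ?thesis
  proof
    assume A: "singset (red_form (tf_subst F M)) = proj_point (1,0,0) \<and> G = step_point p (tf_subst F M)"
    then have B: "singset (red_form (tf_subst F M')) = proj_point (1,0,0)" "in_class m (step_point p (tf_subst F M'))"
      using alt not_point_and_line[OF F M M'] by blast+
    obtain W where "GL3_O v W" "step_point p (tf_subst F M') = tf_subst (step_point p (tf_subst F M)) W"
      using proc_step_point_indep[OF F M M' _ B(1)] A by blast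
    then show ?thesis using in_class_subst[OF cp] A B(2) by simp
  next
    assume A: "singset (red_form (tf_subst F M)) = proj_line (0,0,1) \<and> G = step_line p (tf_subst F M)"
    then have B: "singset (red_form (tf_subst F M')) = proj_line (0,0,1)" "in_class m (step_line p (tf_subst F M'))"
      using alt not_point_and_line[OF F M' M] by blast+
    obtain W where "GL3_O v W" "step_line p (tf_subst F M') = tf_subst (step_line p (tf_subst F M)) W"
      using proc_step_line_indep[OF F M M' _ B(1)] A by blast
    then show ?thesis using in_class_subst[OF cl] A B(2) by simp
  qed
qed

section \<open>Effect of one step on the weight classes\<close>

lemma class_step_point:
  assumes F: "ternary_cubic F" "form_integral v F" and c: "wt_class n F" and n: "2 \<le> n"
  shows "\<exists>m<n. in_class m (step_point p F)"
proof -
  have I: "val_ge v m (F k)" if "m \<le> 0" for m k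
    using form_integralD[OF F(2), of k] ge_mono that by (auto simp: integral_def)
  have cp: "ternary_cubic (step_point p F)" using F(1) by (simp add: ternary_cubic_def step_point_def)
  \<comment> \<open>The step raises the first weight by 1: \<open>(0,1,1)\<close>,
    \<open>(0,1,2)\<close>, \<open>(0,2,3)\<close> become \<open>(1,1,1)\<close>,
    \<open>(1,1,2)\<close>, \<open>(1,2,3)\<close>, that is, \<open>(0,0,0)\<close>,
    \<open>(0,0,1)\<close>, \<open>(0,1,2)\<close>.\<close>
  consider "n = 2" "wt 0 1 1 F" | "n = 3" "wt 0 1 2 F" | "n = 4" "wt 0 2 3 F"
    using c n unfolding wt_class_def by auto
  then show ?thesis
  proof cases
    case 1
    have "wt 0 0 0 (step_point p F)" unfolding wt_def step_point_coeffs
      by (insert 1(2)[unfolded wt_def], elim conjE, intro conjI; ((rule I, simp; fail) | erule ge_mono, simp))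
    then have "wt_class 0 (step_point p F)" by (simp add: wt_class_def)
    then show ?thesis using in_classI[OF cp] 1(1) by (intro exI[of _ 0]) simp
  next
    case 2
    have "wt 0 0 1 (step_point p F)" unfolding wt_def step_point_coeffs
      by (insert 2(2)[unfolded wt_def], elim conjE, intro conjI; ((rule I, simp; fail) | erule ge_mono, simp))
    then have "wt_class 1 (step_point p F)" by (simp add: wt_class_def)
    then show ?thesis using in_classI[OF cp] 2(1) by (intro exI[of _ 1]) simp
  next
    case 3
    have "wt 0 1 2 (step_point p F)" unfolding wt_def step_point_coeffs
      by (insert 3(2)[unfolded wt_def], elim conjE, intro conjI; ((rule I, simp; fail) | erule ge_mono, simp))
    then have "wt_class 3 (step_point p F)" by (simp add: wt_class_def)
    then show ?thesis using in_classI[OF cp] 3(1) by (intro exI[of _ 3]) simp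
  qed
qed

text \<open>The step lowers the third weight by 1. From \<open>(0,2,3)\<close> this gives
  \<open>(0,2,2)\<close>, which is weakened to the listed \<open>(0,1,1)\<close> using that the
  coefficients along the line are divisible by \<open>p\<close>; from \<open>(0,1,1)\<close> it
  gives \<open>(0,1,0)\<close>, which still has to be sorted.\<close>

lemma class_step_line_z:
  assumes F: "ternary_cubic F" "form_integral v F" and c: "wt_class n F" and n: "1 \<le> n"
    and S: "singset (red_form F) = proj_line (0,0,1)"
  shows "\<exists>m<n. in_class m (step_line p F)"
proof -
  have I: "val_ge v m (F k)" if "m \<le> 0" for m k
    using form_integralD[OF F(2), of k] ge_mono that by (auto simp: integral_def)
  have cp: "ternary_cubic (step_line p F)" using F(1) by (simp add: ternary_cubic_def step_line_def)
  note L = line_locus_divisibility[OF F, unfolded S, OF subset_refl]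
  consider "n = 1" "wt 0 0 1 F" | "n = 2" "wt 0 1 1 F" | "n = 3" "wt 0 1 2 F" | "n = 4" "wt 0 2 3 F"
    using c n unfolding wt_class_def by auto
  then show ?thesis
  proof cases
    case 1
    have "wt 0 0 0 (step_line p F)" unfolding wt_def step_line_coeffs
      by (insert 1(2)[unfolded wt_def] L, elim conjE, intro conjI; ((rule I, simp; fail) | erule ge_mono, simp))
    then have "wt_class 0 (step_line p F)" by (simp add: wt_class_def)
    then show ?thesis using in_classI[OF cp] 1(1) by (intro exI[of _ 0]) simp
  next
    case 2
    have "wt 0 1 0 (step_line p F)" unfolding wt_def step_line_coeffs
      by (insert 2(2)[unfolded wt_def] L, elim conjE, intro conjI; ((rule I, simp; fail) | erule ge_mono, simp))
    from wt_swap12[OF cp this] have "wt_class 1 (tf_subst (step_line p F) (mat9 1 0 0 0 0 1 0 1 0))" by (simp add: wt_class_def)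
    then have "in_class 1 (step_line p F)" unfolding in_class_def using swap12_GL3 by blast
    then show ?thesis using 2(1) by (intro exI[of _ 1]) simp
  next
    case 3
    have "wt 0 1 1 (step_line p F)" unfolding wt_def step_line_coeffs
      by (insert 3(2)[unfolded wt_def] L, elim conjE, intro conjI; ((rule I, simp; fail) | erule ge_mono, simp))
    then have "wt_class 2 (step_line p F)" by (simp add: wt_class_def)
    then show ?thesis using in_classI[OF cp] 3(1) by (intro exI[of _ 2]) simp
  next
    case 4
    have "wt 0 1 1 (step_line p F)" unfolding wt_def step_line_coeffs
      by (insert 4(2)[unfolded wt_def] L, elim conjE, intro conjI; ((rule I, simp; fail) | erule ge_mono, simp))
    then have "wt_class 2 (step_line p F)" by (simp add: wt_class_def)
    then show ?thesis using in_classI[OF cp] 4(1) by (intro exI[of _ 2]) simp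
  qed
qed

text \<open>Swapping turns the line \<open>y = 0\<close> into \<open>z = 0\<close> and the weights
  into \<open>(0,1,1)\<close>, \<open>(0,2,1)\<close> or \<open>(0,3,2)\<close>. Lowering the last
  one, together with integrality and the vanishing along the line, leaves at least
  \<open>(0,1,0)\<close> in all three cases.\<close>

lemma class_step_line_y:
  assumes F: "ternary_cubic F" "form_integral v F" and w: "wt 0 1 1 F \<or> wt 0 1 2 F \<or> wt 0 2 3 F"
    and S: "singset (red_form (tf_subst F (mat9 1 0 0 0 0 1 0 1 0))) = proj_line (0,0,1)"
  shows "in_class 1 (step_line p (tf_subst F (mat9 1 0 0 0 0 1 0 1 0)))"
proof -
  let ?S = "mat9 1 0 0 0 0 1 0 1 0 :: nat \<Rightarrow> nat \<Rightarrow> 'a"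
  let ?H = "tf_subst F ?S"
  note H = ternary_cubic_subst[OF F(1), of ?S] red_form_subst(1)[OF F(2) swap12_GL3]
  have I: "val_ge v m (?H k)" if "m \<le> 0" for m k
    using form_integralD[OF H(2), of k] ge_mono that by (auto simp: integral_def)
  have cp: "ternary_cubic (step_line p ?H)" using H(1) by (simp add: ternary_cubic_def step_line_def)
  note L = line_locus_divisibility[OF H, unfolded S, OF subset_refl]
  have "wt 0 1 1 ?H \<or> wt 0 2 1 ?H \<or> wt 0 3 2 ?H" using w wt_swap12[OF F(1)] by blast
  then have "wt 0 1 0 (step_line p ?H)"
  proof (elim disjE)
    assume a: "wt 0 1 1 ?H"
    show ?thesis unfolding wt_def step_line_coeffs
      by (insert a[unfolded wt_def] L, elim conjE, intro conjI; ((rule I, simp; fail) | erule ge_mono, simp))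
  next
    assume a: "wt 0 2 1 ?H"
    show ?thesis unfolding wt_def step_line_coeffs
      by (insert a[unfolded wt_def] L, elim conjE, intro conjI; ((rule I, simp; fail) | erule ge_mono, simp))
  next
    assume a: "wt 0 3 2 ?H"
    show ?thesis unfolding wt_def step_line_coeffs
      by (insert a[unfolded wt_def] L, elim conjE, intro conjI; ((rule I, simp; fail) | erule ge_mono, simp))
  qed
  from wt_swap12[OF cp this] have "wt_class 1 (tf_subst (step_line p ?H) ?S)" by (simp add: wt_class_def)
  then show ?thesis unfolding in_class_def using swap12_GL3 by blast
qed

lemma class_singular_100:
  assumes F: "ternary_cubic F" "form_integral v F" and c: "wt_class n F" and n: "2 \<le> n"
  shows "(1,0,0) \<in> singset (red_form F)"
proof -
  consider "wt 0 1 1 F" | "wt 0 1 2 F" | "wt 0 2 3 F" using c n unfolding wt_class_def by auto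
  then have "val_ge v 1 (F (3,0,0)) \<and> val_ge v 1 (F (2,1,0)) \<and> val_ge v 1 (F (2,0,1))"
    by cases (unfold wt_def, elim conjE, intro conjI; erule ge_mono, simp)+
  then show ?thesis using singset_100[OF ternary_cubic_red[OF F(1)]] rho_form_0[OF F(2)] by blast
qed

text \<open>In class 1 the reduction is \<open>z^2\<close> times a linear form, so the locus is
  \<open>z = 0\<close>. In higher classes \<open>(1:0:0)\<close> is singular, so the locus is this
  point or a line \<open>b y + c z = 0\<close> through it. If \<open>b\<close> is nonzero modulo
  \<open>p\<close>, a shear that respects the weights moves the line to \<open>y = 0\<close>;
  otherwise it is \<open>z = 0\<close> already.\<close>

lemma class_step:
  assumes F: "ternary_cubic F" "form_integral v F" and nz: "\<not> form_val_ge v 1 F"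
    and c: "wt_class n F" and n: "1 \<le> n" and st: "proc_step v p red emb F G"
  shows "\<exists>m<n. in_class m G"
proof (cases "n = 1")
  case True
  have "val_ge v 1 (F (3,0,0)) \<and> val_ge v 1 (F (0,3,0)) \<and> val_ge v 1 (F (2,1,0)) \<and> val_ge v 1 (F (1,2,0))
      \<and> val_ge v 1 (F (2,0,1)) \<and> val_ge v 1 (F (0,2,1)) \<and> val_ge v 1 (F (1,1,1))"
    using c True unfolding wt_class_def wt_def by (auto elim: ge_mono)
  then have z: "red_form F (3,0,0) = 0" "red_form F (0,3,0) = 0" "red_form F (2,1,0) = 0" "red_form F (1,2,0) = 0"
      "red_form F (2,0,1) = 0" "red_form F (0,2,1) = 0" "red_form F (1,1,1) = 0"
    using rho_form_0[OF F(2)] by blast+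
  have "red_form F \<noteq> (\<lambda>_. 0)" using red_form_eq_0[OF F(2)] nz by blast
  from singset_line[OF ternary_cubic_red[OF F(1)] this z]
  have S: "singset (red_form F) = proj_line (0,0,1)" .
  obtain m where "m < n" "in_class m (step_line p F)" using class_step_line_z[OF F c n S] by blast
  then show ?thesis
    using proc_step_in_class[OF F st GL3_O_id3, of m] S unfolding tf_subst_id3[OF infinite_field F(1)] by blast
next
  case False
  then have n2: "2 \<le> n" using n by simp
  note m100 = class_singular_100[OF F c n2]
  obtain M where M: "GL3_O v M" and alt: "singset (red_form (tf_subst F M)) = proj_point (1,0,0) \<or>
      singset (red_form (tf_subst F M)) = proj_line (0,0,1)"
    using st unfolding proc_step_def sing_locus_eq by blast
  define U where "U = inv3 M"
  have U: "GL3_O v U" unfolding U_def by (rule GL3_O_inv3[OF M])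
  have "det3 M \<noteq> 0" using M by (simp add: GL3_O_def)
  then have FU: "tf_subst (tf_subst F M) U = F" unfolding U_def by (rule tf_subst_inv3[OF infinite_field F(1)])
  define N where "N = red_mat U"
  have dI: "det3 N \<noteq> 0" unfolding N_def by (rule det_red_GL3[OF U])
  have S: "X \<in> singset (red_form F) \<longleftrightarrow> vm X N \<in> singset (red_form (tf_subst F M))" for X
    using singset_red_subst[OF ternary_cubic_subst[OF F(1)] red_form_subst(1)[OF F(2) M] U, of X] unfolding FU N_def .
  from alt show ?thesis
  proof
    assume P: "singset (red_form (tf_subst F M)) = proj_point (1,0,0)"
    have "singset (red_form F) = proj_point (1,0,0)"
    proof (intro set_eqI)
      fix X
      obtain x where x: "x \<noteq> 0" "vm (1,0,0) N = (x,0,0)" using m100 unfolding S P proj_point_100 by blast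
      have "X \<in> singset (red_form F) \<longleftrightarrow> vm X N \<in> proj_point (1,0,0)" unfolding S P ..
      also have "proj_point (1,0,0) = proj_point (vm (1,0,0) N)"
        unfolding x(2) using proj_point_scale[OF x(1), of 1 0 0] by simp
      also have "vm X N \<in> \<dots> \<longleftrightarrow> X \<in> proj_point (1,0,0)" by (rule vm_proj_point[OF dI])
      finally show "X \<in> singset (red_form F) \<longleftrightarrow> X \<in> proj_point (1,0,0)" .
    qed
    moreover obtain m where "m < n" "in_class m (step_point p F)" using class_step_point[OF F c n2] by blast
    ultimately show ?thesis
      using proc_step_in_class[OF F st GL3_O_id3, of m] unfolding tf_subst_id3[OF infinite_field F(1)] by blast
  next
    assume Ln: "singset (red_form (tf_subst F M)) = proj_line (0,0,1)"
    have SL: "singset (red_form F) = proj_line (mv N (0,0,1))"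
      using vm_proj_line[OF dI, of _ "(0,0,1)"] unfolding set_eq_iff S Ln by blast
    have Lc: "mv N (0,0,1) = (\<rho> (U 0 2), \<rho> (U 1 2), \<rho> (U 2 2))"
      by (simp add: mv_def red_mat_def N_def)
    have u0: "\<rho> (U 0 2) = 0" using m100 unfolding SL Lc proj_line_def by simp
    have iU: "integral v (U 1 2)" "integral v (U 2 2)" using GL3_O_D[OF U] by simp_all
    have LL: "singset (red_form F) = proj_line (0, \<rho> (U 1 2), \<rho> (U 2 2))" unfolding SL Lc u0 ..
    show ?thesis
    proof (cases "\<rho> (U 1 2) = 0")
      case True
      have "mv N (0,0,1) \<noteq> (0,0,0)"
        using mv_eq_0[OF dI, of "(0,0,1)"] by auto
      then have "\<rho> (U 2 2) \<noteq> 0" using Lc u0 True by simp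
      then have Sz: "singset (red_form F) = proj_line (0,0,1)" unfolding LL True by (rule proj_line_z)
      obtain m where "m < n" "in_class m (step_line p F)" using class_step_line_z[OF F c n Sz] by blast
      then show ?thesis
        using proc_step_in_class[OF F st GL3_O_id3, of m] Sz unfolding tf_subst_id3[OF infinite_field F(1)] by blast
    next
      case False
      define b where "b = U 1 2"
      have b: "integral v b" "\<rho> b \<noteq> 0" using iU False by (simp_all add: b_def)
      then have bu: "b \<noteq> 0" "v b = 0" using unit_iff[OF b(1)] rho_eq_0[OF b(1)] by auto
      \<comment> \<open>The shear with this slope takes the line with coordinates
        \<open>(0, b, U 2 2)\<close> to \<open>y = 0\<close>; it is integral because
        \<open>b\<close> is a unit.\<close>
      define l where "l = - (U 2 2 / b)"
      have il: "integral v l"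
      proof -
        have "integral v (1 / b)" using bu by (simp add: integral_def val_ge_def v_inverse)
        from int_mult[OF iU(2) this] show ?thesis by (simp add: l_def int_uminus)
      qed
      have lb: "\<rho> b * \<rho> l + \<rho> (U 2 2) = 0"
      proof -
        have "b * l + U 2 2 = 0" using bu by (simp add: l_def)
        then have "\<rho> (b * l + U 2 2) = 0" by simp
        then show ?thesis using b il iU by (simp add: rho_add rho_mult int_mult)
      qed
      let ?V = "mat9 1 0 0 0 1 0 0 l 1"
      let ?S = "mat9 1 0 0 0 0 1 0 1 0 :: nat \<Rightarrow> nat \<Rightarrow> 'a"
      let ?H = "tf_subst F ?V"
      have V: "GL3_O v ?V" by (rule GL3_O_mat9) (simp_all add: il det3_def)
      have VS: "GL3_O v (mm ?S ?V)" by (rule GL3_O_mm[OF swap12_GL3 V])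
      note H = ternary_cubic_subst[OF F(1), of ?V] red_form_subst(1)[OF F(2) V]
      have cs: "tf_subst F (mm ?S ?V) = tf_subst ?H ?S" unfolding tf_subst_mm[OF infinite_field F(1)] ..
      have w: "wt 0 1 1 ?H \<or> wt 0 1 2 ?H \<or> wt 0 2 3 ?H"
        using c n2 wt_shear[OF F(1) _ _ il] unfolding wt_class_def by auto
      have Sy: "singset (red_form (tf_subst ?H ?S)) = proj_line (0,0,1)"
      proof (intro set_eqI)
        fix X
        have "X \<in> singset (red_form (tf_subst ?H ?S)) \<longleftrightarrow> X \<in> proj_line (mv (red_mat ?S) (mv (red_mat ?V) (0, \<rho> b, \<rho> (U 2 2))))"
          unfolding singset_red_subst[OF H swap12_GL3] singset_red_subst[OF F V] LL b_def[symmetric]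
            vm_proj_line[OF det_red_GL3[OF V]] vm_proj_line[OF det_red_GL3[OF swap12_GL3]] ..
        also have "mv (red_mat ?V) (0, \<rho> b, \<rho> (U 2 2)) = (0, \<rho> b, 0)"
          unfolding red_mat9 mv_def using lb by (simp add: mult.commute)
        also have "mv (red_mat ?S) (0, \<rho> b, 0) = (0, 0, \<rho> b)" unfolding red_mat9 mv_def by simp
        also have "proj_line (0, 0, \<rho> b) = proj_line (0,0,1)" by (rule proj_line_z[OF b(2)])
        finally show "X \<in> singset (red_form (tf_subst ?H ?S)) \<longleftrightarrow> X \<in> proj_line (0,0,1)" .
      qed
      have "in_class 1 (step_line p (tf_subst ?H ?S))" by (rule class_step_line_y[OF H w Sy])
      then have "in_class 1 G"
        using proc_step_in_class[OF F st VS, of 1] Sy unfolding cs by blast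
      then show ?thesis using n2 by (intro exI[of _ 1]) simp
    qed
  qed
qed

lemma proc_step_subst:
  assumes F: "ternary_cubic F" and U: "GL3_O v U" and st: "proc_step v p red emb F G"
  shows "proc_step v p red emb (tf_subst F U) G"
proof -
  obtain M where M: "GL3_O v M" and alt: "(sing_locus red emb (tf_subst F M) = proj_point (1,0,0) \<and> G = step_point p (tf_subst F M)) \<or>
      (sing_locus red emb (tf_subst F M) = proj_line (0,0,1) \<and> G = step_line p (tf_subst F M))"
    using st unfolding proc_step_def by blast
  obtain W where "GL3_O v W" "tf_subst F M = tf_subst (tf_subst F U) W" by (rule change_matrix[OF F U M])
  then show ?thesis using alt unfolding proc_step_def by auto
qed

lemma in_class_step:
  assumes F: "ternary_cubic F" "form_integral v F" and nz: "\<not> form_val_ge v 1 F"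
    and c: "in_class n F" and st: "proc_step v p red emb F G"
  shows "\<exists>m<n. in_class m G"
proof -
  obtain U where U: "GL3_O v U" "wt_class n (tf_subst F U)" using c unfolding in_class_def by blast
  let ?H = "tf_subst F U"
  note H = ternary_cubic_subst[OF F(1), of U] red_form_subst(1)[OF F(2) U(1)]
  have "\<not> form_val_ge v 1 ?H"
  proof
    assume "form_val_ge v 1 ?H"
    then have "in_class 0 F" unfolding in_class_def wt_class_def using U(1) wt_0_iff[OF H(1)] by blast
    then show False using in_class_0[OF F] nz by blast
  qed
  moreover have "1 \<le> n"
  proof (rule ccontr)
    assume "\<not> 1 \<le> n"
    then have "n = 0" by simp
    then show False using in_class_0[OF F] c nz by blast
  qed
  ultimately show ?thesis using class_step[OF H _ U(2) _ proc_step_subst[OF F(1) U(1) st]] by blast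
qed

lemma four_steps:
  assumes F: "ternary_cubic F" "form_integral v F" and disc: "tc_disc F \<noteq> 0" and lev: "0 < tc_level v F"
    and nm: "tc_non_minimal v F" and Fs: "Fs 0 = F"
    and st: "\<And>i. i < 4 \<Longrightarrow> \<not> form_val_ge v 1 (Fs i) \<Longrightarrow> proc_step v p red emb (Fs i) (Fs (Suc i))"
  shows "\<exists>n\<le>4. form_val_ge v 1 (Fs n)"
proof (rule ccontr)
  assume "\<not> ?thesis"
  then have no: "\<And>i. i \<le> 4 \<Longrightarrow> \<not> form_val_ge v 1 (Fs i)" by blast
  \<comment> \<open>The class index plus the number of steps taken stays at most 4. Nonzero
    discriminant and positive level are carried along because the preservation of integrality needs
    them at every step.\<close>
  have inv: "ternary_cubic (Fs i) \<and> form_integral v (Fs i) \<and> tc_disc (Fs i) \<noteq> 0 \<and> 0 < tc_level v (Fs i)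
      \<and> (\<exists>n. n + i \<le> 4 \<and> in_class n (Fs i))" if "i \<le> 4" for i
    using that
  proof (induction i)
    case 0
    show ?case using F disc lev non_minimal_in_class[OF F disc nm] by (auto simp: Fs)
  next
    case (Suc i)
    then obtain n where IH: "ternary_cubic (Fs i)" "form_integral v (Fs i)" "tc_disc (Fs i) \<noteq> 0" "0 < tc_level v (Fs i)"
      and n: "n + i \<le> 4" "in_class n (Fs i)" by auto
    have s: "proc_step v p red emb (Fs i) (Fs (Suc i))" using st no Suc.prems by simp
    note P = proc_step_preserves[OF IH s]
    obtain c M where "c \<noteq> 0" "det3 M \<noteq> 0" "Fs (Suc i) = (\<lambda>n. c * tf_subst (Fs i) M n)"
      using P unfolding tc_equiv_def by blast
    then have "tc_disc (Fs (Suc i)) \<noteq> 0" using equiv_disc_level(3)[OF _ IH(1) _ IH(3)] by simp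
    moreover obtain m where "m < n" "in_class m (Fs (Suc i))"
      using in_class_step[OF IH(1,2) _ n(2) s] no Suc.prems by auto
    ultimately show ?case using P IH(4) n(1) by (auto intro!: exI[of _ m])
  qed
  obtain n where "n + 4 \<le> (4::nat)" "in_class n (Fs 4)" using inv[of 4] by auto
  then have "in_class 0 (Fs 4)" by simp
  then have "form_val_ge v 1 (Fs 4)" using in_class_0 inv[of 4] by blast
  then show False using no[of 4] by simp
qed

end

theorem theorem4p3:
  fixes v :: "'a::field \<Rightarrow> int" and p :: 'a
    and red :: "'a \<Rightarrow> 'k::field" and emb :: "'k \<Rightarrow> 'c::field"
    and F :: "'a tform"
  assumes val: "discrete_valuation v"
    and unif: "uniformiser v p"
    and res: "residue_map v red"
    and perf: "perfect_field TYPE('k)"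
    and kbar: "algebraic_closure emb"
    and cubic: "ternary_cubic F"
    and intF: "form_integral v F"
    and vF0: "form_val_zero v F"
    and nonsing: "tc_disc F \<noteq> 0"
    and lev: "0 < tc_level v F"
  shows
    "((\<exists>P::'k \<times> 'k \<times> 'k. P \<noteq> (0,0,0) \<and> sing_locus red emb F = proj_point (map3 emb P)) \<or>
      (\<exists>L::'k \<times> 'k \<times> 'k. L \<noteq> (0,0,0) \<and> sing_locus red emb F = proj_line (map3 emb L)))
     \<and>
     ((\<exists>M. GL3_O v M \<and>
          (sing_locus red emb (tf_subst F M) = proj_point (1,0,0) \<or>
           sing_locus red emb (tf_subst F M) = proj_line (0,0,1))) \<and>
      (\<forall>G. proc_step v p red emb F G \<longrightarrow>
          ternary_cubic G \<and> form_integral v G \<and> tc_equiv G F \<and> tc_level v G = tc_level v F))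
     \<and>
     (tc_non_minimal v F \<longrightarrow>
        (\<forall>Fs :: nat \<Rightarrow> 'a tform. Fs 0 = F \<longrightarrow>
           (\<forall>i<4. \<not> form_val_ge v 1 (Fs i) \<longrightarrow> proc_step v p red emb (Fs i) (Fs (Suc i))) \<longrightarrow>
           (\<exists>n\<le>4. form_val_ge v 1 (Fs n))))"
proof -
  interpret setting v p red emb
    by unfold_locales (rule val unif res perf kbar)+
  have nz: "\<not> form_val_ge v 1 F" using vF0 by (simp add: form_val_zero_def)
  note loc = sing_locus_rational[OF cubic intF nz nonsing lev]
  have "\<exists>M. GL3_O v M \<and> (sing_locus red emb (tf_subst F M) = proj_point (1,0,0) \<or>
           sing_locus red emb (tf_subst F M) = proj_line (0,0,1))"
    using loc move_point[OF cubic intF] move_line[OF cubic intF] unfolding sing_locus_eq by blast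
  then show ?thesis
    using loc proc_step_preserves[OF cubic intF nonsing lev] four_steps[OF cubic intF nonsing lev] by blast
qed

end
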